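(* Let $\alpha>0$. For $n\ge 1$ observe $X^{(n)}$ from the Gaussian white noise model $dX^{(n)}(t)=f(t)\,dt+n^{-1/2}\,dW(t)$, $t\in[0,1]$, with $W$ standard Brownian motion. Suppose the true $f_0$ belongs to the Besov space $B^\alpha_{\infty,\infty}[0,1]$, i.e. $\sup_{l\ge0,0\le k\le2^l-1}2^{l(1/2+\alpha)}|\langle f_0,\psi_{lk}\rangle_2|<\infty$. Let $\varphi$ be a continuous probability density on $\mathbb{R}$, strictly positive on $[-1,1]$, such that there exist $b_1,b_2,c_1,c_2,\delta>0$ with $$c_1e^{-b_1|x|^{1+\delta}}\le\varphi(x)\le c_2e^{-b_2|x|^{1+\delta}}\quad\text{for all }|x|\ge1.$$ Let the prior $\Pi$ on $f$ make the coefficients $f_{lk}=\langle f,\psi_{lk}\rangle_2$ independent, $f_{lk}$ having Lebesgue density $x\mapsto\sigma_l^{-1}\varphi(x/\sigma_l)$ on $\mathbb{R}$, where $$\sigma_l=\frac{2^{-l(1/2+\alpha)}}{(l+1)^{\mu}},\qquad \mu=\frac1{1+\delta}.$$ Then there exists $M>0$ such that for all $n\ge2$, $$E_{f_0}^n\int\|f-f_0\|_\infty\,d\Pi(f\mid X^{(n)})\le M\Big(\frac{\log n}{n}\Big)^{\alpha/(2\alpha+1)}.$$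
   Context: $\{\psi_{lk}: l\ge0,\ 0\le k\le 2^l-1\}$ is the boundary-corrected wavelet basis of $L^2[0,1]$ of Cohen–Daubechies–Vial (relabelled so that levels start at $l=0$), chosen sufficiently regular: orthonormal basis of $L^2[0,1]$; supports of diameter $\lesssim2^{-l}$; $\|\psi_{lk}\|_\infty\lesssim2^{l/2}$; $\|\sum_k|\psi_{lk}|\|_\infty\lesssim2^{l/2}$; $\psi_{lk}$ Hölder of order $S\ge\alpha$; the basis characterises $B^s_{\infty,\infty}[0,1]$, $s\le\alpha$, via the norm $\sup_{l,k}2^{l(1/2+s)}|\langle g,\psi_{lk}\rangle_2|$. Projecting onto the basis, the model is equivalent to observing $x_{lk}=f_{lk}+n^{-1/2}\varepsilon_{lk}$ with i.i.d. $N(0,1)$ errors. $\Pi(\cdot\mid X^{(n)})$ is the posterior, $E^n_{f_0}$ expectation when $f=f_0$. *)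

theory Defs
  imports "HOL-Probability.Probability"
begin

definition wav_index :: "(nat \<times> nat) set" where
  "wav_index = {(l, k). k < 2 ^ l}"

definition ip01 :: "(real \<Rightarrow> real) \<Rightarrow> (real \<Rightarrow> real) \<Rightarrow> real" where
  "ip01 g h = (LINT t:{0..1}|lborel. g t * h t)"

text \<open>The standing properties of the (boundary-corrected, CDV) wavelet basis psi l k,
  restricted to what is expressible: orthonormal basis of L2[0,1] (orthonormality plus
  Parseval identity for every square-integrable g), support diameter \<lesssim> 2^-l,
  sup-norm \<lesssim> 2^(l/2), sum over k of |psi l k| \<lesssim> 2^(l/2), and Hoelder regularity
  (of order min alpha 1, which follows from Hoelder order S \<ge> alpha on [0,1]).\<close>
definition wavelet_basis :: "(nat \<Rightarrow> nat \<Rightarrow> real \<Rightarrow> real) \<Rightarrow> real \<Rightarrow> bool" where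
  "wavelet_basis \<psi> \<alpha> \<longleftrightarrow>
     (\<forall>l k. k < 2 ^ l \<longrightarrow> \<psi> l k \<in> borel_measurable lborel) \<and>
     (\<forall>l k l' k'. k < 2 ^ l \<longrightarrow> k' < 2 ^ l' \<longrightarrow>
        ip01 (\<psi> l k) (\<psi> l' k') = (if (l, k) = (l', k') then 1 else 0)) \<and>
     (\<forall>g. g \<in> borel_measurable lborel \<longrightarrow> set_integrable lborel {0..1} (\<lambda>t. (g t)\<^sup>2) \<longrightarrow>
        ((\<lambda>(l, k). (ip01 g (\<psi> l k))\<^sup>2) has_sum ip01 g g) wav_index) \<and>
     (\<exists>C>0. \<forall>l k. k < 2 ^ l \<longrightarrow>
        (\<exists>a. \<forall>t\<in>{0..1}. \<psi> l k t \<noteq> 0 \<longrightarrow> \<bar>t - a\<bar> \<le> C * 2 powr (- real l)) \<and>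
        (\<forall>t\<in>{0..1}. \<bar>\<psi> l k t\<bar> \<le> C * 2 powr (real l / 2))) \<and>
     (\<exists>C>0. \<forall>l. \<forall>t\<in>{0..1}. (\<Sum>k<2 ^ l. \<bar>\<psi> l k t\<bar>) \<le> C * 2 powr (real l / 2)) \<and>
     (\<forall>l k. k < 2 ^ l \<longrightarrow> (\<exists>H. \<forall>s\<in>{0..1}. \<forall>t\<in>{0..1}.
        \<bar>\<psi> l k s - \<psi> l k t\<bar> \<le> H * \<bar>s - t\<bar> powr min \<alpha> 1))"

definition level_term :: "(nat \<Rightarrow> nat \<Rightarrow> real \<Rightarrow> real) \<Rightarrow> (nat \<times> nat \<Rightarrow> real) \<Rightarrow> real \<Rightarrow> nat \<Rightarrow> real" where
  "level_term \<psi> \<theta> t l = (\<Sum>k<2 ^ l. \<theta> (l, k) * \<psi> l k t)"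

definition sup_dist :: "(nat \<Rightarrow> nat \<Rightarrow> real \<Rightarrow> real) \<Rightarrow> (real \<Rightarrow> real) \<Rightarrow> (nat \<times> nat \<Rightarrow> real) \<Rightarrow> ennreal" where
  "sup_dist \<psi> f0 \<theta> =
     (if AE t in restrict_space lborel {0..1}. summable (level_term \<psi> \<theta> t)
      then esssup (restrict_space lborel {0..1})
             (\<lambda>t. ennreal \<bar>suminf (level_term \<psi> \<theta> t) - f0 t\<bar>)
      else \<infinity>)"

definition coef_space :: "(nat \<times> nat \<Rightarrow> real) measure" where
  "coef_space = PiM wav_index (\<lambda>_. borel)"

definition wav_prior :: "(real \<Rightarrow> real) \<Rightarrow> (nat \<Rightarrow> real) \<Rightarrow> (nat \<times> nat \<Rightarrow> real) measure" where
  "wav_prior \<phi> \<sigma> = PiM wav_index (\<lambda>(l, k). density lborel (\<lambda>x. ennreal (\<phi> (x / \<sigma> l) / \<sigma> l)))"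

definition obs_law :: "nat \<Rightarrow> (nat \<times> nat \<Rightarrow> real) \<Rightarrow> (nat \<times> nat \<Rightarrow> real) measure" where
  "obs_law n \<theta> = PiM wav_index (\<lambda>i. density lborel (normal_density (\<theta> i) (1 / sqrt (real n))))"

text \<open>K is a version of the posterior distribution (a Markov kernel from observations to
  parameters) of the Bayesian model theta ~ prior, X | theta ~ obs_law n theta:
  P(theta \<in> A, X \<in> B) = E[ 1_B(X) K(X)(A) ] for all measurable A, B.\<close>
definition is_posterior :: "(nat \<times> nat \<Rightarrow> real) measure \<Rightarrow> ((nat \<times> nat \<Rightarrow> real) \<Rightarrow> (nat \<times> nat \<Rightarrow> real) measure)
     \<Rightarrow> ((nat \<times> nat \<Rightarrow> real) \<Rightarrow> (nat \<times> nat \<Rightarrow> real) measure) \<Rightarrow> bool" where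
  "is_posterior prior P K \<longleftrightarrow>
     K \<in> coef_space \<rightarrow>\<^sub>M prob_algebra prior \<and>
     (\<forall>A\<in>sets prior. \<forall>B\<in>sets coef_space.
        (\<integral>\<^sup>+ \<theta>. indicator A \<theta> * emeasure (P \<theta>) B \<partial>prior) =
        (\<integral>\<^sup>+ \<theta>. (\<integral>\<^sup>+ x. indicator B x * emeasure (K x) A \<partial>P \<theta>) \<partial>prior))"

end

theory Submission
  imports Defs
begin

text \<open>Under the product prior the posterior factorises over the coefficients, so everything reduces to
  one-dimensional bounds: the marginal likelihood of a coefficient at level \<open>l\<close> is at least
  \<open>exp (-C (l + 1)) / sqrt n\<close> times the likelihood of the truth, and hence posterior expectations are
  at most the inverse of this factor times prior expectations. At levels \<open>l\<close> with
  \<open>2 ^ l \<le> (n / ln n) powr (1 / (2 \<alpha> + 1))\<close> Gaussian tails beat this factor once the deviation exceeds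
  a large multiple of \<open>sqrt (ln n / n)\<close>; at higher levels the tails of \<open>\<phi>\<close> do so beyond a large
  multiple of \<open>2 powr (- l (1/2 + \<alpha>))\<close>, which is exactly where the logarithmic factor in \<open>\<sigma>\<^sub>l\<close> enters.
  Summing the maximal deviation of each level against \<open>2 powr (l/2)\<close> gives the rate. A posterior is
  only determined up to null sets of the marginal law of the data, so one also needs the law of the
  data under the truth to be absolutely continuous with respect to that marginal law.\<close>

section \<open>Measure-theoretic preliminaries\<close>

lemma ennreal_le_sqrtI:
  assumes "x\<^sup>2 \<le> ennreal z"
  shows "x \<le> ennreal (sqrt z)"
proof (cases x)
  case (real r)
  with assms have "ennreal (r\<^sup>2) \<le> ennreal z" by (simp add: ennreal_power)
  with real show ?thesis
    by (cases "0 \<le> z") (auto simp: ennreal_neg intro!: ennreal_leI real_le_rsqrt)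
qed (use assms in \<open>simp add: power2_eq_square ennreal_top_mult top_unique\<close>)

lemma (in prob_space) nn_integral_square_le:
  assumes [measurable]: "f \<in> borel_measurable M"
  shows "(\<integral>\<^sup>+x. f x \<partial>M)\<^sup>2 \<le> (\<integral>\<^sup>+x. (f x)\<^sup>2 \<partial>M)"
  using Cauchy_Schwarz_nn_integral[of f M "\<lambda>_. 1"] by (simp add: emeasure_space_1)

lemma emeasure_density_square_le:
  assumes [measurable]: "f \<in> borel_measurable M" "A \<in> sets M"
  shows "(emeasure (density M f) A)\<^sup>2 \<le> (\<integral>\<^sup>+x. (f x)\<^sup>2 \<partial>M) * emeasure M A"
proof -
  have "(emeasure (density M f) A)\<^sup>2 = (\<integral>\<^sup>+x. f x * indicator A x \<partial>M)\<^sup>2"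
    by (simp add: emeasure_density)
  also have "\<dots> \<le> (\<integral>\<^sup>+x. (f x)\<^sup>2 \<partial>M) * (\<integral>\<^sup>+x. (indicator A x)\<^sup>2 \<partial>M)"
    by (rule Cauchy_Schwarz_nn_integral) measurable
  also have "(\<integral>\<^sup>+x. (indicator A x :: ennreal)\<^sup>2 \<partial>M) = (\<integral>\<^sup>+x. indicator A x \<partial>M)"
    by (intro nn_integral_cong) (simp add: indicator_def)
  finally show ?thesis by simp
qed

lemma emeasure_UN_leI:
  assumes sets: "\<And>i::nat. C i \<in> sets M" and partial_le: "\<And>n. emeasure M (\<Union>i<n. C i) \<le> b"
  shows "emeasure M (\<Union>i. C i) \<le> b"
proof -
  have "(\<Union>i. C i) = (\<Union>n. \<Union>i<n. C i)"
    by (auto intro: lessI)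
  also have "emeasure M \<dots> = (SUP n. emeasure M (\<Union>i<n. C i))"
    using sets by (intro SUP_emeasure_incseq[symmetric]) (force simp: incseq_def)+
  also have "\<dots> \<le> b"
    by (intro SUP_least partial_le)
  finally show ?thesis .
qed

lemma measure_eqI_greaterThan_Rats:
  assumes M_finite: "finite_measure M" "sets M = sets borel" and N_sets: "sets N = sets borel"
    and emeasure_eq: "\<And>q. q \<in> \<rat> \<Longrightarrow> emeasure M {q<..} = emeasure N {q<..}"
  shows "M = (N :: real measure)"
proof (rule measure_eqI_generator_eq_countable)
  let ?E = "greaterThan ` \<rat> :: real set set"
  have "borel = sigma UNIV ?E"
  proof (rule borel_eq_sigmaI1[OF borel_Ioi])
    fix X :: "real set" assume "X \<in> range greaterThan"
    then obtain x where "X = {x<..}" by auto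
    also have "\<dots> = (\<Union>q\<in>{q\<in>\<rat>. x < q}. {q<..})"
      using Rats_dense_in_real[of x] by (auto intro: less_trans)
    also have "\<dots> \<in> sets (sigma UNIV ?E)"
      by (intro sets.countable_UN') (auto intro: countable_subset[OF _ countable_rat])
    finally show "X \<in> sets (sigma UNIV ?E)" .
  qed auto
  then have "sets (borel :: real measure) = sigma_sets UNIV ?E"
    by (metis sets_measure_of subset_UNIV Pow_UNIV)
  then show "sets M = sigma_sets UNIV ?E" "sets N = sigma_sets UNIV ?E"
    using M_finite(2) N_sets by simp_all
  show "Int_stable ?E"
    by (auto simp: Int_stable_def lessThan_Int_lessThan max_def)
  show "\<Union> ?E = UNIV"
    by (auto intro: Rats_no_bot_less)
qed (use emeasure_eq finite_measure.emeasure_finite[OF M_finite(1)] countable_rat in auto)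

lemma borel_measurable_nn_integral_count_space:
  fixes f :: "'i \<Rightarrow> 'a \<Rightarrow> ennreal"
  assumes countable_I: "countable I" and f_measurable: "\<And>i. i \<in> I \<Longrightarrow> f i \<in> borel_measurable M"
  shows "(\<lambda>x. \<integral>\<^sup>+i. f i x \<partial>count_space I) \<in> borel_measurable M"
proof -
  interpret sigma_finite_measure "count_space I"
    by (rule sigma_finite_measure_count_space_countable[OF countable_I])
  have "(\<lambda>z. f (snd z) (fst z)) \<in> borel_measurable (M \<Otimes>\<^sub>M count_space I)"
    using f_measurable
    by (intro measurable_compose_countable'[where f="\<lambda>i z. f i (fst z)", OF _ measurable_snd countable_I]) simp
  then show ?thesis
    by (intro borel_measurable_nn_integral) (simp add: case_prod_beta')
qed

lemma borel_measurable_prod_component: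
  fixes f :: "'i \<Rightarrow> 'a \<Rightarrow> ennreal"
  assumes "\<And>j. j \<in> J \<Longrightarrow> f j \<in> borel_measurable (M j)" "J \<subseteq> I"
  shows "(\<lambda>x. \<Prod>j\<in>J. f j (x j)) \<in> borel_measurable (PiM I M)"
proof (rule borel_measurable_prod_ennreal)
  fix j assume "j \<in> J"
  with assms show "(\<lambda>x. f j (x j)) \<in> borel_measurable (PiM I M)"
    by (intro measurable_compose[where f="\<lambda>x. x j" and g="f j"]) auto
qed

lemma (in product_prob_space) nn_integral_prod_PiM:
  assumes J_finite: "finite J" "J \<subseteq> I" and f_measurable: "\<And>j. j \<in> J \<Longrightarrow> f j \<in> borel_measurable (M j)"
  shows "(\<integral>\<^sup>+x. (\<Prod>j\<in>J. f j (x j)) \<partial>PiM I M) = (\<Prod>j\<in>J. \<integral>\<^sup>+y. f j y \<partial>M j)"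
proof -
  have [measurable]: "(\<lambda>x. \<Prod>j\<in>J. f j (x j)) \<in> borel_measurable (PiM J M)"
    by (intro borel_measurable_prod_component f_measurable) auto
  have "(\<Prod>j\<in>J. \<integral>\<^sup>+y. f j y \<partial>M j) = (\<integral>\<^sup>+x. (\<Prod>j\<in>J. f j (x j)) \<partial>PiM J M)"
    using J_finite f_measurable by (simp add: product_nn_integral_prod)
  also have "\<dots> = (\<integral>\<^sup>+x. (\<Prod>j\<in>J. f j (x j)) \<partial>distr (PiM I M) (PiM J M) (\<lambda>x. restrict x J))"
    using J_finite by (simp add: distr_PiM_restrict_finite)
  also have "\<dots> = (\<integral>\<^sup>+x. (\<Prod>j\<in>J. f j (restrict x J j)) \<partial>PiM I M)"
    using J_finite by (intro nn_integral_distr measurable_restrict_subset) auto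
  finally show ?thesis by simp
qed

lemma (in product_prob_space) nn_integral_component_PiM:
  assumes "i \<in> I" "f \<in> borel_measurable (M i)"
  shows "(\<integral>\<^sup>+x. f (x i) \<partial>PiM I M) = (\<integral>\<^sup>+y. f y \<partial>M i)"
  using nn_integral_prod_PiM[of "{i}" "\<lambda>_. f"] assms by simp

lemma indicator_PiE:
  assumes "finite J" "x \<in> extensional J"
  shows "indicator (Pi\<^sub>E J A) x = (\<Prod>j\<in>J. indicator (A j) (x j) :: ennreal)"
  using assms by (auto simp: PiE_iff indicator_def prod_zero_iff)

lemma indicator_prod_emb:
  assumes "finite J" "J \<subseteq> I" "x \<in> space (PiM I M)"
  shows "indicator (prod_emb I M J (Pi\<^sub>E J A)) x = (\<Prod>j\<in>J. indicator (A j) (x j) :: ennreal)"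
proof -
  have "indicator (prod_emb I M J (Pi\<^sub>E J A)) x = (indicator (Pi\<^sub>E J A) (restrict x J) :: ennreal)"
    using assms(3) by (auto simp: indicator_def prod_emb_def space_PiM)
  then show ?thesis
    using assms(1) by (simp add: indicator_PiE)
qed

section \<open>Absolute continuity of product measures\<close>

lemma emeasure_eq_outer_measure:
  assumes "algebra \<Omega> G" "finite_measure M" "sets M = sigma_sets \<Omega> G" "A \<in> sets M"
  shows "emeasure M A = outer_measure G (emeasure M) A"
proof -
  interpret algebra \<Omega> G by fact
  interpret finite_measure M by fact
  have positive: "positive G (emeasure M)" and additive: "countably_additive G (emeasure M)"
    using assms(3) by (auto simp: positive_def countably_additive_def intro!: suminf_emeasure)
  then have increasing: "increasing G (emeasure M)"
    by (metis additive_increasing countably_additive_additive)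
  let ?O = "outer_measure G (emeasure M)"
  have lambda_space: "measure_space \<Omega> (lambda_system \<Omega> (Pow \<Omega>) ?O) ?O"
    by (rule sigma_algebra.caratheodory_lemma[OF sigma_algebra_Pow
          outer_measure_space_outer_measure[OF positive increasing]])
  have "G \<subseteq> lambda_system \<Omega> (Pow \<Omega>) ?O"
    using additive by (intro algebra_subset_lambda_system positive increasing countably_additive_additive)
  then have "sigma_sets \<Omega> G \<subseteq> lambda_system \<Omega> (Pow \<Omega>) ?O"
    using lambda_space by (intro sigma_algebra.sigma_sets_subset) (auto simp: measure_space_def)
  then have outer_measure_space: "measure_space \<Omega> (sigma_sets \<Omega> G) ?O"
    by (rule measure_down[OF lambda_space sigma_algebra_sigma_sets[OF space_closed]])
  have emeasure_eq_outer: "emeasure (measure_of \<Omega> G ?O) X = ?O X" if "X \<in> sigma_sets \<Omega> G" for X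
    using that outer_measure_space space_closed
    by (intro emeasure_measure_of[OF refl]) (auto simp: measure_space_def)
  have "M = measure_of \<Omega> G ?O"
  proof (rule measure_eqI_generator_eq[OF Int_stable space_closed])
    show "emeasure M X = emeasure (measure_of \<Omega> G ?O) X" if "X \<in> G" for X
      using that outer_measure_agrees[OF positive additive that] emeasure_eq_outer[of X] by simp
    show "range (\<lambda>_::nat. \<Omega>) \<subseteq> G" by auto
  qed (use assms(3) space_closed emeasure_finite in auto)
  then show ?thesis
    using emeasure_eq_outer assms(3,4) by simp
qed

lemma absolutely_continuous_algebraI:
  assumes "algebra \<Omega> G" "finite_measure M" "sets M = sigma_sets \<Omega> G" "sets N = sets M"
    and small: "\<And>e. 0 < e \<Longrightarrow> \<exists>d>0. \<forall>C\<in>G. emeasure M C < d \<longrightarrow> emeasure N C \<le> ennreal e"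
  shows "absolutely_continuous M N"
  unfolding absolutely_continuous_def
proof
  interpret algebra \<Omega> G by fact
  have G_sets: "C \<in> sets M" "C \<in> sets N" if "C \<in> G" for C
    using that assms(3,4) by auto
  fix A assume "A \<in> null_sets M"
  then have A_sets: "A \<in> sets M" and A_null: "emeasure M A = 0" by auto
  have "emeasure N A \<le> 0 + ennreal e" if e_pos: "0 < e" for e
  proof -
    obtain d where "0 < d" and d_small: "\<And>C. C \<in> G \<Longrightarrow> emeasure M C < d \<Longrightarrow> emeasure N C \<le> ennreal e"
      using small[OF e_pos] by blast
    have "outer_measure G (emeasure M) A < d"
      unfolding emeasure_eq_outer_measure[OF assms(1-3) A_sets, symmetric] using A_null \<open>0 < d\<close> by simp
    from outer_measure_close[OF this]
    obtain C where C_G: "range C \<subseteq> G" and cover: "A \<subseteq> (\<Union>i. C i)" and C_small: "(\<Sum>i. emeasure M (C i)) < d"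
      by (elim exE conjE)
    have C_sets: "C i \<in> sets M" "C i \<in> sets N" for i
      using C_G G_sets by auto
    have "emeasure N A \<le> emeasure N (\<Union>i. C i)"
      using cover C_sets by (intro emeasure_mono) auto
    also have "\<dots> \<le> ennreal e"
    proof (rule emeasure_UN_leI[OF C_sets(2)], rule d_small)
      fix n :: nat
      show "(\<Union>i<n. C i) \<in> G"
        using C_G by (intro finite_UN) auto
      have "emeasure M (\<Union>i<n. C i) \<le> (\<Sum>i<n. emeasure M (C i))"
        using C_sets by (intro emeasure_subadditive_finite) auto
      also have "\<dots> \<le> (\<Sum>i. emeasure M (C i))"
        by (rule sum_le_suminf) (auto intro: summableI)
      finally show "emeasure M (\<Union>i<n. C i) < d"
        using C_small by (rule le_less_trans)
    qed
    finally show ?thesis by simp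
  qed
  then have "emeasure N A \<le> 0"
    by (rule ennreal_le_epsilon)
  then show "A \<in> null_sets N"
    using A_sets assms(4) by auto
qed

lemma PiM_density_finite:
  assumes prob_M: "product_prob_space M" and prob_N: "product_prob_space N"
    and ratio[measurable]: "\<And>i. r i \<in> borel_measurable (M i)" and N_eq: "\<And>i. N i = density (M i) (r i)"
    and J_finite: "finite J"
  shows "PiM J N = density (PiM J M) (\<lambda>x. \<Prod>j\<in>J. r j (x j))"
proof -
  interpret M: product_prob_space M by fact
  interpret N: product_prob_space N by fact
  have sets_N: "sets (N i) = sets (M i)" for i by (simp add: N_eq)
  have [measurable]: "(\<lambda>x. \<Prod>j\<in>J. r j (x j)) \<in> borel_measurable (PiM J M)"
    by (intro borel_measurable_prod_component ratio) auto
  show ?thesis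
  proof (rule N.PiM_eqI[symmetric, OF J_finite])
    show "sets (density (PiM J M) (\<lambda>x. \<Prod>j\<in>J. r j (x j))) = sets (PiM J N)"
      by (simp add: sets_N cong: sets_PiM_cong)
    fix A assume "\<And>i. i \<in> J \<Longrightarrow> A i \<in> sets (N i)"
    then have A_sets[measurable]: "i \<in> J \<Longrightarrow> A i \<in> sets (M i)" for i by (simp add: sets_N)
    have "emeasure (density (PiM J M) (\<lambda>x. \<Prod>j\<in>J. r j (x j))) (Pi\<^sub>E J A)
        = (\<integral>\<^sup>+x. (\<Prod>j\<in>J. r j (x j)) * indicator (Pi\<^sub>E J A) x \<partial>PiM J M)"
      using A_sets J_finite by (intro emeasure_density sets_PiM_I_finite) auto
    also have "\<dots> = (\<integral>\<^sup>+x. (\<Prod>j\<in>J. r j (x j) * indicator (A j) (x j)) \<partial>PiM J M)"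
      using J_finite by (intro nn_integral_cong) (simp add: indicator_PiE space_PiM PiE_iff prod.distrib)
    also have "\<dots> = (\<Prod>j\<in>J. \<integral>\<^sup>+y. r j y * indicator (A j) y \<partial>M j)"
      using J_finite by (intro M.product_nn_integral_prod) auto
    also have "\<dots> = (\<Prod>j\<in>J. emeasure (N j) (A j))"
      by (intro prod.cong) (auto simp: N_eq emeasure_density)
    finally show "emeasure (density (PiM J M) (\<lambda>x. \<Prod>j\<in>J. r j (x j))) (Pi\<^sub>E J A)
        = (\<Prod>j\<in>J. emeasure (N j) (A j))" .
  qed
qed

lemma emeasure_PiM_cylinder_square_le:
  assumes prob_M: "product_prob_space M" and prob_N: "product_prob_space N"
    and ratio[measurable]: "\<And>i. r i \<in> borel_measurable (M i)" and N_eq: "\<And>i. N i = density (M i) (r i)"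
    and J_finite: "finite J" "J \<subseteq> I" and X_sets[measurable]: "X \<in> sets (PiM J M)"
  shows "(emeasure (PiM I N) (prod_emb I M J X))\<^sup>2
    \<le> (\<Prod>j\<in>J. \<integral>\<^sup>+y. (r j y)\<^sup>2 \<partial>M j) * emeasure (PiM I M) (prod_emb I M J X)"
proof -
  interpret M: product_prob_space M I by fact
  interpret N: product_prob_space N I by fact
  have [measurable]: "(\<lambda>x. \<Prod>j\<in>J. r j (x j)) \<in> borel_measurable (PiM J M)"
    by (intro borel_measurable_prod_component ratio) auto
  have "sets (PiM J N) = sets (PiM J M)" "prod_emb I N J X = prod_emb I M J X"
    by (simp_all add: N_eq prod_emb_def cong: sets_PiM_cong)
  then have "emeasure (PiM I N) (prod_emb I M J X) = emeasure (density (PiM J M) (\<lambda>x. \<Prod>j\<in>J. r j (x j))) X"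
    unfolding PiM_density_finite[OF prob_M prob_N ratio N_eq J_finite(1), symmetric]
    using J_finite X_sets N.emeasure_PiM_emb'[of J X] by simp
  then have "(emeasure (PiM I N) (prod_emb I M J X))\<^sup>2
      \<le> (\<integral>\<^sup>+x. (\<Prod>j\<in>J. r j (x j))\<^sup>2 \<partial>PiM J M) * emeasure (PiM J M) X"
    by (simp add: emeasure_density_square_le)
  also have "(\<integral>\<^sup>+x. (\<Prod>j\<in>J. r j (x j))\<^sup>2 \<partial>PiM J M) = (\<Prod>j\<in>J. \<integral>\<^sup>+y. (r j y)\<^sup>2 \<partial>M j)"
    unfolding prod_power_distrib using J_finite by (intro M.product_nn_integral_prod) auto
  also have "emeasure (PiM J M) X = emeasure (PiM I M) (prod_emb I M J X)"
    using J_finite X_sets by (simp add: M.emeasure_PiM_emb')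
  finally show ?thesis .
qed

text \<open>The easy half of Kakutani's dichotomy.\<close>

lemma PiM_absolutely_continuous:
  assumes prob_M: "product_prob_space M" and prob_N: "product_prob_space N"
    and ratio: "\<And>i. r i \<in> borel_measurable (M i)" and N_eq: "\<And>i. N i = density (M i) (r i)"
    and bounded: "\<And>J. finite J \<Longrightarrow> J \<subseteq> I \<Longrightarrow> (\<Prod>j\<in>J. \<integral>\<^sup>+y. (r j y)\<^sup>2 \<partial>M j) \<le> ennreal c"
  shows "absolutely_continuous (PiM I M) (PiM I N)"
proof -
  interpret M: product_prob_space M I by fact
  have sets_eq: "sets (PiM I N) = sets (PiM I M)"
    by (simp add: N_eq cong: sets_PiM_cong)
  have cylinder: "(emeasure (PiM I N) C)\<^sup>2 \<le> ennreal \<bar>c\<bar> * emeasure (PiM I M) C"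
    if C_generator: "C \<in> M.generator" for C
  proof -
    obtain J X where C_eq: "C = prod_emb I M J X"
      and J_finite: "finite J" "J \<subseteq> I" and X_sets: "X \<in> sets (PiM J M)"
      using C_generator by (rule M.generator.cases)
    have "(\<Prod>j\<in>J. \<integral>\<^sup>+y. (r j y)\<^sup>2 \<partial>M j) \<le> ennreal \<bar>c\<bar>"
      using bounded[OF J_finite] by (rule order_trans) (simp add: ennreal_leI)
    then show ?thesis
      using emeasure_PiM_cylinder_square_le[OF prob_M prob_N ratio N_eq J_finite X_sets] mult_right_mono
      unfolding C_eq by (meson order_trans zero_le)
  qed
  show ?thesis
  proof (rule absolutely_continuous_algebraI[OF M.algebra_generator M.P.finite_measure_axioms
        M.sets_PiM_generator sets_eq])
    fix e :: real assume "0 < e"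
    have "emeasure (PiM I N) C \<le> ennreal e"
      if "C \<in> M.generator" "emeasure (PiM I M) C < ennreal (e\<^sup>2 / (\<bar>c\<bar> + 1))" for C
    proof -
      have "(emeasure (PiM I N) C)\<^sup>2 \<le> ennreal \<bar>c\<bar> * ennreal (e\<^sup>2 / (\<bar>c\<bar> + 1))"
        using that by (intro order_trans[OF cylinder] mult_left_mono) auto
      also have "\<dots> = ennreal (e\<^sup>2 * (\<bar>c\<bar> / (\<bar>c\<bar> + 1)))"
        by (simp add: ennreal_mult[symmetric])
      also have "\<dots> \<le> ennreal (e\<^sup>2 * 1)"
        by (intro ennreal_leI mult_left_mono) auto
      finally show ?thesis
        using \<open>0 < e\<close> ennreal_le_sqrtI[of "emeasure (PiM I N) C" "e\<^sup>2"] by simp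
    qed
    then show "\<exists>d>0. \<forall>C\<in>M.generator. emeasure (PiM I M) C < d \<longrightarrow> emeasure (PiM I N) C \<le> ennreal e"
      using \<open>0 < e\<close> by (intro exI[of _ "ennreal (e\<^sup>2 / (\<bar>c\<bar> + 1))"]) auto
  qed
qed

section \<open>Bayesian updates of a single coordinate\<close>

definition evidence :: "(real \<Rightarrow> real \<Rightarrow> real) \<Rightarrow> real measure \<Rightarrow> real \<Rightarrow> ennreal" where
  "evidence p \<rho> y = (\<integral>\<^sup>+\<theta>. p \<theta> y \<partial>\<rho>)"

definition bayes_update :: "(real \<Rightarrow> real \<Rightarrow> real) \<Rightarrow> real measure \<Rightarrow> real \<Rightarrow> real measure" where
  "bayes_update p \<rho> y = density \<rho> (\<lambda>\<theta>. p \<theta> y / evidence p \<rho> y)"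

definition posterior_risk ::
  "(real \<Rightarrow> real \<Rightarrow> real) \<Rightarrow> real measure \<Rightarrow> real \<Rightarrow> (real \<Rightarrow> ennreal) \<Rightarrow> ennreal" where
  "posterior_risk p \<rho> \<theta>\<^sub>0 w = (\<integral>\<^sup>+y. \<integral>\<^sup>+\<theta>. w \<theta> \<partial>bayes_update p \<rho> y \<partial>density lborel (p \<theta>\<^sub>0))"

locale likelihood =
  fixes p :: "real \<Rightarrow> real \<Rightarrow> real"
  assumes likelihood_measurable_pair: "(\<lambda>(\<theta>, y). p \<theta> y) \<in> borel_measurable (borel \<Otimes>\<^sub>M borel)"
    and likelihood_pos: "\<And>\<theta> y. 0 < p \<theta> y"
    and likelihood_bdd: "\<And>y. \<exists>b. \<forall>\<theta>. p \<theta> y \<le> b"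
    and nn_integral_likelihood: "\<And>\<theta>. (\<integral>\<^sup>+y. p \<theta> y \<partial>lborel) = 1"
begin

lemma likelihood_measurable [measurable (raw)]:
  assumes [measurable]: "f \<in> borel_measurable M" "g \<in> borel_measurable M"
  shows "(\<lambda>x. p (f x) (g x)) \<in> borel_measurable M"
  using measurable_compose[OF _ likelihood_measurable_pair, of "\<lambda>x. (f x, g x)" M] by simp

lemma prob_space_likelihood: "prob_space (density lborel (p \<theta>))"
  by (rule prob_spaceI) (simp add: emeasure_density nn_integral_likelihood)

end

locale bayes_experiment = likelihood +
  fixes \<rho> :: "real measure"
  assumes prob_space_prior: "prob_space \<rho>" and sets_prior [measurable_cong]: "sets \<rho> = sets borel"
begin

sublocale prior: prob_space \<rho> by (rule prob_space_prior)

lemma measurable_prior_iff [simp]: "measurable \<rho> N = measurable borel N"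
  by (rule measurable_cong_sets[OF sets_prior refl])

lemma evidence_measurable [measurable]: "evidence p \<rho> \<in> borel_measurable borel"
proof -
  show ?thesis unfolding evidence_def by measurable
qed

lemma evidence_neq_0: "evidence p \<rho> y \<noteq> 0"
proof
  assume "evidence p \<rho> y = 0"
  then have "AE \<theta> in \<rho>. p \<theta> y \<le> 0"
    unfolding evidence_def by (subst (asm) nn_integral_0_iff_AE) (auto simp: ennreal_eq_0_iff)
  then have "AE \<theta> in \<rho>. False"
    by eventually_elim (use likelihood_pos in \<open>simp add: not_le[symmetric]\<close>)
  then show False by simp
qed

lemma evidence_neq_top: "evidence p \<rho> y \<noteq> \<top>"
proof -
  obtain b where likelihood_le: "\<And>\<theta>. p \<theta> y \<le> b"
    using likelihood_bdd by blast
  have "evidence p \<rho> y \<le> (\<integral>\<^sup>+\<theta>. ennreal b \<partial>\<rho>)"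
    unfolding evidence_def by (intro nn_integral_mono ennreal_leI likelihood_le)
  then show ?thesis by (auto simp: prior.emeasure_space_1 top_unique)
qed

lemma sets_bayes_update [measurable_cong, simp]: "sets (bayes_update p \<rho> y) = sets borel"
  by (simp add: bayes_update_def sets_prior)

lemma nn_integral_bayes_update:
  assumes [measurable]: "w \<in> borel_measurable borel"
  shows "(\<integral>\<^sup>+\<theta>. w \<theta> \<partial>bayes_update p \<rho> y) = (\<integral>\<^sup>+\<theta>. w \<theta> * p \<theta> y \<partial>\<rho>) / evidence p \<rho> y"
  unfolding bayes_update_def
  by (simp add: nn_integral_density mult.commute[of _ "w _"] ennreal_times_divide nn_integral_divide)

lemma nn_integral_bayes_update_measurable [measurable]:
  assumes [measurable]: "w \<in> borel_measurable borel"
  shows "(\<lambda>y. \<integral>\<^sup>+\<theta>. w \<theta> \<partial>bayes_update p \<rho> y) \<in> borel_measurable borel"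
  by (simp add: nn_integral_bayes_update)

lemma emeasure_bayes_update_measurable [measurable]:
  assumes [measurable]: "E \<in> sets borel"
  shows "(\<lambda>y. emeasure (bayes_update p \<rho> y) E) \<in> borel_measurable borel"
  using nn_integral_bayes_update_measurable[of "indicator E"] by simp

lemma prob_space_bayes_update: "prob_space (bayes_update p \<rho> y)"
proof
  have "emeasure (bayes_update p \<rho> y) (space (bayes_update p \<rho> y)) = (\<integral>\<^sup>+\<theta>. 1 \<partial>bayes_update p \<rho> y)"
    by simp
  also have "\<dots> = evidence p \<rho> y / evidence p \<rho> y"
    by (subst nn_integral_bayes_update) (auto simp: evidence_def)
  finally show "emeasure (bayes_update p \<rho> y) (space (bayes_update p \<rho> y)) = 1"
    using evidence_neq_0 evidence_neq_top by (simp add: ennreal_divide_self less_top)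
qed

lemma nn_integral_joint_eq:
  assumes [measurable]: "w \<in> borel_measurable borel" "u \<in> borel_measurable borel"
  shows "(\<integral>\<^sup>+\<theta>. w \<theta> * (\<integral>\<^sup>+y. u y \<partial>density lborel (p \<theta>)) \<partial>\<rho>)
    = (\<integral>\<^sup>+y. (\<integral>\<^sup>+\<theta>. w \<theta> \<partial>bayes_update p \<rho> y) * u y \<partial>density lborel (evidence p \<rho>))"
proof -
  interpret pair_sigma_finite \<rho> lborel ..
  have "(\<integral>\<^sup>+\<theta>. w \<theta> * (\<integral>\<^sup>+y. u y \<partial>density lborel (p \<theta>)) \<partial>\<rho>)
      = (\<integral>\<^sup>+\<theta>. \<integral>\<^sup>+y. u y * (w \<theta> * p \<theta> y) \<partial>lborel \<partial>\<rho>)"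
    by (auto intro!: nn_integral_cong simp: nn_integral_density nn_integral_cmult[symmetric] mult_ac)
  also have "\<dots> = (\<integral>\<^sup>+y. \<integral>\<^sup>+\<theta>. u y * (w \<theta> * p \<theta> y) \<partial>\<rho> \<partial>lborel)"
    by (rule Fubini'[symmetric]) measurable
  also have "\<dots> = (\<integral>\<^sup>+y. evidence p \<rho> y * ((\<integral>\<^sup>+\<theta>. w \<theta> \<partial>bayes_update p \<rho> y) * u y) \<partial>lborel)"
  proof (intro nn_integral_cong)
    fix y
    have "(\<integral>\<^sup>+\<theta>. w \<theta> * p \<theta> y \<partial>\<rho>) = (\<integral>\<^sup>+\<theta>. w \<theta> \<partial>bayes_update p \<rho> y) * evidence p \<rho> y"
      using evidence_neq_0 evidence_neq_top
      by (simp add: nn_integral_bayes_update ennreal_divide_times ennreal_divide_self less_top)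
    then show "(\<integral>\<^sup>+\<theta>. u y * (w \<theta> * p \<theta> y) \<partial>\<rho>)
        = evidence p \<rho> y * ((\<integral>\<^sup>+\<theta>. w \<theta> \<partial>bayes_update p \<rho> y) * u y)"
      by (simp add: nn_integral_cmult mult_ac)
  qed
  finally show ?thesis by (simp add: nn_integral_density)
qed

lemma nn_integral_bayes_update_le:
  assumes [measurable]: "w \<in> borel_measurable borel" "u \<in> borel_measurable borel"
    and evidence_ge: "0 < c" "\<And>y. ennreal (c * p \<theta>\<^sub>0 y) \<le> evidence p \<rho> y"
  shows "(\<integral>\<^sup>+y. (\<integral>\<^sup>+\<theta>. w \<theta> \<partial>bayes_update p \<rho> y) * u y \<partial>density lborel (p \<theta>\<^sub>0))
    \<le> ennreal (1 / c) * (\<integral>\<^sup>+\<theta>. w \<theta> * (\<integral>\<^sup>+y. u y \<partial>density lborel (p \<theta>)) \<partial>\<rho>)"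
proof -
  let ?h = "\<lambda>y. (\<integral>\<^sup>+\<theta>. w \<theta> \<partial>bayes_update p \<rho> y) * u y"
  have likelihood_le: "ennreal (p \<theta>\<^sub>0 y) \<le> ennreal (1 / c) * evidence p \<rho> y" for y
  proof -
    have "ennreal (p \<theta>\<^sub>0 y) = ennreal (1 / c) * ennreal (c * p \<theta>\<^sub>0 y)"
      using evidence_ge(1) by (simp add: ennreal_mult'[symmetric])
    also have "\<dots> \<le> ennreal (1 / c) * evidence p \<rho> y"
      by (intro mult_left_mono evidence_ge) auto
    finally show ?thesis .
  qed
  have "(\<integral>\<^sup>+y. ?h y \<partial>density lborel (p \<theta>\<^sub>0)) = (\<integral>\<^sup>+y. p \<theta>\<^sub>0 y * ?h y \<partial>lborel)"
    by (simp add: nn_integral_density)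
  also have "\<dots> \<le> (\<integral>\<^sup>+y. ennreal (1 / c) * (evidence p \<rho> y * ?h y) \<partial>lborel)"
    using likelihood_le by (intro nn_integral_mono) (simp add: mult.assoc[symmetric] mult_right_mono)
  also have "\<dots> = ennreal (1 / c) * (\<integral>\<^sup>+y. ?h y \<partial>density lborel (evidence p \<rho>))"
    by (simp add: nn_integral_cmult nn_integral_density)
  finally show ?thesis by (simp add: nn_integral_joint_eq)
qed

lemma posterior_risk_le:
  assumes "w \<in> borel_measurable borel" "0 < c" "\<And>y. ennreal (c * p \<theta>\<^sub>0 y) \<le> evidence p \<rho> y"
  shows "posterior_risk p \<rho> \<theta>\<^sub>0 w \<le> ennreal (1 / c) * (\<integral>\<^sup>+\<theta>. w \<theta> \<partial>\<rho>)"
  using nn_integral_bayes_update_le[OF assms(1) _ assms(2,3), of "\<lambda>_. 1"]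
  by (simp add: posterior_risk_def prob_space.emeasure_space_1[OF prob_space_likelihood, simplified])

end

section \<open>The posterior under a product prior\<close>

locale sequence_model = likelihood +
  fixes I :: "'i set" and \<pi> :: "'i \<Rightarrow> real measure"
  assumes prob_space_coord_prior: "\<And>i. prob_space (\<pi> i)"
    and sets_coord_prior [measurable_cong]: "\<And>i. sets (\<pi> i) = sets borel"
begin

sublocale coord: bayes_experiment p "\<pi> i" for i
  by (intro bayes_experiment.intro likelihood_axioms bayes_experiment_axioms.intro
      prob_space_coord_prior sets_coord_prior)

sublocale prior: product_prob_space \<pi> I
  by (intro product_prob_spaceI prob_space_coord_prior)

abbreviation borel_seq :: "('i \<Rightarrow> real) measure" where
  "borel_seq \<equiv> PiM I (\<lambda>_. borel)"

definition obs :: "('i \<Rightarrow> real) \<Rightarrow> ('i \<Rightarrow> real) measure" where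
  "obs \<theta> = PiM I (\<lambda>i. density lborel (p (\<theta> i)))"

definition marginal :: "('i \<Rightarrow> real) measure" where
  "marginal = PiM I \<pi> \<bind> obs"

lemma product_prob_space_obs: "product_prob_space (\<lambda>i. density lborel (p (\<theta> i)))"
  by (intro product_prob_spaceI prob_space_likelihood)

lemma prob_space_obs: "prob_space (obs \<theta>)"
  unfolding obs_def by (intro prob_space_PiM prob_space_likelihood)

lemma sets_obs [measurable_cong]: "sets (obs \<theta>) = sets borel_seq"
  unfolding obs_def by (intro sets_PiM_cong) auto

lemma space_obs: "space (obs \<theta>) = space borel_seq"
  by (rule sets_eq_imp_space_eq[OF sets_obs])

lemma sets_prior [measurable_cong]: "sets (PiM I \<pi>) = sets borel_seq"
  by (intro sets_PiM_cong) (auto simp: sets_coord_prior)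

lemma component_measurable [measurable]: "i \<in> I \<Longrightarrow> (\<lambda>\<theta>. \<theta> i) \<in> borel_measurable (PiM I \<pi>)"
  using measurable_component_singleton[of i I "\<lambda>_. borel"] by (simp cong: measurable_cong_sets add: sets_prior)

lemma nn_integral_obs_prod:
  assumes "finite J" "J \<subseteq> I" "\<And>j. j \<in> J \<Longrightarrow> u j \<in> borel_measurable borel"
  shows "(\<integral>\<^sup>+x. (\<Prod>j\<in>J. u j (x j)) \<partial>obs \<theta>) = (\<Prod>j\<in>J. \<integral>\<^sup>+y. u j y \<partial>density lborel (p (\<theta> j)))"
proof -
  interpret product_prob_space "\<lambda>i. density lborel (p (\<theta> i))" I
    by (rule product_prob_space_obs)
  show ?thesis
    unfolding obs_def using assms by (intro nn_integral_prod_PiM) auto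
qed

lemma obs_measurable: "obs \<in> borel_seq \<rightarrow>\<^sub>M prob_algebra borel_seq"
proof (rule measurable_prob_algebra_generated[OF sets_PiM Int_stable_prod_algebra prod_algebra_sets_into_space])
  fix X assume "X \<in> prod_algebra I (\<lambda>_. borel :: real measure)"
  then obtain J A where X_eq: "X = prod_emb I (\<lambda>_. borel) J (Pi\<^sub>E J A)"
    and J_finite: "finite J" "J \<subseteq> I" and A_sets[measurable]: "\<And>j. j \<in> J \<Longrightarrow> A j \<in> sets borel"
    by (auto elim!: prod_algebraE)
  have X_sets: "X \<in> sets borel_seq"
    unfolding X_eq using J_finite A_sets by (intro sets_PiM_I) auto
  have "emeasure (obs \<theta>) X = (\<Prod>j\<in>J. \<integral>\<^sup>+y. indicator (A j) y \<partial>density lborel (p (\<theta> j)))" for \<theta>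
  proof -
    have "emeasure (obs \<theta>) X = (\<integral>\<^sup>+x. indicator X x \<partial>obs \<theta>)"
      using X_sets by (simp add: sets_obs)
    also have "\<dots> = (\<integral>\<^sup>+x. (\<Prod>j\<in>J. indicator (A j) (x j)) \<partial>obs \<theta>)"
      unfolding X_eq using J_finite by (intro nn_integral_cong indicator_prod_emb) (auto simp: space_obs)
    also have "\<dots> = (\<Prod>j\<in>J. \<integral>\<^sup>+y. indicator (A j) y \<partial>density lborel (p (\<theta> j)))"
      using J_finite by (intro nn_integral_obs_prod) auto
    finally show ?thesis .
  qed
  moreover have "(\<lambda>\<theta>. \<Prod>j\<in>J. \<integral>\<^sup>+y. indicator (A j) y \<partial>density lborel (p (\<theta> j))) \<in> borel_measurable borel_seq"
  proof (rule borel_measurable_prod_component[OF _ J_finite(2)])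
    fix j assume "j \<in> J"
    then have [measurable]: "A j \<in> sets borel" by (rule A_sets)
    show "(\<lambda>\<theta>. \<integral>\<^sup>+y. indicator (A j) y \<partial>density lborel (p \<theta>)) \<in> borel_measurable borel"
      by (simp add: emeasure_density)
  qed
  ultimately show "(\<lambda>\<theta>. emeasure (obs \<theta>) X) \<in> borel_measurable borel_seq" by simp
qed (auto simp: prob_space_obs sets_obs)

lemma obs_kernel [measurable]: "obs \<in> PiM I \<pi> \<rightarrow>\<^sub>M subprob_algebra borel_seq"
  using measurable_prob_algebraD[OF obs_measurable] by (simp cong: measurable_cong_sets add: sets_prior)

lemma sets_marginal [measurable_cong]: "sets marginal = sets borel_seq"
  unfolding marginal_def by (rule sets_bind_measurable[OF obs_kernel prior.P.not_empty])

lemma space_marginal: "space marginal = space borel_seq"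
  by (rule sets_eq_imp_space_eq[OF sets_marginal])

lemma nn_integral_marginal:
  "f \<in> borel_measurable borel_seq \<Longrightarrow>
    (\<integral>\<^sup>+x. f x \<partial>marginal) = (\<integral>\<^sup>+\<theta>. \<integral>\<^sup>+x. f x \<partial>obs \<theta> \<partial>PiM I \<pi>)"
  unfolding marginal_def by (rule nn_integral_bind[OF _ obs_kernel])

lemma prob_space_marginal: "prob_space marginal"
  unfolding marginal_def
  by (rule prior.P.prob_space_bind[OF AE_I2 obs_kernel]) (rule prob_space_obs)

lemma nn_integral_joint_prod:
  assumes J_finite: "finite J" "J \<subseteq> I"
    and [measurable]: "\<And>j. j \<in> J \<Longrightarrow> w j \<in> borel_measurable borel"
      "\<And>j. j \<in> J \<Longrightarrow> u j \<in> borel_measurable borel"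
  shows "(\<integral>\<^sup>+\<theta>. (\<Prod>j\<in>J. w j (\<theta> j)) * (\<integral>\<^sup>+x. (\<Prod>j\<in>J. u j (x j)) \<partial>obs \<theta>) \<partial>PiM I \<pi>)
    = (\<Prod>j\<in>J. \<integral>\<^sup>+\<theta>. w j \<theta> * (\<integral>\<^sup>+y. u j y \<partial>density lborel (p \<theta>)) \<partial>\<pi> j)"
proof -
  have "(\<integral>\<^sup>+\<theta>. (\<Prod>j\<in>J. w j (\<theta> j)) * (\<integral>\<^sup>+x. (\<Prod>j\<in>J. u j (x j)) \<partial>obs \<theta>) \<partial>PiM I \<pi>)
    = (\<integral>\<^sup>+\<theta>. (\<Prod>j\<in>J. w j (\<theta> j) * (\<integral>\<^sup>+y. u j y \<partial>density lborel (p (\<theta> j)))) \<partial>PiM I \<pi>)"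
    using J_finite by (simp add: nn_integral_obs_prod prod.distrib)
  also have "\<dots> = (\<Prod>j\<in>J. \<integral>\<^sup>+\<theta>. w j \<theta> * (\<integral>\<^sup>+y. u j y \<partial>density lborel (p \<theta>)) \<partial>\<pi> j)"
    using J_finite by (intro prior.nn_integral_prod_PiM) (simp_all add: nn_integral_density)
  finally show ?thesis .
qed

lemma nn_integral_marginal_prod:
  assumes "finite J" "J \<subseteq> I" and [measurable]: "\<And>j. j \<in> J \<Longrightarrow> u j \<in> borel_measurable borel"
  shows "(\<integral>\<^sup>+x. (\<Prod>j\<in>J. u j (x j)) \<partial>marginal)
    = (\<Prod>j\<in>J. \<integral>\<^sup>+y. u j y \<partial>density lborel (evidence p (\<pi> j)))"
proof -
  have "(\<integral>\<^sup>+x. (\<Prod>j\<in>J. u j (x j)) \<partial>marginal)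
      = (\<integral>\<^sup>+\<theta>. (\<Prod>j\<in>J. 1) * (\<integral>\<^sup>+x. (\<Prod>j\<in>J. u j (x j)) \<partial>obs \<theta>) \<partial>PiM I \<pi>)"
    using assms by (simp add: nn_integral_marginal borel_measurable_prod_component)
  also have "\<dots> = (\<Prod>j\<in>J. \<integral>\<^sup>+\<theta>. 1 * (\<integral>\<^sup>+y. u j y \<partial>density lborel (p \<theta>)) \<partial>\<pi> j)"
    using assms by (intro nn_integral_joint_prod) auto
  also have "\<dots> = (\<Prod>j\<in>J. \<integral>\<^sup>+y. u j y \<partial>density lborel (evidence p (\<pi> j)))"
    using prob_space.emeasure_space_1[OF coord.prob_space_bayes_update]
    by (intro prod.cong refl, subst coord.nn_integral_joint_eq) auto
  finally show ?thesis .
qed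

end

locale sequence_posterior = sequence_model +
  fixes K :: "('a \<Rightarrow> real) \<Rightarrow> ('a \<Rightarrow> real) measure"
  assumes kernel: "K \<in> borel_seq \<rightarrow>\<^sub>M prob_algebra (PiM I \<pi>)"
    and posterior: "\<And>A B. A \<in> sets (PiM I \<pi>) \<Longrightarrow> B \<in> sets borel_seq \<Longrightarrow>
      (\<integral>\<^sup>+\<theta>. indicator A \<theta> * emeasure (obs \<theta>) B \<partial>PiM I \<pi>) =
      (\<integral>\<^sup>+\<theta>. \<integral>\<^sup>+x. indicator B x * emeasure (K x) A \<partial>obs \<theta> \<partial>PiM I \<pi>)"
begin

lemma kernel_subprob [measurable]: "K \<in> borel_seq \<rightarrow>\<^sub>M subprob_algebra (PiM I \<pi>)"
  by (rule measurable_prob_algebraD[OF kernel])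

lemma sets_kernel_eq: "x \<in> space borel_seq \<Longrightarrow> sets (K x) = sets (PiM I \<pi>)"
  using measurable_space[OF kernel] by (auto simp: space_prob_algebra)

lemma prob_space_kernel: "x \<in> space borel_seq \<Longrightarrow> prob_space (K x)"
  using measurable_space[OF kernel] by (auto simp: space_prob_algebra)

lemma component_measurable_kernel:
  "x \<in> space borel_seq \<Longrightarrow> i \<in> I \<Longrightarrow> (\<lambda>\<theta>. \<theta> i) \<in> borel_measurable (K x)"
  using component_measurable measurable_cong_sets[OF sets_kernel_eq refl] by blast

lemma emeasure_density_marginal_kernel:
  assumes [measurable]: "A \<in> sets (PiM I \<pi>)" "B \<in> sets borel_seq"
  shows "emeasure (density marginal (\<lambda>x. emeasure (K x) A)) B
    = (\<integral>\<^sup>+\<theta>. indicator A \<theta> * emeasure (obs \<theta>) B \<partial>PiM I \<pi>)"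
proof -
  have "emeasure (density marginal (\<lambda>x. emeasure (K x) A)) B
      = (\<integral>\<^sup>+x. indicator B x * emeasure (K x) A \<partial>marginal)"
    by (subst emeasure_density) (auto simp: mult.commute)
  also have "\<dots> = (\<integral>\<^sup>+\<theta>. \<integral>\<^sup>+x. indicator B x * emeasure (K x) A \<partial>obs \<theta> \<partial>PiM I \<pi>)"
    by (rule nn_integral_marginal) measurable
  finally show ?thesis by (simp add: posterior)
qed

lemma emeasure_density_marginal_kernel_cylinder:
  assumes i_in_I: "i \<in> I" and E_borel[measurable]: "E \<in> sets borel"
    and J_finite: "finite J" "J \<subseteq> I" "i \<in> J" and A_borel[measurable]: "\<And>j. j \<in> J \<Longrightarrow> A j \<in> sets borel"
  defines "X \<equiv> prod_emb I (\<lambda>_. borel) J (Pi\<^sub>E J A)"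
  shows "emeasure (density marginal (\<lambda>x. emeasure (K x) {\<theta>\<in>space (PiM I \<pi>). \<theta> i \<in> E})) X
    = emeasure (density marginal (\<lambda>x. emeasure (bayes_update p (\<pi> i) (x i)) E)) X"
proof -
  let ?A = "{\<theta>\<in>space (PiM I \<pi>). \<theta> i \<in> E}"
  define w where "w j = (if j = i then indicator E else (\<lambda>_. 1) :: real \<Rightarrow> ennreal)" for j
  have [measurable]: "w j \<in> borel_measurable borel" for j
    by (simp add: w_def)
  have indicator_X: "indicator X x = (\<Prod>j\<in>J. indicator (A j) (x j) :: ennreal)" if "x \<in> space borel_seq" for x
    unfolding X_def using J_finite that by (intro indicator_prod_emb)
  have [measurable]: "X \<in> sets borel_seq"
    unfolding X_def using J_finite by (intro sets_PiM_I) auto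
  have [measurable]: "?A \<in> sets (PiM I \<pi>)"
    using i_in_I by measurable
  have nn_integral_w: "(\<integral>\<^sup>+\<theta>. w j \<theta> \<partial>bayes_update p (\<pi> j) y)
      = (if j = i then emeasure (bayes_update p (\<pi> i) y) E else 1)" for j y
    using prob_space.emeasure_space_1[OF coord.prob_space_bayes_update] by (auto simp: w_def)
  have "emeasure (density marginal (\<lambda>x. emeasure (K x) ?A)) X
      = (\<integral>\<^sup>+\<theta>. indicator ?A \<theta> * (\<integral>\<^sup>+x. indicator X x \<partial>obs \<theta>) \<partial>PiM I \<pi>)"
    by (simp add: emeasure_density_marginal_kernel sets_obs)
  also have "\<dots> = (\<integral>\<^sup>+\<theta>. (\<Prod>j\<in>J. w j (\<theta> j)) * (\<integral>\<^sup>+x. (\<Prod>j\<in>J. indicator (A j) (x j)) \<partial>obs \<theta>) \<partial>PiM I \<pi>)"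
  proof (intro nn_integral_cong arg_cong2[where f="(*)"])
    fix \<theta> assume "\<theta> \<in> space (PiM I \<pi>)"
    then have "indicator ?A \<theta> = (\<Prod>j\<in>J. if j = i then indicator E (\<theta> j) else 1 :: ennreal)"
      using J_finite by (simp add: indicator_def)
    also have "\<dots> = (\<Prod>j\<in>J. w j (\<theta> j))"
      by (intro prod.cong) (auto simp: w_def)
    finally show "indicator ?A \<theta> = (\<Prod>j\<in>J. w j (\<theta> j))" .
  qed (simp add: indicator_X space_obs)
  also have "\<dots> = (\<Prod>j\<in>J. \<integral>\<^sup>+\<theta>. w j \<theta> * (\<integral>\<^sup>+y. indicator (A j) y \<partial>density lborel (p \<theta>)) \<partial>\<pi> j)"
    using J_finite by (intro nn_integral_joint_prod) auto
  also have "\<dots> = (\<Prod>j\<in>J. \<integral>\<^sup>+y. (\<integral>\<^sup>+\<theta>. w j \<theta> \<partial>bayes_update p (\<pi> j) y) * indicator (A j) y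
        \<partial>density lborel (evidence p (\<pi> j)))"
    by (intro prod.cong refl coord.nn_integral_joint_eq) auto
  also have "\<dots> = (\<integral>\<^sup>+x. (\<Prod>j\<in>J. (\<integral>\<^sup>+\<theta>. w j \<theta> \<partial>bayes_update p (\<pi> j) (x j)) * indicator (A j) (x j)) \<partial>marginal)"
    using J_finite by (intro nn_integral_marginal_prod[symmetric]) auto
  also have "\<dots> = (\<integral>\<^sup>+x. emeasure (bayes_update p (\<pi> i) (x i)) E * indicator X x \<partial>marginal)"
    using J_finite by (intro nn_integral_cong) (simp add: indicator_X space_marginal prod.distrib nn_integral_w)
  also have "\<dots> = emeasure (density marginal (\<lambda>x. emeasure (bayes_update p (\<pi> i) (x i)) E)) X"
    using i_in_I by (subst emeasure_density) auto
  finally show ?thesis .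
qed

lemma emeasure_kernel_component_AE:
  assumes i_in_I: "i \<in> I" and E_borel[measurable]: "E \<in> sets borel"
  shows "AE x in marginal. emeasure (K x) {\<theta>\<in>space (PiM I \<pi>). \<theta> i \<in> E}
    = emeasure (bayes_update p (\<pi> i) (x i)) E"
proof -
  let ?A = "{\<theta>\<in>space (PiM I \<pi>). \<theta> i \<in> E}"
  let ?f = "\<lambda>x. emeasure (K x) ?A" and ?g = "\<lambda>x. emeasure (bayes_update p (\<pi> i) (x i)) E"
  interpret marginal: prob_space marginal by (rule prob_space_marginal)
  have A_sets[measurable]: "?A \<in> sets (PiM I \<pi>)"
    using i_in_I by measurable
  have "density marginal ?f = density marginal ?g"
  proof (rule measure_eqI_PiM_infinite[where I=I and M="\<lambda>_. borel"])
    show "finite_measure (density marginal ?f)"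
    proof
      have "emeasure (density marginal ?f) (space borel_seq) \<le> (\<integral>\<^sup>+\<theta>. 1 \<partial>PiM I \<pi>)"
        unfolding emeasure_density_marginal_kernel[OF A_sets sets.top]
        using prob_space.emeasure_le_1[OF prob_space_obs]
        by (intro nn_integral_mono) (auto simp: indicator_def)
      then show "emeasure (density marginal ?f) (space (density marginal ?f)) \<noteq> \<infinity>"
        by (auto simp: space_marginal prior.P.emeasure_space_1 top_unique)
    qed
    fix A J assume J_finite: "finite J" "J \<subseteq> I" and A_borel: "\<And>j. j \<in> J \<Longrightarrow> A j \<in> sets (borel :: real measure)"
    let ?A' = "\<lambda>j. if j \<in> J then A j else UNIV"
    have "prod_emb I (\<lambda>_. borel) J (Pi\<^sub>E J A)
        = prod_emb I (\<lambda>_. borel :: real measure) (insert i J) (Pi\<^sub>E (insert i J) ?A')"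
      using J_finite i_in_I by (auto simp: prod_emb_def PiE_iff)
    then show "emeasure (density marginal ?f) (prod_emb I (\<lambda>_. borel) J (Pi\<^sub>E J A))
        = emeasure (density marginal ?g) (prod_emb I (\<lambda>_. borel) J (Pi\<^sub>E J A))"
      using emeasure_density_marginal_kernel_cylinder[OF i_in_I E_borel, of "insert i J" ?A'] i_in_I J_finite A_borel
      by simp
  qed (simp_all add: sets_marginal)
  then show ?thesis
    using i_in_I by (subst (asm) marginal.density_unique_iff) auto
qed

lemma distr_kernel_component_AE:
  assumes i_in_I: "i \<in> I"
  shows "AE x in marginal. distr (K x) borel (\<lambda>\<theta>. \<theta> i) = bayes_update p (\<pi> i) (x i)"
proof -
  have "AE x in marginal. \<forall>q\<in>\<rat>. emeasure (K x) {\<theta>\<in>space (PiM I \<pi>). \<theta> i \<in> {q<..}}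
      = emeasure (bayes_update p (\<pi> i) (x i)) {q<..}"
    using i_in_I by (subst AE_ball_countable[OF countable_rat]) (intro ballI emeasure_kernel_component_AE, auto)
  then show ?thesis
  proof (rule AE_mp[OF _ AE_I2], intro impI)
    fix x assume "x \<in> space marginal"
      and emeasure_eq: "\<forall>q\<in>\<rat>. emeasure (K x) {\<theta>\<in>space (PiM I \<pi>). \<theta> i \<in> {q<..}}
        = emeasure (bayes_update p (\<pi> i) (x i)) {q<..}"
    then have x_in_space: "x \<in> space borel_seq" by (simp add: space_marginal)
    interpret K: prob_space "K x" by (rule prob_space_kernel[OF x_in_space])
    note component = component_measurable_kernel[OF x_in_space i_in_I]
    show "distr (K x) borel (\<lambda>\<theta>. \<theta> i) = bayes_update p (\<pi> i) (x i)"
    proof (rule measure_eqI_greaterThan_Rats)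
      show "finite_measure (distr (K x) borel (\<lambda>\<theta>. \<theta> i))"
        using component by (rule K.finite_measure_distr)
      fix q :: real assume "q \<in> \<rat>"
      have "emeasure (distr (K x) borel (\<lambda>\<theta>. \<theta> i)) {q<..} = emeasure (K x) ((\<lambda>\<theta>. \<theta> i) -` {q<..} \<inter> space (K x))"
        using component by (intro emeasure_distr) auto
      also have "(\<lambda>\<theta>. \<theta> i) -` {q<..} \<inter> space (K x) = {\<theta>\<in>space (PiM I \<pi>). \<theta> i \<in> {q<..}}"
        using sets_eq_imp_space_eq[OF sets_kernel_eq[OF x_in_space]] by auto
      finally show "emeasure (distr (K x) borel (\<lambda>\<theta>. \<theta> i)) {q<..} = emeasure (bayes_update p (\<pi> i) (x i)) {q<..}"
        using emeasure_eq \<open>q \<in> \<rat>\<close> by simp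
    qed auto
  qed
qed

definition mean_posterior :: "('a \<Rightarrow> real) \<Rightarrow> ('a \<Rightarrow> real) measure" where
  "mean_posterior \<theta>\<^sub>0 = obs \<theta>\<^sub>0 \<bind> K"

lemma kernel_subprob_obs [measurable]: "K \<in> obs \<theta>\<^sub>0 \<rightarrow>\<^sub>M subprob_algebra (PiM I \<pi>)"
  using kernel_subprob by (simp cong: measurable_cong_sets add: sets_obs)

lemma sets_mean_posterior [measurable_cong]: "sets (mean_posterior \<theta>\<^sub>0) = sets (PiM I \<pi>)"
  unfolding mean_posterior_def
  by (rule sets_bind_measurable[OF kernel_subprob_obs prob_space.not_empty[OF prob_space_obs]])

lemma prob_space_mean_posterior: "prob_space (mean_posterior \<theta>\<^sub>0)"
  unfolding mean_posterior_def
  by (rule prob_space.prob_space_bind[OF prob_space_obs AE_I2 kernel_subprob_obs])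
    (simp add: space_obs prob_space_kernel)

lemma nn_integral_mean_posterior:
  "f \<in> borel_measurable (PiM I \<pi>) \<Longrightarrow>
    (\<integral>\<^sup>+\<theta>. f \<theta> \<partial>mean_posterior \<theta>\<^sub>0) = (\<integral>\<^sup>+x. \<integral>\<^sup>+\<theta>. f \<theta> \<partial>K x \<partial>obs \<theta>\<^sub>0)"
  unfolding mean_posterior_def by (rule nn_integral_bind[OF _ kernel_subprob_obs])

lemma nn_integral_mean_posterior_component:
  assumes abs_cont: "absolutely_continuous marginal (obs \<theta>\<^sub>0)" and i_in_I: "i \<in> I"
    and [measurable]: "w \<in> borel_measurable borel"
  shows "(\<integral>\<^sup>+\<theta>. w (\<theta> i) \<partial>mean_posterior \<theta>\<^sub>0) = posterior_risk p (\<pi> i) (\<theta>\<^sub>0 i) w"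
proof -
  have "AE x in obs \<theta>\<^sub>0. distr (K x) borel (\<lambda>\<theta>. \<theta> i) = bayes_update p (\<pi> i) (x i)"
    by (rule absolutely_continuous_AE[OF _ abs_cont distr_kernel_component_AE[OF i_in_I]])
      (simp add: sets_obs sets_marginal)
  then have "AE x in obs \<theta>\<^sub>0. (\<integral>\<^sup>+\<theta>. w (\<theta> i) \<partial>K x) = (\<integral>\<^sup>+\<theta>. w \<theta> \<partial>bayes_update p (\<pi> i) (x i))"
  proof (rule AE_mp[OF _ AE_I2], intro impI)
    fix x assume "x \<in> space (obs \<theta>\<^sub>0)"
    then have component: "(\<lambda>\<theta>. \<theta> i) \<in> borel_measurable (K x)"
      using i_in_I by (intro component_measurable_kernel) (simp_all add: space_obs)
    have "(\<integral>\<^sup>+\<theta>. w (\<theta> i) \<partial>K x) = (\<integral>\<^sup>+\<theta>. w \<theta> \<partial>distr (K x) borel (\<lambda>\<theta>. \<theta> i))"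
      using component by (simp add: nn_integral_distr)
    also assume "distr (K x) borel (\<lambda>\<theta>. \<theta> i) = bayes_update p (\<pi> i) (x i)"
    finally show "(\<integral>\<^sup>+\<theta>. w (\<theta> i) \<partial>K x) = (\<integral>\<^sup>+\<theta>. w \<theta> \<partial>bayes_update p (\<pi> i) (x i))" .
  qed
  then have "(\<integral>\<^sup>+\<theta>. w (\<theta> i) \<partial>mean_posterior \<theta>\<^sub>0)
      = (\<integral>\<^sup>+x. \<integral>\<^sup>+\<theta>. w \<theta> \<partial>bayes_update p (\<pi> i) (x i) \<partial>obs \<theta>\<^sub>0)"
    using i_in_I by (subst nn_integral_mean_posterior) (auto intro: nn_integral_cong_AE)
  also have "\<dots> = posterior_risk p (\<pi> i) (\<theta>\<^sub>0 i) w"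
    unfolding posterior_risk_def
    using nn_integral_obs_prod[of "{i}" "\<lambda>_ y. \<integral>\<^sup>+\<theta>. w \<theta> \<partial>bayes_update p (\<pi> i) y" \<theta>\<^sub>0] i_in_I by simp
  finally show ?thesis .
qed

end

section \<open>Gaussian observations\<close>

lemma nn_integral_normal_density: "0 < s \<Longrightarrow> (\<integral>\<^sup>+y. normal_density \<mu> s y \<partial>lborel) = 1"
  using prob_space.emeasure_space_1[OF prob_space_normal_density[of s \<mu>]] by (simp add: emeasure_density)

lemma likelihood_normal_density:
  assumes "0 < s"
  shows "likelihood (\<lambda>\<theta>. normal_density \<theta> s)"
proof
  show "\<exists>b. \<forall>\<theta>. normal_density \<theta> s y \<le> b" for y
    unfolding normal_density_def using assms
    by (intro exI[of _ "1 / sqrt (2 * pi * s\<^sup>2)"] allI mult_left_le) auto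
qed (simp_all add: assms normal_density_pos nn_integral_normal_density, simp add: normal_density_def)

lemma normal_density_ratio_square:
  assumes s_pos: "0 < s"
  shows "normal_density b s y * (normal_density a s y / normal_density b s y)\<^sup>2
    = exp ((a - b)\<^sup>2 / s\<^sup>2) * normal_density (2 * a - b) s y"
proof -
  let ?e = "\<lambda>\<mu>. exp (- (y - \<mu>)\<^sup>2 / (2 * s\<^sup>2))"
  have nonzero: "sqrt (2 * pi * s\<^sup>2) \<noteq> 0" using s_pos by simp
  have "normal_density b s y * (normal_density a s y / normal_density b s y)\<^sup>2
      = 1 / sqrt (2 * pi * s\<^sup>2) * (?e a * ?e a / ?e b)"
    using nonzero by (simp add: normal_density_def power2_eq_square)
  also have "?e a * ?e a / ?e b = exp (- (y - a)\<^sup>2 / (2 * s\<^sup>2) + - (y - a)\<^sup>2 / (2 * s\<^sup>2) - - (y - b)\<^sup>2 / (2 * s\<^sup>2))"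
    by (simp only: exp_add exp_diff)
  also have "- (y - a)\<^sup>2 / (2 * s\<^sup>2) + - (y - a)\<^sup>2 / (2 * s\<^sup>2) - - (y - b)\<^sup>2 / (2 * s\<^sup>2)
      = (a - b)\<^sup>2 / s\<^sup>2 + - (y - (2 * a - b))\<^sup>2 / (2 * s\<^sup>2)"
    using s_pos by (simp add: field_simps) (simp add: power2_eq_square algebra_simps)
  finally show ?thesis
    unfolding normal_density_def[of "2 * a - b"] by (simp only: exp_add mult_ac)
qed

lemma nn_integral_normal_density_ratio_square:
  assumes s_pos: "0 < s"
  shows "(\<integral>\<^sup>+y. (ennreal (normal_density a s y / normal_density b s y))\<^sup>2 \<partial>density lborel (normal_density b s))
    = ennreal (exp ((a - b)\<^sup>2 / s\<^sup>2))"
proof -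
  have "(\<integral>\<^sup>+y. (ennreal (normal_density a s y / normal_density b s y))\<^sup>2 \<partial>density lborel (normal_density b s))
      = (\<integral>\<^sup>+y. ennreal (normal_density b s y * (normal_density a s y / normal_density b s y)\<^sup>2) \<partial>lborel)"
    by (simp add: nn_integral_density ennreal_power ennreal_mult)
  also have "\<dots> = (\<integral>\<^sup>+y. ennreal (exp ((a - b)\<^sup>2 / s\<^sup>2)) * ennreal (normal_density (2 * a - b) s y) \<partial>lborel)"
    unfolding normal_density_ratio_square[OF s_pos] by (simp add: ennreal_mult)
  finally show ?thesis
    using s_pos by (simp add: nn_integral_cmult nn_integral_normal_density)
qed

lemma density_normal_density_ratio:
  assumes "0 < s"
  shows "density lborel (normal_density a s)
    = density (density lborel (normal_density b s)) (\<lambda>y. ennreal (normal_density a s y / normal_density b s y))"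
proof -
  have "ennreal (normal_density b s y) * ennreal (normal_density a s y / normal_density b s y)
      = ennreal (normal_density a s y)" for y
    using normal_density_pos[OF assms, of b y] by (simp add: ennreal_mult[symmetric])
  then show ?thesis by (simp add: density_density_eq)
qed

lemma emeasure_normal_density_tail_le:
  assumes s_pos: "0 < s" and r_nonneg: "0 \<le> r"
  shows "emeasure (density lborel (normal_density \<theta> s)) {y. r \<le> \<bar>y - \<theta>\<bar>}
    \<le> ennreal (sqrt 2 * exp (- r\<^sup>2 / (4 * s\<^sup>2)))"
proof -
  let ?T = "sqrt 2 * exp (- r\<^sup>2 / (4 * s\<^sup>2))"
  have wider: "normal_density \<theta> s y \<le> ?T * normal_density \<theta> (sqrt 2 * s) y" if "r \<le> \<bar>y - \<theta>\<bar>" for y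
  proof -
    have "2 * pi * (sqrt 2 * s)\<^sup>2 = 2 * (2 * pi * s\<^sup>2)" by (simp add: power_mult_distrib)
    then have factor: "1 / sqrt (2 * pi * s\<^sup>2) = sqrt 2 * (1 / sqrt (2 * pi * (sqrt 2 * s)\<^sup>2))"
      by (simp only: real_sqrt_mult[of 2 "2 * pi * s\<^sup>2"]) simp
    have "r\<^sup>2 \<le> (y - \<theta>)\<^sup>2"
      using that r_nonneg by (metis abs_le_square_iff abs_of_nonneg)
    then have "- (y - \<theta>)\<^sup>2 / (2 * s\<^sup>2) \<le> - r\<^sup>2 / (4 * s\<^sup>2) + - (y - \<theta>)\<^sup>2 / (2 * (sqrt 2 * s)\<^sup>2)"
      using s_pos by (simp add: power_mult_distrib field_simps)
    then have "exp (- (y - \<theta>)\<^sup>2 / (2 * s\<^sup>2))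
        \<le> exp (- r\<^sup>2 / (4 * s\<^sup>2)) * exp (- (y - \<theta>)\<^sup>2 / (2 * (sqrt 2 * s)\<^sup>2))"
      by (simp only: exp_add[symmetric] exp_le_cancel_iff)
    then have "normal_density \<theta> s y
        \<le> 1 / sqrt (2 * pi * s\<^sup>2) * (exp (- r\<^sup>2 / (4 * s\<^sup>2)) * exp (- (y - \<theta>)\<^sup>2 / (2 * (sqrt 2 * s)\<^sup>2)))"
      unfolding normal_density_def by (rule mult_left_mono) (use s_pos in simp)
    then show ?thesis
      unfolding factor normal_density_def by (simp only: mult_ac)
  qed
  have "emeasure (density lborel (normal_density \<theta> s)) {y. r \<le> \<bar>y - \<theta>\<bar>}
      = (\<integral>\<^sup>+y. ennreal (normal_density \<theta> s y) * indicator {y. r \<le> \<bar>y - \<theta>\<bar>} y \<partial>lborel)"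
    by (rule emeasure_density) measurable
  also have "\<dots> \<le> (\<integral>\<^sup>+y. ennreal ?T * ennreal (normal_density \<theta> (sqrt 2 * s) y) \<partial>lborel)"
    using wider by (intro nn_integral_mono) (auto simp: indicator_def ennreal_mult[symmetric] ennreal_leI)
  also have "\<dots> = ennreal ?T"
    using s_pos by (simp add: nn_integral_cmult nn_integral_normal_density)
  finally show ?thesis .
qed

lemma half_normal_density_le:
  assumes s_pos: "0 < s" and "\<bar>\<theta> - \<theta>\<^sub>0\<bar> \<le> s" "0 \<le> (\<theta> - \<theta>\<^sub>0) * (y - \<theta>\<^sub>0)"
  shows "normal_density \<theta>\<^sub>0 s y / 2 \<le> normal_density \<theta> s y"
proof -
  have "(y - \<theta>)\<^sup>2 = (y - \<theta>\<^sub>0)\<^sup>2 + (\<theta> - \<theta>\<^sub>0)\<^sup>2 - 2 * ((\<theta> - \<theta>\<^sub>0) * (y - \<theta>\<^sub>0))"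
    by (simp add: power2_eq_square algebra_simps)
  also have "\<dots> \<le> (y - \<theta>\<^sub>0)\<^sup>2 + s\<^sup>2"
    using assms abs_le_square_iff[of "\<theta> - \<theta>\<^sub>0" s] by auto
  finally have "(y - \<theta>)\<^sup>2 / (2 * s\<^sup>2) \<le> ((y - \<theta>\<^sub>0)\<^sup>2 + s\<^sup>2) / (2 * s\<^sup>2)"
    by (rule divide_right_mono) simp
  then have "- (y - \<theta>\<^sub>0)\<^sup>2 / (2 * s\<^sup>2) + - (1/2) \<le> - (y - \<theta>)\<^sup>2 / (2 * s\<^sup>2)"
    using s_pos by (simp add: add_divide_distrib)
  then have "exp (- (y - \<theta>\<^sub>0)\<^sup>2 / (2 * s\<^sup>2)) * exp (- (1/2)) \<le> exp (- (y - \<theta>)\<^sup>2 / (2 * s\<^sup>2))"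
    by (simp only: exp_add[symmetric] exp_le_cancel_iff)
  moreover have "1/2 \<le> exp (- (1/2) :: real)"
    using exp_ge_add_one_self[of "- (1/2) :: real"] by simp
  ultimately have "exp (- (y - \<theta>\<^sub>0)\<^sup>2 / (2 * s\<^sup>2)) * (1/2) \<le> exp (- (y - \<theta>)\<^sup>2 / (2 * s\<^sup>2))"
    by (meson exp_ge_zero mult_left_mono order_trans)
  from mult_left_mono[OF this, of "1 / sqrt (2 * pi * s\<^sup>2)"] show ?thesis
    by (simp add: normal_density_def)
qed

text \<open>Half of the interval \<open>[\<theta>\<^sub>0 - h, \<theta>\<^sub>0 + h]\<close> lies on the same side of \<open>\<theta>\<^sub>0\<close> as the observation \<open>y\<close>.\<close>

lemma evidence_normal_density_ge:
  assumes s_pos: "0 < s" and h_range: "0 < h" "h \<le> s" and [measurable]: "f \<in> borel_measurable borel"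
    and q_le: "0 \<le> q" "\<And>\<theta>. \<bar>\<theta> - \<theta>\<^sub>0\<bar> \<le> h \<Longrightarrow> q \<le> f \<theta>"
  shows "ennreal (q * h / 2 * normal_density \<theta>\<^sub>0 s y)
    \<le> evidence (\<lambda>\<theta>. normal_density \<theta> s) (density lborel (\<lambda>\<theta>. ennreal (f \<theta>))) y"
proof -
  interpret likelihood "\<lambda>\<theta>. normal_density \<theta> s"
    by (rule likelihood_normal_density[OF s_pos])
  define S where "S = (if \<theta>\<^sub>0 \<le> y then {\<theta>\<^sub>0..\<theta>\<^sub>0 + h} else {\<theta>\<^sub>0 - h..\<theta>\<^sub>0})"
  have "ennreal (q * h / 2 * normal_density \<theta>\<^sub>0 s y)
      = ennreal (q * (normal_density \<theta>\<^sub>0 s y / 2)) * emeasure lborel S"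
    using h_range q_le by (simp add: S_def ennreal_mult[symmetric] mult_ac)
  also have "\<dots> = (\<integral>\<^sup>+\<theta>. ennreal (q * (normal_density \<theta>\<^sub>0 s y / 2)) * indicator S \<theta> \<partial>lborel)"
    by (subst nn_integral_cmult_indicator) (auto simp: S_def)
  also have "\<dots> \<le> (\<integral>\<^sup>+\<theta>. ennreal (f \<theta>) * ennreal (normal_density \<theta> s y) \<partial>lborel)"
  proof (intro nn_integral_mono)
    fix \<theta>
    show "ennreal (q * (normal_density \<theta>\<^sub>0 s y / 2)) * indicator S \<theta>
        \<le> ennreal (f \<theta>) * ennreal (normal_density \<theta> s y)"
    proof (cases "\<theta> \<in> S")
      case True
      have near: "\<bar>\<theta> - \<theta>\<^sub>0\<bar> \<le> h" "0 \<le> (\<theta> - \<theta>\<^sub>0) * (y - \<theta>\<^sub>0)"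
        using True h_range by (auto simp: S_def mult_nonneg_nonneg mult_nonpos_nonpos split: if_splits)
      then have "q * (normal_density \<theta>\<^sub>0 s y / 2) \<le> f \<theta> * normal_density \<theta> s y"
        using s_pos h_range q_le order_trans[OF q_le(1) q_le(2)[OF near(1)]]
        by (intro mult_mono half_normal_density_le) auto
      then show ?thesis
        using True order_trans[OF q_le(1) q_le(2)[OF near(1)]] by (simp add: ennreal_mult[symmetric] ennreal_leI)
    qed simp
  qed
  also have "\<dots> = evidence (\<lambda>\<theta>. normal_density \<theta> s) (density lborel (\<lambda>\<theta>. ennreal (f \<theta>))) y"
    by (simp add: evidence_def nn_integral_density)
  finally show ?thesis .
qed

definition excess :: "real \<Rightarrow> real \<Rightarrow> real \<Rightarrow> ennreal" where
  "excess a \<theta>\<^sub>0 \<theta> = ennreal (\<bar>\<theta> - \<theta>\<^sub>0\<bar> - a)"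

lemma excess_measurable [measurable (raw)]:
  assumes [measurable]: "f \<in> borel_measurable M"
  shows "(\<lambda>x. excess a \<theta>\<^sub>0 (f x)) \<in> borel_measurable M"
  unfolding excess_def by measurable

lemma excess_eq_0: "\<bar>\<theta> - \<theta>\<^sub>0\<bar> \<le> a \<Longrightarrow> excess a \<theta>\<^sub>0 \<theta> = 0"
  by (simp add: excess_def ennreal_neg)

lemma excess_square_le:
  assumes "0 \<le> a"
  shows "(excess a \<theta>\<^sub>0 \<theta>)\<^sup>2 \<le> ennreal ((\<theta> - \<theta>\<^sub>0)\<^sup>2)"
proof (cases "\<bar>\<theta> - \<theta>\<^sub>0\<bar> \<le> a")
  case False
  then have "(\<bar>\<theta> - \<theta>\<^sub>0\<bar> - a)\<^sup>2 \<le> \<bar>\<theta> - \<theta>\<^sub>0\<bar>\<^sup>2"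
    using assms by (intro power_mono) auto
  then show ?thesis
    using False by (simp add: excess_def ennreal_power ennreal_leI)
qed (simp add: excess_eq_0)

lemma excess_le_1_plus_square:
  assumes "0 \<le> a"
  shows "excess a \<theta>\<^sub>0 \<theta> \<le> 1 + ennreal ((\<theta> - \<theta>\<^sub>0)\<^sup>2)"
proof -
  have "\<bar>\<theta> - \<theta>\<^sub>0\<bar> - a \<le> 1 + (\<theta> - \<theta>\<^sub>0)\<^sup>2"
    using sum_squares_bound[of 1 "\<bar>\<theta> - \<theta>\<^sub>0\<bar>"] abs_ge_zero[of "\<theta> - \<theta>\<^sub>0"] assms
    by (simp del: abs_ge_zero)
  then show ?thesis
    unfolding excess_def by (metis ennreal_1 ennreal_leI ennreal_plus zero_le_one zero_le_power2)
qed

locale gaussian_experiment = bayes_experiment "\<lambda>\<theta>. normal_density \<theta> s" \<rho> for s \<rho> +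
  assumes s_pos: "0 < s"
begin

context
  fixes \<theta>\<^sub>0 c a m :: real
  assumes evidence_ge: "0 < c" "\<And>y. ennreal (c * normal_density \<theta>\<^sub>0 s y) \<le> evidence (\<lambda>\<theta>. normal_density \<theta> s) \<rho> y"
    and a_nonneg: "0 \<le> a"
    and second_moment: "0 \<le> m" "(\<integral>\<^sup>+\<theta>. ennreal ((\<theta> - \<theta>\<^sub>0)\<^sup>2) \<partial>\<rho>) \<le> ennreal m"
begin

lemma posterior_excess_near_le:
  defines "T \<equiv> sqrt 2 * exp (- (a / 2)\<^sup>2 / (4 * s\<^sup>2))"
  shows "(\<integral>\<^sup>+y. (\<integral>\<^sup>+\<theta>. excess a \<theta>\<^sub>0 \<theta> \<partial>bayes_update (\<lambda>\<theta>. normal_density \<theta> s) \<rho> y) * indicator {y. \<bar>y - \<theta>\<^sub>0\<bar> < a / 2} y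
      \<partial>density lborel (normal_density \<theta>\<^sub>0 s)) \<le> ennreal (T * (1 + m) / c)"
    (is "?lhs \<le> _")
proof -
  let ?N = "{y. \<bar>y - \<theta>\<^sub>0\<bar> < a / 2}" and ?Q = "\<lambda>\<theta>. density lborel (normal_density \<theta> s)"
  have likelihood_near: "excess a \<theta>\<^sub>0 \<theta> * emeasure (?Q \<theta>) ?N \<le> excess a \<theta>\<^sub>0 \<theta> * ennreal T" for \<theta>
  proof (cases "\<bar>\<theta> - \<theta>\<^sub>0\<bar> \<le> a")
    case False
    have "emeasure (?Q \<theta>) ?N \<le> emeasure (?Q \<theta>) {y. a / 2 \<le> \<bar>y - \<theta>\<bar>}"
      using False by (intro emeasure_mono) (auto simp: abs_if split: if_splits)
    also have "\<dots> \<le> ennreal T"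
      unfolding T_def using a_nonneg by (intro emeasure_normal_density_tail_le s_pos) auto
    finally show ?thesis by (rule mult_left_mono) simp
  qed (simp add: excess_eq_0)
  have "?lhs \<le> ennreal (1 / c) * (\<integral>\<^sup>+\<theta>. excess a \<theta>\<^sub>0 \<theta> * (\<integral>\<^sup>+y. indicator ?N y \<partial>?Q \<theta>) \<partial>\<rho>)"
    by (rule nn_integral_bayes_update_le[OF _ _ evidence_ge]) measurable
  also have "\<dots> \<le> ennreal (1 / c) * (\<integral>\<^sup>+\<theta>. (1 + ennreal ((\<theta> - \<theta>\<^sub>0)\<^sup>2)) * ennreal T \<partial>\<rho>)"
    using order_trans[OF likelihood_near mult_right_mono[OF excess_le_1_plus_square[OF a_nonneg]]]
    by (intro mult_left_mono nn_integral_mono) auto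
  also have "\<dots> = ennreal (1 / c) * ((1 + (\<integral>\<^sup>+\<theta>. ennreal ((\<theta> - \<theta>\<^sub>0)\<^sup>2) \<partial>\<rho>)) * ennreal T)"
    by (simp add: nn_integral_multc nn_integral_add prior.emeasure_space_1)
  also have "\<dots> \<le> ennreal (1 / c) * ((1 + ennreal m) * ennreal T)"
    by (intro mult_left_mono mult_right_mono add_left_mono second_moment) auto
  also have "\<dots> = ennreal (1 / c) * (ennreal (1 + m) * ennreal T)"
    using second_moment(1) by simp
  also have "\<dots> = ennreal (T * (1 + m) / c)"
    using evidence_ge(1) second_moment(1) by (simp add: ennreal_mult[symmetric] T_def mult_ac del: ennreal_plus)
  finally show ?thesis .
qed

lemma posterior_excess_far_le:
  defines "T \<equiv> sqrt 2 * exp (- (a / 2)\<^sup>2 / (4 * s\<^sup>2))"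
  shows "(\<integral>\<^sup>+y. (\<integral>\<^sup>+\<theta>. excess a \<theta>\<^sub>0 \<theta> \<partial>bayes_update (\<lambda>\<theta>. normal_density \<theta> s) \<rho> y) * indicator {y. a / 2 \<le> \<bar>y - \<theta>\<^sub>0\<bar>} y
      \<partial>density lborel (normal_density \<theta>\<^sub>0 s)) \<le> ennreal (sqrt (T * m / c))"
    (is "(\<integral>\<^sup>+y. ?E y * indicator ?F y \<partial>?Q) \<le> _")
proof (rule ennreal_le_sqrtI)
  let ?p = "\<lambda>\<theta>. normal_density \<theta> s"
  have "(\<integral>\<^sup>+y. ?E y * indicator ?F y \<partial>?Q)\<^sup>2 \<le> (\<integral>\<^sup>+y. (?E y)\<^sup>2 \<partial>?Q) * (\<integral>\<^sup>+y. (indicator ?F y)\<^sup>2 \<partial>?Q)"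
    by (rule Cauchy_Schwarz_nn_integral) measurable
  also have "(\<integral>\<^sup>+y. (indicator ?F y :: ennreal)\<^sup>2 \<partial>?Q) = (\<integral>\<^sup>+y. indicator ?F y \<partial>?Q)"
    by (intro nn_integral_cong) (simp add: indicator_def)
  also have "\<dots> = emeasure ?Q ?F"
    by simp
  also have "(\<integral>\<^sup>+y. (?E y)\<^sup>2 \<partial>?Q) * emeasure ?Q ?F \<le> ennreal (m / c) * ennreal T"
  proof (rule mult_mono)
    have "(\<integral>\<^sup>+y. (?E y)\<^sup>2 \<partial>?Q) \<le> posterior_risk ?p \<rho> \<theta>\<^sub>0 (\<lambda>\<theta>. (excess a \<theta>\<^sub>0 \<theta>)\<^sup>2)"
      unfolding posterior_risk_def
      by (intro nn_integral_mono prob_space.nn_integral_square_le[OF prob_space_bayes_update]) measurable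
    also have "\<dots> \<le> ennreal (1 / c) * (\<integral>\<^sup>+\<theta>. (excess a \<theta>\<^sub>0 \<theta>)\<^sup>2 \<partial>\<rho>)"
      by (rule posterior_risk_le[OF _ evidence_ge]) measurable
    also have "\<dots> \<le> ennreal (1 / c) * ennreal m"
      by (intro mult_left_mono order_trans[OF nn_integral_mono second_moment(2)] excess_square_le a_nonneg) auto
    finally show "(\<integral>\<^sup>+y. (?E y)\<^sup>2 \<partial>?Q) \<le> ennreal (m / c)"
      using evidence_ge(1) second_moment(1) by (simp add: ennreal_mult[symmetric])
    show "emeasure ?Q ?F \<le> ennreal T"
      unfolding T_def using a_nonneg by (intro emeasure_normal_density_tail_le s_pos) auto
  qed auto
  finally show "(\<integral>\<^sup>+y. ?E y * indicator ?F y \<partial>?Q)\<^sup>2 \<le> ennreal (T * m / c)"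
    using evidence_ge(1) second_moment(1) by (simp add: ennreal_mult[symmetric] T_def mult_ac)
qed

text \<open>If the observation is within \<open>a/2\<close> of \<open>\<theta>\<^sub>0\<close>, then parameters at distance more than \<open>a\<close> from
  \<open>\<theta>\<^sub>0\<close> have exponentially small likelihood; all other observations are themselves unlikely.\<close>

lemma posterior_excess_le_tails:
  defines "T \<equiv> sqrt 2 * exp (- (a / 2)\<^sup>2 / (4 * s\<^sup>2))"
  shows "posterior_risk (\<lambda>\<theta>. normal_density \<theta> s) \<rho> \<theta>\<^sub>0 (excess a \<theta>\<^sub>0)
    \<le> ennreal (T * (1 + m) / c + sqrt (T * m / c))"
proof -
  let ?Q = "density lborel (normal_density \<theta>\<^sub>0 s)"
  let ?E = "\<lambda>y. \<integral>\<^sup>+\<theta>. excess a \<theta>\<^sub>0 \<theta> \<partial>bayes_update (\<lambda>\<theta>. normal_density \<theta> s) \<rho> y"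
  have "posterior_risk (\<lambda>\<theta>. normal_density \<theta> s) \<rho> \<theta>\<^sub>0 (excess a \<theta>\<^sub>0)
      = (\<integral>\<^sup>+y. ?E y * indicator {y. \<bar>y - \<theta>\<^sub>0\<bar> < a / 2} y + ?E y * indicator {y. a / 2 \<le> \<bar>y - \<theta>\<^sub>0\<bar>} y \<partial>?Q)"
    unfolding posterior_risk_def by (intro nn_integral_cong) (auto simp: indicator_def)
  also have "\<dots> = (\<integral>\<^sup>+y. ?E y * indicator {y. \<bar>y - \<theta>\<^sub>0\<bar> < a / 2} y \<partial>?Q)
      + (\<integral>\<^sup>+y. ?E y * indicator {y. a / 2 \<le> \<bar>y - \<theta>\<^sub>0\<bar>} y \<partial>?Q)"
    by (rule nn_integral_add) measurable
  also have "\<dots> \<le> ennreal (T * (1 + m) / c) + ennreal (sqrt (T * m / c))"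
    unfolding T_def by (intro add_mono posterior_excess_near_le posterior_excess_far_le)
  also have "\<dots> = ennreal (T * (1 + m) / c + sqrt (T * m / c))"
    using evidence_ge(1) second_moment(1) by (simp add: T_def)
  finally show ?thesis .
qed

end

end

locale gaussian_sequence = sequence_model "\<lambda>\<theta>. normal_density \<theta> s" I \<pi> for s I \<pi> +
  assumes s_pos: "0 < s"
begin

sublocale coord: gaussian_experiment s "\<pi> i" for i
  by unfold_locales (rule s_pos)

lemma obs_absolutely_continuous:
  assumes sum_finite: "(\<integral>\<^sup>+i. ennreal ((\<theta> i - \<theta>\<^sub>0 i)\<^sup>2) \<partial>count_space I) < \<top>"
  shows "absolutely_continuous (obs \<theta>) (obs \<theta>\<^sub>0)"
  unfolding obs_def
proof (rule PiM_absolutely_continuous[OF product_prob_space_obs product_prob_space_obs])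
  let ?r = "\<lambda>i y. ennreal (normal_density (\<theta>\<^sub>0 i) s y / normal_density (\<theta> i) s y)"
  show "?r i \<in> borel_measurable (density lborel (normal_density (\<theta> i) s))" for i by simp
  show "density lborel (normal_density (\<theta>\<^sub>0 i) s) = density (density lborel (normal_density (\<theta> i) s)) (?r i)" for i
    by (rule density_normal_density_ratio[OF s_pos])
  define C where "C = enn2real (\<integral>\<^sup>+i. ennreal ((\<theta> i - \<theta>\<^sub>0 i)\<^sup>2) \<partial>count_space I)"
  fix J assume J_finite: "finite J" "J \<subseteq> I"
  have "ennreal (\<Sum>j\<in>J. (\<theta> j - \<theta>\<^sub>0 j)\<^sup>2) = (\<integral>\<^sup>+i. ennreal ((\<theta> i - \<theta>\<^sub>0 i)\<^sup>2) * indicator J i \<partial>count_space I)"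
    using J_finite by (subst nn_integral_indicator_finite) (auto simp: subset_iff)
  also have "\<dots> \<le> (\<integral>\<^sup>+i. ennreal ((\<theta> i - \<theta>\<^sub>0 i)\<^sup>2) \<partial>count_space I)"
    by (intro nn_integral_mono) (simp add: indicator_def)
  also have "\<dots> = ennreal C"
    using sum_finite by (simp add: C_def)
  finally have sum_le: "(\<Sum>j\<in>J. (\<theta> j - \<theta>\<^sub>0 j)\<^sup>2) \<le> C"
    by (simp add: C_def)
  have "(\<Prod>j\<in>J. \<integral>\<^sup>+y. (?r j y)\<^sup>2 \<partial>density lborel (normal_density (\<theta> j) s))
      = ennreal (exp ((\<Sum>j\<in>J. (\<theta> j - \<theta>\<^sub>0 j)\<^sup>2) / s\<^sup>2))"
    using J_finite
    by (simp add: nn_integral_normal_density_ratio_square[OF s_pos] prod_ennreal exp_sum sum_divide_distrib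
        power2_commute[of "\<theta>\<^sub>0 _"])
  also have "\<dots> \<le> ennreal (exp (C / s\<^sup>2))"
    using sum_le s_pos by (intro ennreal_leI) (simp add: divide_right_mono)
  finally show "(\<Prod>j\<in>J. \<integral>\<^sup>+y. (?r j y)\<^sup>2 \<partial>density lborel (normal_density (\<theta> j) s)) \<le> ennreal (exp (C / s\<^sup>2))" .
qed

text \<open>By Cameron-Martin, it suffices that one prior draw \<open>\<theta>\<close> with \<open>\<theta> - \<theta>\<^sub>0\<close> square summable
  gives the null set measure zero; almost every draw does.\<close>

lemma marginal_absolutely_continuous:
  assumes countable_I: "countable I"
    and sum_finite: "(\<integral>\<^sup>+i. \<integral>\<^sup>+\<theta>. ennreal ((\<theta> - \<theta>\<^sub>0 i)\<^sup>2) \<partial>\<pi> i \<partial>count_space I) < \<top>"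
  shows "absolutely_continuous marginal (obs \<theta>\<^sub>0)"
  unfolding absolutely_continuous_def
proof
  fix A assume "A \<in> null_sets marginal"
  then have A_sets[measurable]: "A \<in> sets borel_seq" and "emeasure marginal A = 0"
    by (auto simp: sets_marginal)
  then have "(\<integral>\<^sup>+\<theta>. emeasure (obs \<theta>) A \<partial>PiM I \<pi>) = 0"
    unfolding marginal_def by (subst (asm) emeasure_bind[OF prior.P.not_empty obs_kernel A_sets])
  then have null_AE: "AE \<theta> in PiM I \<pi>. emeasure (obs \<theta>) A = 0"
    using measurable_compose[OF obs_kernel measurable_emeasure_subprob_algebra[OF A_sets]]
    by (subst (asm) nn_integral_0_iff_AE) auto
  let ?S = "\<lambda>\<theta>. \<integral>\<^sup>+i. ennreal ((\<theta> i - \<theta>\<^sub>0 i)\<^sup>2) \<partial>count_space I"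
  have component_square_measurable: "(\<lambda>\<theta>. ennreal ((\<theta> i - \<theta>\<^sub>0 i)\<^sup>2)) \<in> borel_measurable (PiM I \<pi>)" if "i \<in> I" for i
    using that by measurable
  have "(\<integral>\<^sup>+\<theta>. ?S \<theta> \<partial>PiM I \<pi>) = (\<integral>\<^sup>+i. \<integral>\<^sup>+\<theta>. ennreal ((\<theta> i - \<theta>\<^sub>0 i)\<^sup>2) \<partial>PiM I \<pi> \<partial>count_space I)"
    by (rule nn_integral_count_space_nn_integral[OF countable_I component_square_measurable])
  also have "\<dots> = (\<integral>\<^sup>+i. \<integral>\<^sup>+\<theta>. ennreal ((\<theta> - \<theta>\<^sub>0 i)\<^sup>2) \<partial>\<pi> i \<partial>count_space I)"
    by (intro nn_integral_cong prior.nn_integral_component_PiM) auto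
  finally have "AE \<theta> in PiM I \<pi>. ?S \<theta> \<noteq> \<infinity>"
    using sum_finite
    by (intro nn_integral_PInf_AE
        borel_measurable_nn_integral_count_space[OF countable_I component_square_measurable]) auto
  with null_AE have "AE \<theta> in PiM I \<pi>. emeasure (obs \<theta>) A = 0 \<and> ?S \<theta> < \<top>"
    by eventually_elim (simp add: less_top)
  moreover have "ae_filter (PiM I \<pi>) \<noteq> bot"
    by (simp add: ae_filter_eq_bot_iff prior.P.emeasure_space_1)
  ultimately obtain \<theta> where "emeasure (obs \<theta>) A = 0" "?S \<theta> < \<top>"
    by (blast dest: eventually_happens')
  then have "A \<in> null_sets (obs \<theta>)" "absolutely_continuous (obs \<theta>) (obs \<theta>\<^sub>0)"
    using A_sets by (auto intro: obs_absolutely_continuous simp: sets_obs)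
  then show "A \<in> null_sets (obs \<theta>\<^sub>0)"
    by (auto simp: absolutely_continuous_def)
qed

end

section \<open>The supremum distance in terms of the coefficients\<close>

definition square_integrable_01 :: "(real \<Rightarrow> real) \<Rightarrow> bool" where
  "square_integrable_01 g \<longleftrightarrow> g \<in> borel_measurable borel \<and> set_integrable lborel {0..1} (\<lambda>t. (g t)\<^sup>2)"

lemma square_integrable_01_bounded:
  assumes [measurable]: "g \<in> borel_measurable borel" and bound: "\<And>t. t \<in> {0..1} \<Longrightarrow> \<bar>g t\<bar> \<le> C"
  shows "square_integrable_01 g"
proof -
  have "set_integrable lborel {0..1} (\<lambda>t. (g t)\<^sup>2)"
    unfolding set_integrable_def
  proof (rule Bochner_Integration.integrable_bound)
    show "integrable lborel (\<lambda>t. C\<^sup>2 * indicator {0..1::real} t)" by simp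
    show "AE t in lborel. norm (indicator {0..1} t *\<^sub>R (g t)\<^sup>2) \<le> norm (C\<^sup>2 * indicator {0..1} t)"
      using power_mono[OF bound abs_ge_zero, of _ 2] by (intro AE_I2) (auto simp: indicator_def)
  qed simp
  then show ?thesis by (simp add: square_integrable_01_def)
qed

lemma square_integrable_01_mult:
  assumes "square_integrable_01 f" "square_integrable_01 g"
  shows "set_integrable lborel {0..1} (\<lambda>t. f t * g t)"
  unfolding set_integrable_def
proof (rule Bochner_Integration.integrable_bound)
  have [measurable]: "f \<in> borel_measurable borel" "g \<in> borel_measurable borel"
    using assms by (simp_all add: square_integrable_01_def)
  show "integrable lborel (\<lambda>t. indicator {0..1} t *\<^sub>R (f t)\<^sup>2 + indicator {0..1} t *\<^sub>R (g t)\<^sup>2)"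
    using assms by (simp add: square_integrable_01_def set_integrable_def)
  have "\<bar>f t * g t\<bar> \<le> (f t)\<^sup>2 + (g t)\<^sup>2" for t
    using sum_squares_bound[of "\<bar>f t\<bar>" "\<bar>g t\<bar>"] mult_nonneg_nonneg[OF abs_ge_zero[of "f t"] abs_ge_zero[of "g t"]]
    unfolding abs_mult power2_abs by linarith
  then show "AE t in lborel. norm (indicator {0..1} t *\<^sub>R (f t * g t))
      \<le> norm (indicator {0..1} t *\<^sub>R (f t)\<^sup>2 + indicator {0..1} t *\<^sub>R (g t)\<^sup>2)"
    by (intro AE_I2) (simp add: indicator_def)
  show "(\<lambda>t. indicator {0..1} t *\<^sub>R (f t * g t)) \<in> borel_measurable lborel"
    by measurable
qed

lemma square_integrable_01_diff:
  assumes "square_integrable_01 f" "square_integrable_01 g"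
  shows "square_integrable_01 (\<lambda>t. f t - g t)"
proof -
  have "set_integrable lborel {0..1} (\<lambda>t. (f t)\<^sup>2 + (g t)\<^sup>2 - 2 * (f t * g t))"
    using assms square_integrable_01_mult[OF assms]
    by (intro set_integral_diff(1) set_integral_add(1) set_integrable_mult_right)
      (simp_all add: square_integrable_01_def)
  moreover have "(f t - g t)\<^sup>2 = (f t)\<^sup>2 + (g t)\<^sup>2 - 2 * (f t * g t)" for t
    by (simp add: power2_diff)
  ultimately show ?thesis
    using assms by (auto simp: square_integrable_01_def)
qed

lemma ip01_diff_left:
  assumes "square_integrable_01 f" "square_integrable_01 g" "square_integrable_01 h"
  shows "ip01 (\<lambda>t. f t - g t) h = ip01 f h - ip01 g h"
  unfolding ip01_def left_diff_distrib
  using assms by (intro set_integral_diff(2) square_integrable_01_mult)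

lemma ip01_eq_0_AE:
  assumes "square_integrable_01 h" "ip01 h h = 0"
  shows "AE t in lborel. t \<in> {0..1} \<longrightarrow> h t = 0"
proof -
  have "(LINT t|lborel. indicator {0..1} t *\<^sub>R (h t)\<^sup>2) = 0"
    using assms(2) unfolding ip01_def set_lebesgue_integral_def by (simp add: power2_eq_square)
  then have "AE t in lborel. indicator {0..1} t *\<^sub>R (h t)\<^sup>2 = 0"
    using assms(1) unfolding square_integrable_01_def set_integrable_def
    by (subst (asm) integral_nonneg_eq_0_iff_AE) auto
  then show ?thesis by eventually_elim auto
qed

lemma ip01_sums:
  assumes f_bounded: "\<And>l. f l \<in> borel_measurable borel" "\<And>l t. t \<in> {0..1} \<Longrightarrow> \<bar>f l t\<bar> \<le> r l"
    and r_summable: "summable r" and h_square_integrable: "square_integrable_01 h"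
  shows "(\<lambda>l. ip01 (f l) h) sums ip01 (\<lambda>t. \<Sum>l. f l t) h"
proof -
  have [measurable]: "f l \<in> borel_measurable borel" "h \<in> borel_measurable borel" for l
    using f_bounded h_square_integrable by (simp_all add: square_integrable_01_def)
  have h_abs: "set_integrable lborel {0..1} (\<lambda>t. \<bar>h t\<bar>)"
    using square_integrable_01_mult[OF square_integrable_01_bounded[of "\<lambda>_. 1" 1] h_square_integrable]
    by (simp add: set_integrable_abs)
  let ?g = "\<lambda>l t. indicator {0..1} t *\<^sub>R (f l t * h t)"
  have g_le: "norm (?g l t) \<le> r l * (indicator {0..1} t *\<^sub>R \<bar>h t\<bar>)" for l t
    using f_bounded(2)[of t l] by (auto simp: indicator_def abs_mult intro: mult_right_mono)
  have bound_integrable: "integrable lborel (\<lambda>t. r l * (indicator {0..1} t *\<^sub>R \<bar>h t\<bar>))" for l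
    using h_abs by (simp add: set_integrable_def)
  have g_integrable: "integrable lborel (?g l)" for l
    by (rule Bochner_Integration.integrable_bound[OF bound_integrable])
      (use order_trans[OF g_le abs_ge_self] in auto)
  have "(\<lambda>l. integral\<^sup>L lborel (?g l)) sums (LINT t|lborel. (\<Sum>l. ?g l t))"
  proof (rule sums_integral[OF g_integrable])
    show "AE t in lborel. summable (\<lambda>l. norm (?g l t))"
      using g_le by (intro AE_I2 summable_comparison_test'[OF summable_mult2[OF r_summable], of 0]) simp
    have "(LINT t|lborel. norm (?g l t)) \<le> r l * (LINT t:{0..1}|lborel. \<bar>h t\<bar>)" for l
      unfolding set_lebesgue_integral_def integral_mult_right_zero[symmetric]
      by (intro integral_mono integrable_norm g_integrable bound_integrable g_le)
    then show "summable (\<lambda>l. LINT t|lborel. norm (?g l t))"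
      by (intro summable_comparison_test'[OF summable_mult2[OF r_summable], of 0]) simp
  qed
  moreover have "(\<Sum>l. ?g l t) = indicator {0..1} t *\<^sub>R ((\<Sum>l. f l t) * h t)" for t
  proof (cases "t \<in> {0..1}")
    case True
    then have "summable (\<lambda>l. f l t)"
      using f_bounded(2) by (intro summable_comparison_test'[OF r_summable, of 0]) simp
    then show ?thesis using True by (simp add: suminf_mult2)
  qed simp
  ultimately show ?thesis
    unfolding ip01_def set_lebesgue_integral_def by simp
qed

locale wavelet =
  fixes \<psi> :: "nat \<Rightarrow> nat \<Rightarrow> real \<Rightarrow> real" and \<alpha> C :: real
  assumes wavelet_basis: "wavelet_basis \<psi> \<alpha>" and C_pos: "0 < C"
    and sum_abs_wavelet_le: "\<And>l t. t \<in> {0..1} \<Longrightarrow> (\<Sum>k<2 ^ l. \<bar>\<psi> l k t\<bar>) \<le> C * 2 powr (real l / 2)"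
begin

lemma wavelet_measurable: "k < 2 ^ l \<Longrightarrow> \<psi> l k \<in> borel_measurable borel"
  using wavelet_basis unfolding wavelet_basis_def by simp

lemma ip01_wavelet:
  "k < 2 ^ l \<Longrightarrow> k' < 2 ^ l' \<Longrightarrow> ip01 (\<psi> l k) (\<psi> l' k') = (if (l, k) = (l', k') then 1 else 0)"
  using wavelet_basis unfolding wavelet_basis_def by blast

lemma square_integrable_wavelet:
  assumes "k < 2 ^ l"
  shows "square_integrable_01 (\<psi> l k)"
proof (rule square_integrable_01_bounded[OF wavelet_measurable[OF assms]])
  fix t :: real assume "t \<in> {0..1}"
  have "\<bar>\<psi> l k t\<bar> \<le> (\<Sum>k<2 ^ l. \<bar>\<psi> l k t\<bar>)"
    using assms by (intro member_le_sum) auto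
  also have "\<dots> \<le> C * 2 powr (real l / 2)"
    by (rule sum_abs_wavelet_le) fact
  finally show "\<bar>\<psi> l k t\<bar> \<le> C * 2 powr (real l / 2)" .
qed

lemma AE_eqI:
  assumes f_square_integrable: "square_integrable_01 f" and g_square_integrable: "square_integrable_01 g"
    and ip01_eq: "\<And>l k. k < 2 ^ l \<Longrightarrow> ip01 f (\<psi> l k) = ip01 g (\<psi> l k)"
  shows "AE t in lborel. t \<in> {0..1} \<longrightarrow> f t = g t"
proof -
  let ?h = "\<lambda>t. f t - g t"
  have diff_square_integrable: "square_integrable_01 ?h"
    by (rule square_integrable_01_diff[OF f_square_integrable g_square_integrable])
  then have "((\<lambda>(l, k). (ip01 ?h (\<psi> l k))\<^sup>2) has_sum ip01 ?h ?h) wav_index"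
    using wavelet_basis unfolding wavelet_basis_def square_integrable_01_def by simp
  moreover have "((\<lambda>(l, k). (ip01 ?h (\<psi> l k))\<^sup>2) has_sum 0) wav_index"
    by (rule has_sum_0)
      (auto simp: wav_index_def ip01_eq ip01_diff_left[OF f_square_integrable g_square_integrable square_integrable_wavelet])
  ultimately have "ip01 ?h ?h = 0" by (rule has_sum_unique)
  from ip01_eq_0_AE[OF diff_square_integrable this] show ?thesis by simp
qed

lemma level_term_measurable [measurable]: "(\<lambda>t. level_term \<psi> \<theta> t l) \<in> borel_measurable borel"
  unfolding level_term_def by (intro borel_measurable_sum borel_measurable_times) (auto intro: wavelet_measurable)

lemma abs_level_term_le:
  assumes "t \<in> {0..1}" and coeff_bound: "\<And>k. k < 2 ^ l \<Longrightarrow> \<bar>\<theta> (l, k)\<bar> \<le> D"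
  shows "\<bar>level_term \<psi> \<theta> t l\<bar> \<le> C * 2 powr (real l / 2) * D"
proof -
  have "0 \<le> D" using order_trans[OF abs_ge_zero coeff_bound[of 0]] by simp
  have "\<bar>level_term \<psi> \<theta> t l\<bar> \<le> (\<Sum>k<2 ^ l. \<bar>\<theta> (l, k)\<bar> * \<bar>\<psi> l k t\<bar>)"
    unfolding level_term_def by (rule order_trans[OF sum_abs]) (simp add: abs_mult)
  also have "\<dots> \<le> (\<Sum>k<2 ^ l. \<bar>\<psi> l k t\<bar>) * D"
    unfolding sum_distrib_right using coeff_bound
    by (intro sum_mono) (metis abs_ge_zero lessThan_iff mult.commute mult_right_mono)
  also have "\<dots> \<le> C * 2 powr (real l / 2) * D"
    using assms(1) \<open>0 \<le> D\<close> by (intro mult_right_mono sum_abs_wavelet_le)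
  finally show ?thesis .
qed

lemma ip01_level_term:
  assumes k_less: "k < 2 ^ l"
  shows "ip01 (\<lambda>t. level_term \<psi> \<theta> t l') (\<psi> l k) = (if l' = l then \<theta> (l, k) else 0)"
proof -
  have summand_integrable: "integrable lborel (\<lambda>t. \<theta> (l', k') * (indicator {0..1} t *\<^sub>R (\<psi> l' k' t * \<psi> l k t)))"
    if "k' < 2 ^ l'" for k'
    using square_integrable_01_mult[OF square_integrable_wavelet[OF that] square_integrable_wavelet[OF k_less]]
    by (simp add: set_integrable_def)
  have "ip01 (\<lambda>t. level_term \<psi> \<theta> t l') (\<psi> l k)
      = (LINT t|lborel. (\<Sum>k'<2 ^ l'. \<theta> (l', k') * (indicator {0..1} t *\<^sub>R (\<psi> l' k' t * \<psi> l k t))))"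
    unfolding ip01_def level_term_def set_lebesgue_integral_def
    by (simp add: sum_distrib_right sum_distrib_left mult_ac)
  also have "\<dots> = (\<Sum>k'<2 ^ l'. \<theta> (l', k') * ip01 (\<psi> l' k') (\<psi> l k))"
    unfolding ip01_def set_lebesgue_integral_def
    using summand_integrable by (subst Bochner_Integration.integral_sum) simp_all
  also have "\<dots> = (\<Sum>k'<2 ^ l'. if k' = k then (if l' = l then \<theta> (l, k) else 0) else 0)"
    using k_less by (intro sum.cong) (auto simp: ip01_wavelet)
  also have "\<dots> = (if l' = l then \<theta> (l, k) else 0)"
    using k_less by auto
  finally show ?thesis .
qed

context
  fixes \<theta> :: "nat \<times> nat \<Rightarrow> real" and D :: "nat \<Rightarrow> real"
  assumes coeff_le: "\<And>l k. k < 2 ^ l \<Longrightarrow> \<bar>\<theta> (l, k)\<bar> \<le> D l"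
    and summable_coeff: "summable (\<lambda>l. C * 2 powr (real l / 2) * D l)"
begin

lemma summable_abs_level_term: "t \<in> {0..1} \<Longrightarrow> summable (\<lambda>l. \<bar>level_term \<psi> \<theta> t l\<bar>)"
  by (rule summable_comparison_test'[OF summable_coeff, of 0])
    (simp only: real_norm_def abs_abs abs_level_term_le coeff_le)

lemma abs_suminf_level_term_le:
  assumes "t \<in> {0..1}"
  shows "\<bar>suminf (level_term \<psi> \<theta> t)\<bar> \<le> (\<Sum>l. C * 2 powr (real l / 2) * D l)"
proof -
  have "\<bar>suminf (level_term \<psi> \<theta> t)\<bar> \<le> (\<Sum>l. \<bar>level_term \<psi> \<theta> t l\<bar>)"
    by (rule summable_rabs[OF summable_abs_level_term[OF assms]])
  also have "\<dots> \<le> (\<Sum>l. C * 2 powr (real l / 2) * D l)"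
    by (intro suminf_le abs_level_term_le coeff_le assms summable_abs_level_term summable_coeff)
  finally show ?thesis .
qed

lemma square_integrable_suminf_level_term: "square_integrable_01 (\<lambda>t. suminf (level_term \<psi> \<theta> t))"
  by (rule square_integrable_01_bounded[OF borel_measurable_suminf[OF level_term_measurable]
        abs_suminf_level_term_le])

lemma ip01_suminf_level_term:
  assumes "k < 2 ^ l"
  shows "ip01 (\<lambda>t. suminf (level_term \<psi> \<theta> t)) (\<psi> l k) = \<theta> (l, k)"
proof -
  have "(\<lambda>l'. ip01 (\<lambda>t. level_term \<psi> \<theta> t l') (\<psi> l k)) sums ip01 (\<lambda>t. suminf (level_term \<psi> \<theta> t)) (\<psi> l k)"
    by (rule ip01_sums[OF level_term_measurable abs_level_term_le summable_coeff square_integrable_wavelet])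
      (use assms coeff_le in auto)
  then have "(\<lambda>l'. if l' = l then \<theta> (l, k) else 0) sums ip01 (\<lambda>t. suminf (level_term \<psi> \<theta> t)) (\<psi> l k)"
    by (simp only: ip01_level_term[OF assms])
  then show ?thesis
    by (rule sums_unique2) (rule sums_single[of l "\<lambda>_. \<theta> (l, k)"])
qed

end

context
  fixes f0 :: "real \<Rightarrow> real" and D\<^sub>0 :: "nat \<Rightarrow> real"
  assumes square_integrable_f0: "square_integrable_01 f0"
    and coeff_f0_le: "\<And>l k. k < 2 ^ l \<Longrightarrow> \<bar>ip01 f0 (\<psi> l k)\<bar> \<le> D\<^sub>0 l"
    and summable_coeff_f0: "summable (\<lambda>l. C * 2 powr (real l / 2) * D\<^sub>0 l)"
begin

lemma summable_level_term_f0: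
  "t \<in> {0..1} \<Longrightarrow> summable (level_term \<psi> (\<lambda>(l, k). ip01 f0 (\<psi> l k)) t)"
  by (rule summable_rabs_cancel[OF summable_abs_level_term[OF _ summable_coeff_f0]])
    (simp_all add: coeff_f0_le)

lemma suminf_level_term_f0_AE_eq:
  "AE t in lborel. t \<in> {0..1} \<longrightarrow> suminf (level_term \<psi> (\<lambda>(l, k). ip01 f0 (\<psi> l k)) t) = f0 t"
proof (rule AE_eqI[OF _ square_integrable_f0])
  let ?\<theta>\<^sub>0 = "\<lambda>(l, k). ip01 f0 (\<psi> l k)"
  show "square_integrable_01 (\<lambda>t. suminf (level_term \<psi> ?\<theta>\<^sub>0 t))"
    by (rule square_integrable_suminf_level_term[OF _ summable_coeff_f0]) (simp add: coeff_f0_le)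
  show "ip01 (\<lambda>t. suminf (level_term \<psi> ?\<theta>\<^sub>0 t)) (\<psi> l k) = ip01 f0 (\<psi> l k)" if "k < 2 ^ l" for l k
    using ip01_suminf_level_term[OF _ summable_coeff_f0 that, of ?\<theta>\<^sub>0] by (simp add: coeff_f0_le)
qed

lemma sup_dist_le:
  assumes diff_le: "\<And>l k. k < 2 ^ l \<Longrightarrow> \<bar>\<theta> (l, k) - ip01 f0 (\<psi> l k)\<bar> \<le> D l"
    and D_summable: "summable (\<lambda>l. C * 2 powr (real l / 2) * D l)"
  shows "sup_dist \<psi> f0 \<theta> \<le> ennreal (\<Sum>l. C * 2 powr (real l / 2) * D l)"
proof -
  let ?\<theta>\<^sub>0 = "\<lambda>(l, k). ip01 f0 (\<psi> l k)"
  define d where "d i = \<theta> i - ?\<theta>\<^sub>0 i" for i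
  have d_le: "\<bar>d (l, k)\<bar> \<le> D l" if "k < 2 ^ l" for l k
    using diff_le[OF that] by (simp add: d_def)
  have level_term_split: "level_term \<psi> \<theta> t = (\<lambda>l. level_term \<psi> d t l + level_term \<psi> ?\<theta>\<^sub>0 t l)" for t
    by (simp add: level_term_def d_def fun_eq_iff sum.distrib[symmetric] distrib_right[symmetric])
  have summable_d: "summable (level_term \<psi> d t)" if "t \<in> {0..1}" for t
    by (rule summable_rabs_cancel[OF summable_abs_level_term[OF d_le D_summable that]])
  have summable_\<theta>: "summable (level_term \<psi> \<theta> t)" if "t \<in> {0..1}" for t
    unfolding level_term_split by (intro summable_add summable_d summable_level_term_f0 that)
  have "\<bar>suminf (level_term \<psi> \<theta> t) - f0 t\<bar> \<le> (\<Sum>l. C * 2 powr (real l / 2) * D l)"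
    if "t \<in> {0..1}" "suminf (level_term \<psi> ?\<theta>\<^sub>0 t) = f0 t" for t
  proof -
    have "suminf (level_term \<psi> \<theta> t) - f0 t = suminf (level_term \<psi> d t)"
      unfolding level_term_split
        suminf_add[OF summable_d[OF that(1)] summable_level_term_f0[OF that(1)], symmetric] that(2)
      by simp
    then show ?thesis
      using abs_suminf_level_term_le[OF d_le D_summable that(1)] by simp
  qed
  then have "AE t in lborel. t \<in> {0..1} \<longrightarrow>
      ennreal \<bar>suminf (level_term \<psi> \<theta> t) - f0 t\<bar> \<le> ennreal (\<Sum>l. C * 2 powr (real l / 2) * D l)"
    using suminf_level_term_f0_AE_eq by (auto elim!: eventually_mono intro!: ennreal_leI)
  moreover have "(\<lambda>t. ennreal \<bar>suminf (level_term \<psi> \<theta> t) - f0 t\<bar>) \<in> borel_measurable lborel"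
  proof -
    have [measurable]: "f0 \<in> borel_measurable borel"
      using square_integrable_f0 by (simp add: square_integrable_01_def)
    have [measurable]: "(\<lambda>t. suminf (level_term \<psi> \<theta> t)) \<in> borel_measurable borel"
      by (rule borel_measurable_suminf[OF level_term_measurable])
    show ?thesis by measurable
  qed
  ultimately have "esssup (restrict_space lborel {0..1}) (\<lambda>t. ennreal \<bar>suminf (level_term \<psi> \<theta> t) - f0 t\<bar>)
      \<le> ennreal (\<Sum>l. C * 2 powr (real l / 2) * D l)"
    by (intro esssup_I measurable_restrict_space1) (auto simp: AE_restrict_space_iff)
  moreover have "AE t in restrict_space lborel {0..1}. summable (level_term \<psi> \<theta> t)"
    using summable_\<theta> by (intro AE_I2) (simp add: space_restrict_space)
  ultimately show ?thesis by (simp add: sup_dist_def)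
qed

lemma sup_dist_le_excess:
  assumes a_nonneg: "\<And>l. 0 \<le> a l"
  shows "sup_dist \<psi> f0 \<theta> \<le> (\<Sum>l. ennreal (C * 2 powr (real l / 2)) *
    (ennreal (a l) + (\<Sum>k<2 ^ l. excess (a l) (ip01 f0 (\<psi> l k)) (\<theta> (l, k)))))"
    (is "_ \<le> (\<Sum>l. ?R l)")
proof (cases "(\<Sum>l. ?R l) = \<top>")
  case False
  let ?x = "\<lambda>l k. max 0 (\<bar>\<theta> (l, k) - ip01 f0 (\<psi> l k)\<bar> - a l)"
  define D where "D l = a l + (\<Sum>k<2 ^ l. ?x l k)" for l
  have D_nonneg: "0 \<le> C * 2 powr (real l / 2) * D l" for l
    unfolding D_def using C_pos a_nonneg by (intro mult_nonneg_nonneg add_nonneg_nonneg sum_nonneg) auto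
  have summand_eq: "?R l = ennreal (C * 2 powr (real l / 2) * D l)" for l
  proof -
    have "(\<Sum>k<2 ^ l. excess (a l) (ip01 f0 (\<psi> l k)) (\<theta> (l, k))) = (\<Sum>k<2 ^ l. ennreal (?x l k))"
      by (intro sum.cong refl) (auto simp: excess_def max_def ennreal_neg)
    also have "\<dots> = ennreal (\<Sum>k<2 ^ l. ?x l k)"
      by (intro sum_ennreal) auto
    finally show ?thesis
      unfolding D_def using a_nonneg C_pos by (simp add: ennreal_mult sum_nonneg add_nonneg_nonneg)
  qed
  have D_summable: "summable (\<lambda>l. C * 2 powr (real l / 2) * D l)"
    using False D_nonneg unfolding summand_eq by (intro summable_suminf_not_top) auto
  have "sup_dist \<psi> f0 \<theta> \<le> ennreal (\<Sum>l. C * 2 powr (real l / 2) * D l)"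
  proof (rule sup_dist_le[OF _ D_summable])
    fix l k :: nat assume "k < 2 ^ l"
    then have "?x l k \<le> (\<Sum>k<2 ^ l. ?x l k)"
      by (intro member_le_sum) auto
    then show "\<bar>\<theta> (l, k) - ip01 f0 (\<psi> l k)\<bar> \<le> D l"
      by (simp add: D_def)
  qed
  also have "\<dots> = (\<Sum>l. ?R l)"
    unfolding summand_eq by (rule suminf_ennreal2[OF D_nonneg D_summable, symmetric])
  finally show ?thesis .
qed simp

end

end

section \<open>Priors with exponential power tails\<close>

lemma nn_integral_exp_neg_abs_finite:
  fixes r :: real
  assumes r_pos: "0 < r"
  shows "(\<integral>\<^sup>+u. ennreal (exp (- r * \<bar>u\<bar>)) \<partial>lborel) < \<infinity>"
proof -
  let ?e = "exponential_density r"
  have total: "(\<integral>\<^sup>+u. ennreal (?e u) \<partial>lborel) = 1"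
    using prob_space.emeasure_space_1[OF prob_space_exponential_density[OF r_pos]] by (simp add: emeasure_density)
  then have reflected: "(\<integral>\<^sup>+u. ennreal (?e (- u)) \<partial>lborel) = 1"
    using nn_integral_real_affine[of "\<lambda>u. ennreal (?e u)" "-1" 0] by simp
  have "exp (- r * \<bar>u\<bar>) \<le> 1 / r * (?e u + ?e (- u))" for u
    using r_pos by (auto simp: exponential_density_def field_simps)
  then have "(\<integral>\<^sup>+u. ennreal (exp (- r * \<bar>u\<bar>)) \<partial>lborel) \<le> (\<integral>\<^sup>+u. ennreal (1 / r * (?e u + ?e (- u))) \<partial>lborel)"
    by (intro nn_integral_mono ennreal_leI)
  also have "\<dots> = (\<integral>\<^sup>+u. ennreal (1 / r) * (ennreal (?e u) + ennreal (?e (- u))) \<partial>lborel)"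
    using r_pos by (intro nn_integral_cong, subst ennreal_mult) (auto simp: exponential_density_nonneg)
  also have "\<dots> < \<infinity>"
    by (simp add: nn_integral_cmult nn_integral_add total reflected ennreal_mult_less_top)
  finally show ?thesis .
qed

lemma one_plus_square_le_exp_powr:
  fixes u b q :: real
  assumes b_pos: "0 < b" and q_ge_1: "1 \<le> q"
  shows "1 + u\<^sup>2 \<le> (2 + 2 / b\<^sup>2) * exp (b * \<bar>u\<bar> powr q)"
proof (cases "\<bar>u\<bar> \<le> 1")
  case True
  then have "1 + u\<^sup>2 \<le> 2 * 1"
    by (simp add: abs_square_le_1)
  also have "\<dots> \<le> (2 + 2 / b\<^sup>2) * exp (b * \<bar>u\<bar> powr q)"
    using b_pos by (intro mult_mono) auto
  finally show ?thesis .
next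
  case False
  then have "\<bar>u\<bar> powr 1 \<le> \<bar>u\<bar> powr q"
    using q_ge_1 by (intro powr_mono) auto
  then have abs_u_le: "\<bar>u\<bar> \<le> \<bar>u\<bar> powr q" using False by simp
  have "0 \<le> b * \<bar>u\<bar>" using b_pos by simp
  then have "(b * \<bar>u\<bar>)\<^sup>2 / 2 \<le> exp (b * \<bar>u\<bar>)"
    using exp_lower_Taylor_quadratic[of "b * \<bar>u\<bar>"] by linarith
  also have "\<dots> \<le> exp (b * \<bar>u\<bar> powr q)"
    using abs_u_le b_pos by simp
  finally have "u\<^sup>2 \<le> 2 / b\<^sup>2 * exp (b * \<bar>u\<bar> powr q)"
    using b_pos by (simp add: power_mult_distrib field_simps)
  moreover have "1 \<le> exp (b * \<bar>u\<bar> powr q)"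
    using b_pos by simp
  ultimately show ?thesis unfolding distrib_right by linarith
qed

locale exp_power_density =
  fixes \<phi> :: "real \<Rightarrow> real" and b1 b2 c1 c2 \<delta> :: real
  assumes density_continuous: "continuous_on UNIV \<phi>"
    and density_nonneg: "\<And>x. \<phi> x \<ge> 0"
    and nn_integral_density_eq_1: "(\<integral>\<^sup>+ x. ennreal (\<phi> x) \<partial>lborel) = 1"
    and density_pos: "\<And>x. \<bar>x\<bar> \<le> 1 \<Longrightarrow> \<phi> x > 0"
    and consts_pos: "b1 > 0" "b2 > 0" "c1 > 0" "c2 > 0" "\<delta> > 0"
    and density_tails: "\<And>x. \<bar>x\<bar> \<ge> 1 \<Longrightarrow>
        c1 * exp (- b1 * \<bar>x\<bar> powr (1 + \<delta>)) \<le> \<phi> x \<and> \<phi> x \<le> c2 * exp (- b2 * \<bar>x\<bar> powr (1 + \<delta>))"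
begin

lemma density_measurable [measurable]: "\<phi> \<in> borel_measurable borel"
  using density_continuous by (rule borel_measurable_continuous_onI)

definition density_floor :: real where
  "density_floor = min c1 (INF u\<in>{-1..1}. \<phi> u)"

lemma density_floor_pos: "0 < density_floor"
proof -
  have "continuous_on {-1..1} \<phi>" using density_continuous by (rule continuous_on_subset) auto
  then obtain m where minimizer: "m \<in> {-1..1}" "\<And>u. u \<in> {-1..1} \<Longrightarrow> \<phi> m \<le> \<phi> u"
    using continuous_attains_inf[of "{-1..1::real}" \<phi>] by auto
  have "0 < \<phi> m" using density_pos[of m] minimizer(1) by (simp add: abs_le_iff)
  also have "\<phi> m \<le> (INF u\<in>{-1..1}. \<phi> u)"
    using minimizer(2) by (intro cINF_greatest) auto
  finally show ?thesis using consts_pos by (simp add: density_floor_def)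
qed

lemma density_ge: "density_floor * exp (- b1 * \<bar>u\<bar> powr (1 + \<delta>)) \<le> \<phi> u"
proof (cases "\<bar>u\<bar> \<le> 1")
  case True
  have "density_floor * exp (- b1 * \<bar>u\<bar> powr (1 + \<delta>)) \<le> density_floor * 1"
    using density_floor_pos consts_pos by (intro mult_left_mono) auto
  also have "\<dots> \<le> (INF u\<in>{-1..1}. \<phi> u)"
    by (simp add: density_floor_def)
  also have "\<dots> \<le> \<phi> u"
    using True density_nonneg by (intro cINF_lower bdd_belowI2[of _ 0]) (auto simp: abs_le_iff)
  finally show ?thesis .
next
  case False
  have "density_floor * exp (- b1 * \<bar>u\<bar> powr (1 + \<delta>)) \<le> c1 * exp (- b1 * \<bar>u\<bar> powr (1 + \<delta>))"
    by (intro mult_right_mono) (auto simp: density_floor_def)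
  also have "\<dots> \<le> \<phi> u" using density_tails[of u] False by auto
  finally show ?thesis .
qed

lemma nn_integral_exp_powr_finite:
  assumes b_range: "0 \<le> b" "b < b2"
  shows "(\<integral>\<^sup>+u. ennreal (exp (b * \<bar>u\<bar> powr (1 + \<delta>)) * \<phi> u) \<partial>lborel) < \<infinity>"
proof -
  have pointwise_le: "exp (b * \<bar>u\<bar> powr (1 + \<delta>)) * \<phi> u \<le> exp b * \<phi> u + c2 * exp (- (b2 - b) * \<bar>u\<bar>)" for u
  proof (cases "\<bar>u\<bar> \<le> 1")
    case True
    then have "\<bar>u\<bar> powr (1 + \<delta>) \<le> 1 powr (1 + \<delta>)"
      using consts_pos by (intro powr_mono2) auto
    then have "exp (b * \<bar>u\<bar> powr (1 + \<delta>)) * \<phi> u \<le> exp b * \<phi> u"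
      using b_range density_nonneg by (intro mult_right_mono) (auto simp: mult_left_le)
    then show ?thesis using consts_pos by (simp add: add_increasing2)
  next
    case False
    then have "\<bar>u\<bar> powr 1 \<le> \<bar>u\<bar> powr (1 + \<delta>)"
      using consts_pos by (intro powr_mono) auto
    then have exponent_le: "- (b2 - b) * \<bar>u\<bar> powr (1 + \<delta>) \<le> - (b2 - b) * \<bar>u\<bar>"
      using False b_range by (intro mult_left_mono_neg) auto
    have "exp (b * \<bar>u\<bar> powr (1 + \<delta>)) * \<phi> u
        \<le> exp (b * \<bar>u\<bar> powr (1 + \<delta>)) * (c2 * exp (- b2 * \<bar>u\<bar> powr (1 + \<delta>)))"
      using density_tails[of u] False by (intro mult_left_mono) auto
    also have "\<dots> = c2 * exp (- (b2 - b) * \<bar>u\<bar> powr (1 + \<delta>))"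
      by (simp add: exp_add[symmetric] algebra_simps)
    also have "\<dots> \<le> c2 * exp (- (b2 - b) * \<bar>u\<bar>)"
      using exponent_le consts_pos by (intro mult_left_mono) auto
    finally show ?thesis using density_nonneg[of u] by (simp add: add_increasing)
  qed
  have "(\<integral>\<^sup>+u. ennreal (exp (b * \<bar>u\<bar> powr (1 + \<delta>)) * \<phi> u) \<partial>lborel)
      \<le> (\<integral>\<^sup>+u. ennreal (exp b) * ennreal (\<phi> u) + ennreal c2 * ennreal (exp (- (b2 - b) * \<bar>u\<bar>)) \<partial>lborel)"
    using pointwise_le consts_pos density_nonneg
    by (intro nn_integral_mono)
      (auto simp: ennreal_mult[symmetric] ennreal_plus[symmetric] simp del: ennreal_plus intro!: ennreal_leI)
  also have "\<dots> = ennreal (exp b) * 1 + ennreal c2 * (\<integral>\<^sup>+u. ennreal (exp (- (b2 - b) * \<bar>u\<bar>)) \<partial>lborel)"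
    by (simp add: nn_integral_add nn_integral_cmult nn_integral_density_eq_1)
  also have "\<dots> < \<infinity>"
    using nn_integral_exp_neg_abs_finite[of "b2 - b"] b_range by (simp add: ennreal_mult_less_top)
  finally show ?thesis .
qed

definition exp_weight :: "real \<Rightarrow> real" where
  "exp_weight u = (1 + u\<^sup>2) * exp (b2 / 2 * \<bar>u\<bar> powr (1 + \<delta>))"

definition exp_moment :: real where
  "exp_moment = enn2real (\<integral>\<^sup>+u. ennreal (exp_weight u * \<phi> u) \<partial>lborel)"

lemma exp_moment_nonneg: "0 \<le> exp_moment"
  by (simp add: exp_moment_def)

lemma exp_weight_ge: "1 + u\<^sup>2 \<le> exp_weight u"
  unfolding exp_weight_def using consts_pos mult_left_mono[of 1 "exp (b2 / 2 * \<bar>u\<bar> powr (1 + \<delta>))" "1 + u\<^sup>2"]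
  by (simp add: add_nonneg_nonneg)

lemma exp_weight_measurable [measurable]: "exp_weight \<in> borel_measurable borel"
  unfolding exp_weight_def[abs_def] by measurable

lemma nn_integral_exp_moment: "(\<integral>\<^sup>+u. ennreal (exp_weight u * \<phi> u) \<partial>lborel) = ennreal exp_moment"
proof -
  let ?v = "\<lambda>u. \<bar>u\<bar> powr (1 + \<delta>)"
  define C where "C = 2 + 2 / (b2 / 4)\<^sup>2"
  have C_nonneg: "0 \<le> C" by (simp add: C_def add_nonneg_nonneg)
  have weight_le: "exp_weight u * \<phi> u \<le> C * (exp (3 * b2 / 4 * ?v u) * \<phi> u)" for u
  proof -
    have "exp_weight u \<le> C * exp (b2 / 4 * ?v u) * exp (b2 / 2 * ?v u)"
      unfolding exp_weight_def C_def using consts_pos by (intro mult_right_mono one_plus_square_le_exp_powr) auto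
    also have "\<dots> = C * exp (3 * b2 / 4 * ?v u)"
      by (simp add: mult.assoc exp_add[symmetric] field_simps)
    finally show ?thesis
      using mult_right_mono density_nonneg by (fastforce simp: mult.assoc[symmetric])
  qed
  have "(\<integral>\<^sup>+u. ennreal (exp_weight u * \<phi> u) \<partial>lborel)
      \<le> (\<integral>\<^sup>+u. ennreal C * ennreal (exp (3 * b2 / 4 * ?v u) * \<phi> u) \<partial>lborel)"
    using weight_le C_nonneg by (intro nn_integral_mono) (simp add: ennreal_mult'[symmetric] ennreal_leI)
  also have "\<dots> < \<infinity>"
    using nn_integral_exp_powr_finite[of "3 * b2 / 4"] consts_pos
    by (simp add: nn_integral_cmult ennreal_mult_less_top)
  finally show ?thesis by (simp add: exp_moment_def)
qed

definition scaled :: "real \<Rightarrow> real measure" where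
  "scaled \<sigma> = density lborel (\<lambda>x. ennreal (\<phi> (x / \<sigma>) / \<sigma>))"

lemma sets_scaled [measurable_cong, simp]: "sets (scaled \<sigma>) = sets borel"
  by (simp add: scaled_def)

lemma nn_integral_scaled:
  assumes \<sigma>_pos: "0 < \<sigma>" and [measurable]: "g \<in> borel_measurable borel"
  shows "(\<integral>\<^sup>+x. g x \<partial>scaled \<sigma>) = (\<integral>\<^sup>+u. g (\<sigma> * u) * ennreal (\<phi> u) \<partial>lborel)"
proof -
  have "(\<integral>\<^sup>+x. g x \<partial>scaled \<sigma>) = (\<integral>\<^sup>+x. g x * ennreal (\<phi> (x / \<sigma>) / \<sigma>) \<partial>lborel)"
    unfolding scaled_def by (subst nn_integral_density) (auto simp: mult.commute)
  also have "\<dots> = ennreal \<bar>\<sigma>\<bar> * (\<integral>\<^sup>+u. g (0 + \<sigma> * u) * ennreal (\<phi> ((0 + \<sigma> * u) / \<sigma>) / \<sigma>) \<partial>lborel)"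
    using \<sigma>_pos by (intro nn_integral_real_affine) auto
  also have "\<dots> = (\<integral>\<^sup>+u. g (\<sigma> * u) * (ennreal \<sigma> * ennreal (\<phi> u / \<sigma>)) \<partial>lborel)"
    using \<sigma>_pos by (simp add: nn_integral_cmult[symmetric] mult_ac)
  finally show ?thesis
    using \<sigma>_pos density_nonneg by (simp add: ennreal_mult[symmetric])
qed

lemma prob_space_scaled:
  assumes "0 < \<sigma>"
  shows "prob_space (scaled \<sigma>)"
proof
  have "emeasure (scaled \<sigma>) (space (scaled \<sigma>)) = (\<integral>\<^sup>+x. 1 \<partial>scaled \<sigma>)" by simp
  also have "\<dots> = 1"
    using assms by (subst nn_integral_scaled) (auto simp: nn_integral_density_eq_1)
  finally show "emeasure (scaled \<sigma>) (space (scaled \<sigma>)) = 1" .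
qed

lemma nn_integral_scaled_le_exp_moment:
  assumes \<sigma>_pos: "0 < \<sigma>" and [measurable]: "g \<in> borel_measurable borel" and c_nonneg: "0 \<le> c"
    and g_le: "\<And>u. g (\<sigma> * u) \<le> c * exp_weight u"
  shows "(\<integral>\<^sup>+x. ennreal (g x) \<partial>scaled \<sigma>) \<le> ennreal (c * exp_moment)"
proof -
  have "(\<integral>\<^sup>+x. ennreal (g x) \<partial>scaled \<sigma>) = (\<integral>\<^sup>+u. ennreal (g (\<sigma> * u) * \<phi> u) \<partial>lborel)"
    using \<sigma>_pos density_nonneg by (subst nn_integral_scaled) (auto simp: ennreal_mult'')
  also have "\<dots> \<le> (\<integral>\<^sup>+u. ennreal c * ennreal (exp_weight u * \<phi> u) \<partial>lborel)"
    using mult_right_mono[OF g_le density_nonneg] c_nonneg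
    by (intro nn_integral_mono) (simp add: ennreal_mult'[symmetric] mult.assoc ennreal_leI)
  also have "\<dots> = ennreal (c * exp_moment)"
    using c_nonneg exp_moment_nonneg by (simp add: nn_integral_cmult nn_integral_exp_moment ennreal_mult)
  finally show ?thesis .
qed

lemma scaled_second_moment_le:
  assumes "0 < \<sigma>"
  shows "(\<integral>\<^sup>+x. ennreal ((x - \<theta>\<^sub>0)\<^sup>2) \<partial>scaled \<sigma>) \<le> ennreal (2 * (\<sigma>\<^sup>2 + \<theta>\<^sub>0\<^sup>2) * exp_moment)"
proof (rule nn_integral_scaled_le_exp_moment[OF assms])
  fix u
  have "(\<sigma> * u - \<theta>\<^sub>0)\<^sup>2 \<le> 2 * (\<sigma> * u)\<^sup>2 + 2 * \<theta>\<^sub>0\<^sup>2"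
    using zero_le_power2[of "\<theta>\<^sub>0 + \<sigma> * u"] by (simp add: power2_eq_square algebra_simps)
  also have "\<dots> \<le> 2 * (\<sigma>\<^sup>2 + \<theta>\<^sub>0\<^sup>2) * (1 + u\<^sup>2)"
    by (simp add: power_mult_distrib algebra_simps)
  also have "\<dots> \<le> 2 * (\<sigma>\<^sup>2 + \<theta>\<^sub>0\<^sup>2) * exp_weight u"
    by (intro mult_left_mono exp_weight_ge) auto
  finally show "(\<sigma> * u - \<theta>\<^sub>0)\<^sup>2 \<le> 2 * (\<sigma>\<^sup>2 + \<theta>\<^sub>0\<^sup>2) * exp_weight u" .
qed auto

lemma scaled_excess_le:
  assumes \<sigma>_pos: "0 < \<sigma>" and R_nonneg: "0 \<le> R" and a_ge: "\<sigma> * R + \<bar>\<theta>\<^sub>0\<bar> \<le> a"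
  shows "(\<integral>\<^sup>+x. excess a \<theta>\<^sub>0 x \<partial>scaled \<sigma>)
    \<le> ennreal (\<sigma> * exp (- (b2 / 2 * R powr (1 + \<delta>))) * exp_moment)"
  unfolding excess_def
proof (rule nn_integral_scaled_le_exp_moment[OF \<sigma>_pos])
  fix u
  let ?W = "exp (- (b2 / 2 * R powr (1 + \<delta>))) * exp_weight u"
  have weight_nonneg: "0 \<le> ?W" by (simp add: exp_weight_def add_nonneg_nonneg)
  have excess_le: "\<bar>\<sigma> * u - \<theta>\<^sub>0\<bar> - a \<le> \<sigma> * (\<bar>u\<bar> - R)"
    using a_ge \<sigma>_pos abs_triangle_ineq4[of "\<sigma> * u" \<theta>\<^sub>0] by (simp add: abs_mult right_diff_distrib)
  have "\<bar>u\<bar> - R \<le> ?W"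
  proof (cases "\<bar>u\<bar> \<le> R")
    case False
    then have "b2 / 2 * R powr (1 + \<delta>) \<le> b2 / 2 * \<bar>u\<bar> powr (1 + \<delta>)"
      using R_nonneg consts_pos by (intro mult_left_mono powr_mono2) auto
    then have "1 \<le> exp (- (b2 / 2 * R powr (1 + \<delta>))) * exp (b2 / 2 * \<bar>u\<bar> powr (1 + \<delta>))"
      by (simp add: exp_add[symmetric])
    moreover have "\<bar>u\<bar> \<le> 1 + u\<^sup>2"
      using sum_squares_bound[of 1 "\<bar>u\<bar>"] by simp
    ultimately have "\<bar>u\<bar> * 1 \<le> (1 + u\<^sup>2) * (exp (- (b2 / 2 * R powr (1 + \<delta>))) * exp (b2 / 2 * \<bar>u\<bar> powr (1 + \<delta>)))"
      by (intro mult_mono) auto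
    then show ?thesis using R_nonneg by (simp add: exp_weight_def mult_ac)
  qed (use weight_nonneg in linarith)
  then have "\<sigma> * (\<bar>u\<bar> - R) \<le> \<sigma> * ?W"
    using \<sigma>_pos by (intro mult_left_mono) auto
  then show "\<bar>\<sigma> * u - \<theta>\<^sub>0\<bar> - a \<le> \<sigma> * exp (- (b2 / 2 * R powr (1 + \<delta>))) * exp_weight u"
    using excess_le by (simp add: mult.assoc)
qed (use \<sigma>_pos in auto)

end

section \<open>Levels and rates\<close>

definition level_scale :: "real \<Rightarrow> nat \<Rightarrow> real" where
  "level_scale \<alpha> l = 2 powr (- real l * (1 / 2 + \<alpha>))"

lemma level_scale_pos: "0 < level_scale \<alpha> l"
  by (simp add: level_scale_def)

lemma level_scale_le_1: "0 < \<alpha> \<Longrightarrow> level_scale \<alpha> l \<le> 1"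
  using powr_mono[of "- real l * (1 / 2 + \<alpha>)" 0 2] by (simp add: level_scale_def)

lemma powr_half_mult_level_scale: "2 powr (real l / 2) * level_scale \<alpha> l = (2 powr - \<alpha>) ^ l"
proof -
  have "2 powr (real l / 2) * level_scale \<alpha> l = 2 powr (real l / 2 + - real l * (1 / 2 + \<alpha>))"
    by (simp only: level_scale_def powr_add)
  also have "real l / 2 + - real l * (1 / 2 + \<alpha>) = (- \<alpha>) * real l"
    by (simp add: algebra_simps)
  also have "2 powr \<dots> = (2 powr - \<alpha>) ^ l"
    by (subst powr_powr[symmetric], subst powr_realpow) auto
  finally show ?thesis .
qed

lemma two_power_mult_level_scale_square: "2 ^ l * (level_scale \<alpha> l)\<^sup>2 = ((2 powr - \<alpha>)\<^sup>2) ^ l"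
proof -
  have "(2 powr (real l / 2))\<^sup>2 = (2::real) ^ l"
    by (simp add: power2_eq_square powr_add[symmetric] powr_realpow)
  then have "2 ^ l * (level_scale \<alpha> l)\<^sup>2 = (2 powr (real l / 2) * level_scale \<alpha> l)\<^sup>2"
    by (simp add: power_mult_distrib)
  then show ?thesis
    unfolding powr_half_mult_level_scale by (simp add: power_mult[symmetric] mult.commute)
qed

lemma two_powr_minus_less_1: "0 < \<alpha> \<Longrightarrow> 2 powr - \<alpha> < (1::real)"
  using powr_less_mono[of "- \<alpha>" 0 2] by simp

lemma ex_power_two_le_iff:
  assumes "1 \<le> (y::real)"
  obtains N where "\<And>l. 2 ^ l \<le> y \<longleftrightarrow> l \<le> N"
proof
  fix l :: nat
  have "2 ^ l \<le> y \<longleftrightarrow> real l \<le> log 2 y"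
    using assms by (simp add: le_log_iff powr_realpow)
  also have "\<dots> \<longleftrightarrow> l \<le> nat \<lfloor>log 2 y\<rfloor>"
    using assms by (simp add: le_nat_floor zero_le_log_cancel_iff le_nat_iff le_floor_iff)
  finally show "2 ^ l \<le> y \<longleftrightarrow> l \<le> nat \<lfloor>log 2 y\<rfloor>" .
qed

lemma sum_two_powr_le:
  fixes \<beta> y :: real
  assumes \<beta>_pos: "0 < \<beta>" and N_le: "2 ^ N \<le> y"
  shows "(\<Sum>l<Suc N. 2 powr (\<beta> * real l)) \<le> y powr \<beta> / (1 - 2 powr - \<beta>)"
proof -
  define q where "q = (2::real) powr \<beta>"
  have q_gt_1: "1 < q" using \<beta>_pos powr_less_mono[of 0 \<beta> 2] by (simp add: q_def)
  have q_power: "2 powr (\<beta> * real l) = q ^ l" for l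
    unfolding q_def by (subst powr_powr[symmetric], subst powr_realpow) auto
  have "(\<Sum>l<Suc N. q ^ l) = (q ^ Suc N - 1) / (q - 1)"
    using q_gt_1 by (intro geometric_sum) simp
  also have "\<dots> \<le> q ^ Suc N / (q - 1)"
    using q_gt_1 by (intro divide_right_mono) auto
  also have "\<dots> = q ^ N / (1 - 1 / q)"
    using q_gt_1 by (simp add: field_simps)
  also have "q ^ N = (2 ^ N) powr \<beta>"
    unfolding q_power[symmetric] by (simp add: powr_realpow[symmetric] powr_powr mult.commute)
  also have "\<dots> / (1 - 1 / q) \<le> y powr \<beta> / (1 - 1 / q)"
    using q_gt_1 \<beta>_pos N_le by (intro divide_right_mono powr_mono2) auto
  also have "1 / q = 2 powr - \<beta>"
    by (simp add: q_def powr_minus_divide)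
  finally show ?thesis by (simp only: q_power)
qed

lemma suminf_two_powr_tail_le:
  fixes \<alpha> y :: real
  assumes \<alpha>_pos: "0 < \<alpha>" and y_range: "0 < y" "y \<le> 2 ^ N"
  shows "(\<Sum>l. (2 powr - \<alpha>) ^ (l + N)) \<le> y powr - \<alpha> / (1 - 2 powr - \<alpha>)"
proof -
  let ?r = "2 powr - \<alpha>"
  have "(\<Sum>l. ?r ^ (l + N)) = ?r ^ N * (1 / (1 - ?r))"
    using two_powr_minus_less_1[OF \<alpha>_pos]
    by (simp add: power_add mult.commute[of _ "?r ^ N"] suminf_mult suminf_geometric)
  also have "?r ^ N = (2 ^ N) powr - \<alpha>"
    by (simp add: powr_realpow[symmetric] powr_powr mult.commute)
  also have "\<dots> * (1 / (1 - ?r)) \<le> y powr - \<alpha> * (1 / (1 - ?r))"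
    using two_powr_minus_less_1[OF \<alpha>_pos] \<alpha>_pos y_range by (intro mult_right_mono powr_mono2') auto
  finally show ?thesis by simp
qed

definition rate_const :: "real \<Rightarrow> real" where
  "rate_const \<alpha> = 1 / (1 - 2 powr - (1 / 2)) + 1 / (1 - 2 powr - \<alpha>)"

lemma rate_const_pos: "0 < \<alpha> \<Longrightarrow> 0 < rate_const \<alpha>"
  using two_powr_minus_less_1[of \<alpha>] two_powr_minus_less_1[of "1 / 2"] by (simp add: rate_const_def add_pos_pos)

lemma suminf_levels_le:
  assumes \<alpha>_pos: "0 < \<alpha>" and y_ge_1: "1 \<le> y"
  shows "(\<Sum>l. ennreal (2 powr (real l / 2) * (if 2 ^ l \<le> y then y powr (- (\<alpha> + 1 / 2)) else level_scale \<alpha> l)))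
    \<le> ennreal (rate_const \<alpha> * y powr - \<alpha>)"
proof -
  obtain N where N_iff: "\<And>l. 2 ^ l \<le> y \<longleftrightarrow> l \<le> N"
    using ex_power_two_le_iff[OF y_ge_1] by blast
  let ?f = "\<lambda>l. 2 powr (real l / 2) * (if 2 ^ l \<le> y then y powr (- (\<alpha> + 1 / 2)) else level_scale \<alpha> l)"
  have high_level_term: "?f (l + Suc N) = (2 powr - \<alpha>) ^ (l + Suc N)" for l
    unfolding N_iff powr_half_mult_level_scale[symmetric] by simp
  have "summable (\<lambda>l. (2 powr - \<alpha>) ^ (l + Suc N))"
    using two_powr_minus_less_1[OF \<alpha>_pos] by (intro summable_ignore_initial_segment summable_geometric) simp
  then have summable: "summable ?f"
    unfolding high_level_term[symmetric] by (rule iffD1[OF summable_iff_shift])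
  have "(\<Sum>l. ?f l) = (\<Sum>l. ?f (l + Suc N)) + (\<Sum>l<Suc N. ?f l)"
    by (rule suminf_split_initial_segment[OF summable])
  also have "(\<Sum>l. ?f (l + Suc N)) \<le> y powr - \<alpha> / (1 - 2 powr - \<alpha>)"
    unfolding high_level_term using y_ge_1 N_iff[of "Suc N"] by (intro suminf_two_powr_tail_le \<alpha>_pos) auto
  also have "(\<Sum>l<Suc N. ?f l) = (\<Sum>l<Suc N. 2 powr (1 / 2 * real l)) * y powr (- (\<alpha> + 1 / 2))"
    unfolding sum_distrib_right by (intro sum.cong) (auto simp: N_iff)
  also have "\<dots> \<le> y powr (1 / 2) / (1 - 2 powr - (1 / 2)) * y powr (- (\<alpha> + 1 / 2))"
    using N_iff[of N] by (intro mult_right_mono sum_two_powr_le) auto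
  also have "\<dots> = y powr - \<alpha> / (1 - 2 powr - (1 / 2))"
    using y_ge_1 by (simp add: powr_add[symmetric])
  finally have "(\<Sum>l. ?f l) \<le> rate_const \<alpha> * y powr - \<alpha>"
    by (simp add: rate_const_def distrib_right)
  moreover have "0 \<le> ?f l" for l
    by (simp add: level_scale_pos less_imp_le)
  ultimately show ?thesis
    by (subst suminf_ennreal2[OF _ summable]) (auto intro: ennreal_leI)
qed

lemma ln_ge_half:
  assumes "2 \<le> n"
  shows "1 / 2 \<le> ln (real n)"
proof -
  have "1 / 2 \<le> ln (2::real)" using ln_le_minus_one[of "1 / 2::real"] by (simp add: ln_div)
  also have "\<dots> \<le> ln (real n)" using assms by simp
  finally show ?thesis .
qed

lemma ln_le_sqrt:
  assumes "0 < x"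
  shows "ln x \<le> sqrt x"
proof -
  define t where "t = sqrt (sqrt x)"
  have t_root: "0 < t" "sqrt x = t\<^sup>2"
    using assms by (simp_all add: t_def)
  have "x = (sqrt x)\<^sup>2" using assms by simp
  also have "\<dots> = t ^ 4" unfolding t_root by simp
  finally have "x = t ^ 4" .
  then have "ln x = 4 * ln t" using t_root by (simp add: ln_realpow)
  also have "\<dots> \<le> 4 * (t - 1)" using ln_le_minus_one[OF t_root(1)] by simp
  also have "\<dots> \<le> t\<^sup>2" using zero_le_power2[of "t - 2"] by (simp add: power2_eq_square algebra_simps)
  finally show ?thesis using t_root by simp
qed

lemma two_power_le_exp: "(2::real) ^ l \<le> exp (real l)"
proof -
  have "(2::real) ^ l \<le> exp 1 ^ l" using exp_ge_add_one_self[of 1] by (intro power_mono) auto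
  then show ?thesis by (simp add: exp_of_nat_mult[symmetric])
qed

definition resolution :: "real \<Rightarrow> nat \<Rightarrow> real" where
  "resolution \<alpha> n = (real n / ln (real n)) powr (1 / (2 * \<alpha> + 1))"

definition level_rate :: "real \<Rightarrow> nat \<Rightarrow> nat \<Rightarrow> real" where
  "level_rate \<alpha> n l = (if 2 ^ l \<le> resolution \<alpha> n then sqrt (ln (real n) / real n) else level_scale \<alpha> l)"

context
  fixes \<alpha> :: real and n :: nat
  assumes \<alpha>_pos: "0 < \<alpha>" and n_ge_2: "2 \<le> n"
begin

lemma level_rate_nonneg: "0 \<le> level_rate \<alpha> n l"
  using ln_ge_half[OF n_ge_2] level_scale_pos[of \<alpha> l] by (simp add: level_rate_def)

lemma resolution_ge_1: "1 \<le> resolution \<alpha> n"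
proof -
  have "ln (real n) \<le> real n - 1" using n_ge_2 by (intro ln_le_minus_one) auto
  then have "1 \<le> real n / ln (real n)" using ln_ge_half[OF n_ge_2] by (simp add: le_divide_eq)
  then show ?thesis unfolding resolution_def using \<alpha>_pos by (intro ge_one_powr_ge_zero) auto
qed

lemma resolution_powr:
  "resolution \<alpha> n powr - \<alpha> = (ln (real n) / real n) powr (\<alpha> / (2 * \<alpha> + 1))"
  "resolution \<alpha> n powr (- (\<alpha> + 1 / 2)) = sqrt (ln (real n) / real n)"
  "resolution \<alpha> n powr (2 * \<alpha> + 1) = real n / ln (real n)"
proof -
  have ratio_pos: "0 < real n / ln (real n)" using ln_ge_half[OF n_ge_2] n_ge_2 by simp
  have powr_inverse: "(real n / ln (real n)) powr (- x) = (ln (real n) / real n) powr x" for x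
  proof -
    have "ln (real n) / real n = inverse (real n / ln (real n))" by simp
    then show ?thesis using ratio_pos by (simp only: powr_minus inverse_powr)
  qed
  have "1 / (2 * \<alpha> + 1) * - \<alpha> = - (\<alpha> / (2 * \<alpha> + 1))" by simp
  then show "resolution \<alpha> n powr - \<alpha> = (ln (real n) / real n) powr (\<alpha> / (2 * \<alpha> + 1))"
    by (simp only: resolution_def powr_powr powr_inverse)
  have "1 / (2 * \<alpha> + 1) * - (\<alpha> + 1 / 2) = - (1 / 2)" using \<alpha>_pos by (simp add: field_simps)
  then have "resolution \<alpha> n powr (- (\<alpha> + 1 / 2)) = (ln (real n) / real n) powr (1 / 2)"
    by (simp only: resolution_def powr_powr powr_inverse)
  then show "resolution \<alpha> n powr (- (\<alpha> + 1 / 2)) = sqrt (ln (real n) / real n)"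
    using ln_ge_half[OF n_ge_2] by (simp add: powr_half_sqrt)
  show "resolution \<alpha> n powr (2 * \<alpha> + 1) = real n / ln (real n)"
    unfolding resolution_def powr_powr using \<alpha>_pos ratio_pos ln_ge_half[OF n_ge_2] by simp
qed

lemma suminf_level_rate_le:
  "(\<Sum>l. ennreal (2 powr (real l / 2) * level_rate \<alpha> n l))
    \<le> ennreal (rate_const \<alpha> * (ln (real n) / real n) powr (\<alpha> / (2 * \<alpha> + 1)))"
  using suminf_levels_le[OF \<alpha>_pos resolution_ge_1] unfolding level_rate_def resolution_powr .

lemma low_level_power_le:
  assumes "2 ^ l \<le> resolution \<alpha> n"
  shows "2 ^ l \<le> (real n)\<^sup>2"
proof -
  have "(2::real) ^ l \<le> resolution \<alpha> n powr 1" using assms resolution_ge_1 by simp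
  also have "\<dots> \<le> resolution \<alpha> n powr (2 * \<alpha> + 1)"
    using \<alpha>_pos resolution_ge_1 by (intro powr_mono) auto
  also have "\<dots> = real n / ln (real n)" by (simp add: resolution_powr)
  also have "\<dots> \<le> real n / (1 / 2)" using ln_ge_half[OF n_ge_2] n_ge_2 by (intro divide_left_mono) auto
  also have "\<dots> \<le> (real n)\<^sup>2" using n_ge_2 by (simp add: power2_eq_square)
  finally show ?thesis .
qed

lemma low_level_le:
  assumes "2 ^ l \<le> resolution \<alpha> n"
  shows "real (l + 1) \<le> 6 * ln (real n)"
proof -
  have "ln ((2::real) ^ l) \<le> ln ((real n)\<^sup>2)"
    using low_level_power_le[OF assms] n_ge_2 by simp
  then have "real l * ln 2 \<le> 2 * ln (real n)" using n_ge_2 by (simp add: ln_realpow)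
  moreover have "real l * (1 / 2) \<le> real l * ln 2"
    using ln_ge_half[of 2] by (intro mult_left_mono) auto
  ultimately show ?thesis using ln_ge_half[OF n_ge_2] by simp
qed

lemma low_level_rate_ge:
  assumes "2 ^ l \<le> resolution \<alpha> n"
  shows "real n powr - 3 \<le> level_rate \<alpha> n l / 2 ^ l"
proof -
  have "1 / real n \<le> ln (real n)"
    using n_ge_2 by (intro order_trans[OF _ ln_ge_half[OF n_ge_2]]) (simp add: divide_le_eq)
  from divide_right_mono[OF this, of "real n"] have "(1 / real n)\<^sup>2 \<le> ln (real n) / real n"
    by (simp add: power2_eq_square)
  then have "1 / real n \<le> sqrt (ln (real n) / real n)"
    by (rule real_le_rsqrt)
  moreover have "1 / (real n)\<^sup>2 \<le> 1 / 2 ^ l"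
    using low_level_power_le[OF assms] n_ge_2 by (intro divide_left_mono) auto
  ultimately have "1 / real n * (1 / (real n)\<^sup>2) \<le> sqrt (ln (real n) / real n) * (1 / 2 ^ l)"
    using ln_ge_half[OF n_ge_2] by (intro mult_mono) auto
  also have "1 / real n * (1 / (real n)\<^sup>2) = real n powr - 3"
    using n_ge_2 by (simp add: powr_minus_divide powr_numeral power_numeral_reduce)
  finally show ?thesis using assms by (simp add: level_rate_def)
qed

lemma high_level_sqrt_le:
  assumes "\<not> 2 ^ l \<le> resolution \<alpha> n"
  shows "sqrt (real n) \<le> exp ((1 + 2 * \<alpha>) * real (l + 1))"
proof -
  have ln_pos: "0 < real n" "0 < ln (real n)" using ln_ge_half[OF n_ge_2] n_ge_2 by auto
  have "sqrt (real n) * ln (real n) \<le> sqrt (real n) * sqrt (real n)"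
    using ln_pos by (intro mult_left_mono ln_le_sqrt) auto
  then have "sqrt (real n) \<le> real n / ln (real n)" using ln_pos by (simp add: le_divide_eq)
  also have "\<dots> = resolution \<alpha> n powr (2 * \<alpha> + 1)" by (simp add: resolution_powr)
  also have "\<dots> \<le> exp (real l) powr (2 * \<alpha> + 1)"
    using assms \<alpha>_pos resolution_ge_1 two_power_le_exp[of l] by (intro powr_mono2) auto
  also have "\<dots> = exp ((1 + 2 * \<alpha>) * real l)" by (simp add: powr_def algebra_simps)
  also have "\<dots> \<le> exp ((1 + 2 * \<alpha>) * real (l + 1))" using \<alpha>_pos by (simp add: mult_left_mono)
  finally show ?thesis .
qed

end

lemma nn_integral_count_space_wav_index:
  "(\<integral>\<^sup>+i. f i \<partial>count_space wav_index) = (\<Sum>l. \<Sum>k<2 ^ l. f (l, k))"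
proof -
  have inner_integral: "(\<integral>\<^sup>+k. f (l, k) * indicator wav_index (l, k) \<partial>count_space UNIV) = (\<Sum>k<2 ^ l. f (l, k))" for l
    by (subst nn_integral_count_space'[of "{..<2 ^ l}"]) (auto simp: wav_index_def)
  have "(\<integral>\<^sup>+i. f i \<partial>count_space wav_index) = (\<integral>\<^sup>+i. f i * indicator wav_index i \<partial>count_space UNIV)"
    by (rule nn_integral_count_space_indicator) simp
  also have "\<dots> = (\<integral>\<^sup>+l. \<integral>\<^sup>+k. f (l, k) * indicator wav_index (l, k) \<partial>count_space UNIV \<partial>count_space UNIV)"
    by (rule nn_integral_fst_count_space[symmetric])
  finally show ?thesis
    by (simp only: inner_integral nn_integral_count_space_nat)
qed

section \<open>Posterior contraction\<close>

locale besov_model = exp_power_density +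
  fixes \<alpha> B :: real and \<theta>\<^sub>0 :: "nat \<times> nat \<Rightarrow> real"
  assumes \<alpha>_pos: "0 < \<alpha>"
    and coeff_le: "\<And>l k. k < 2 ^ l \<Longrightarrow> \<bar>\<theta>\<^sub>0 (l, k)\<bar> \<le> B * level_scale \<alpha> l"
begin

lemma B_nonneg: "0 \<le> B"
  using order_trans[OF abs_ge_zero coeff_le[of 0 0]] by (simp add: level_scale_def)

definition \<sigma> :: "nat \<Rightarrow> real" where
  "\<sigma> l = level_scale \<alpha> l / real (l + 1) powr (1 / (1 + \<delta>))"

definition coord_prior :: "nat \<times> nat \<Rightarrow> real measure" where
  "coord_prior = (\<lambda>(l, k). scaled (\<sigma> l))"

lemma wav_prior_eq: "wav_prior \<phi> \<sigma> = PiM wav_index coord_prior"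
  unfolding wav_prior_def coord_prior_def scaled_def ..

lemma \<sigma>_pos: "0 < \<sigma> l"
  by (simp add: \<sigma>_def level_scale_pos)

lemma \<sigma>_mult: "\<sigma> l * real (l + 1) powr (1 / (1 + \<delta>)) = level_scale \<alpha> l"
  by (simp add: \<sigma>_def)

lemma \<sigma>_le: "\<sigma> l \<le> level_scale \<alpha> l"
proof -
  have "\<sigma> l * 1 \<le> \<sigma> l * real (l + 1) powr (1 / (1 + \<delta>))"
    using consts_pos \<sigma>_pos[of l] by (intro mult_left_mono ge_one_powr_ge_zero) auto
  then show ?thesis by (simp only: \<sigma>_mult mult_1_right)
qed

lemma \<sigma>_le_1: "\<sigma> l \<le> 1"
  using order_trans[OF \<sigma>_le level_scale_le_1[OF \<alpha>_pos]] .

definition moment_const :: real where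
  "moment_const = 2 * (1 + B\<^sup>2) * exp_moment"

lemma moment_const_nonneg: "0 \<le> moment_const"
  using exp_moment_nonneg by (simp add: moment_const_def)

lemma second_moment_le:
  assumes "k < 2 ^ l"
  shows "(\<integral>\<^sup>+\<theta>. ennreal ((\<theta> - \<theta>\<^sub>0 (l, k))\<^sup>2) \<partial>coord_prior (l, k)) \<le> ennreal (moment_const * (level_scale \<alpha> l)\<^sup>2)"
proof -
  have "(\<sigma> l)\<^sup>2 \<le> (level_scale \<alpha> l)\<^sup>2"
    using \<sigma>_le \<sigma>_pos[of l] by (intro power_mono) auto
  moreover have "\<bar>\<theta>\<^sub>0 (l, k)\<bar>\<^sup>2 \<le> (B * level_scale \<alpha> l)\<^sup>2"
    using coeff_le[OF assms] by (intro power_mono) auto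
  ultimately have "(\<sigma> l)\<^sup>2 + (\<theta>\<^sub>0 (l, k))\<^sup>2 \<le> (1 + B\<^sup>2) * (level_scale \<alpha> l)\<^sup>2"
    by (simp add: power_mult_distrib distrib_right)
  then have "2 * ((\<sigma> l)\<^sup>2 + (\<theta>\<^sub>0 (l, k))\<^sup>2) * exp_moment \<le> 2 * ((1 + B\<^sup>2) * (level_scale \<alpha> l)\<^sup>2) * exp_moment"
    using exp_moment_nonneg by (intro mult_right_mono mult_left_mono) auto
  also have "\<dots> = moment_const * (level_scale \<alpha> l)\<^sup>2"
    by (simp add: moment_const_def)
  finally show ?thesis
    unfolding coord_prior_def prod.case
    by (rule order_trans[OF scaled_second_moment_le[OF \<sigma>_pos] ennreal_leI])
qed

lemma sum_second_moments_finite: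
  "(\<integral>\<^sup>+i. \<integral>\<^sup>+\<theta>. ennreal ((\<theta> - \<theta>\<^sub>0 i)\<^sup>2) \<partial>coord_prior i \<partial>count_space wav_index) < \<top>"
proof -
  let ?r = "(2 powr - \<alpha>)\<^sup>2"
  have ratio_less_1: "?r < 1"
    using two_powr_minus_less_1[OF \<alpha>_pos] by (simp add: power_less_one_iff)
  have level_le: "(\<Sum>k<2 ^ l. \<integral>\<^sup>+\<theta>. ennreal ((\<theta> - \<theta>\<^sub>0 (l, k))\<^sup>2) \<partial>coord_prior (l, k))
      \<le> ennreal (moment_const * ?r ^ l)" for l
  proof -
    have "(\<Sum>k<2 ^ l. \<integral>\<^sup>+\<theta>. ennreal ((\<theta> - \<theta>\<^sub>0 (l, k))\<^sup>2) \<partial>coord_prior (l, k))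
        \<le> (\<Sum>k<(2::nat) ^ l. ennreal (moment_const * (level_scale \<alpha> l)\<^sup>2))"
      using second_moment_le by (intro sum_mono) auto
    also have "\<dots> = ennreal (moment_const * (2 ^ l * (level_scale \<alpha> l)\<^sup>2))"
      using moment_const_nonneg by (subst sum_ennreal) (auto simp: mult_ac)
    finally show ?thesis by (simp only: two_power_mult_level_scale_square)
  qed
  have "(\<integral>\<^sup>+i. \<integral>\<^sup>+\<theta>. ennreal ((\<theta> - \<theta>\<^sub>0 i)\<^sup>2) \<partial>coord_prior i \<partial>count_space wav_index)
      \<le> (\<Sum>l. ennreal (moment_const * ?r ^ l))"
    unfolding nn_integral_count_space_wav_index by (intro suminf_le level_le summableI)
  also have "\<dots> = ennreal (\<Sum>l. moment_const * ?r ^ l)"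
    using ratio_less_1 moment_const_nonneg by (intro suminf_ennreal2 summable_mult summable_geometric) auto
  finally show ?thesis by (rule le_less_trans) simp
qed

definition evidence_exponent :: real where
  "evidence_exponent = b1 * (B + 1) powr (1 + \<delta>)"

lemma evidence_exponent_nonneg: "0 \<le> evidence_exponent"
  using consts_pos by (simp add: evidence_exponent_def)

lemma prior_density_ge:
  assumes k_less: "k < 2 ^ l" and near: "\<bar>\<theta> - \<theta>\<^sub>0 (l, k)\<bar> \<le> \<sigma> l"
  shows "density_floor * exp (- evidence_exponent * real (l + 1)) \<le> \<phi> (\<theta> / \<sigma> l)"
proof -
  have "\<bar>\<theta>\<bar> \<le> level_scale \<alpha> l + B * level_scale \<alpha> l"
    using near coeff_le[OF k_less] \<sigma>_le[of l] by linarith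
  also have "\<dots> = \<sigma> l * ((B + 1) * real (l + 1) powr (1 / (1 + \<delta>)))"
    unfolding \<sigma>_mult[symmetric] by (simp add: algebra_simps)
  finally have "\<bar>\<theta> / \<sigma> l\<bar> \<le> (B + 1) * real (l + 1) powr (1 / (1 + \<delta>))"
    using \<sigma>_pos[of l] by (simp add: divide_le_eq mult.commute)
  then have "\<bar>\<theta> / \<sigma> l\<bar> powr (1 + \<delta>) \<le> ((B + 1) * real (l + 1) powr (1 / (1 + \<delta>))) powr (1 + \<delta>)"
    using consts_pos by (intro powr_mono2) auto
  also have "\<dots> = (B + 1) powr (1 + \<delta>) * real (l + 1)"
    using B_nonneg consts_pos by (simp add: powr_mult powr_powr)
  finally have "b1 * \<bar>\<theta> / \<sigma> l\<bar> powr (1 + \<delta>) \<le> evidence_exponent * real (l + 1)"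
    using consts_pos unfolding evidence_exponent_def mult.assoc by (intro mult_left_mono) auto
  then have "density_floor * exp (- evidence_exponent * real (l + 1))
      \<le> density_floor * exp (- b1 * \<bar>\<theta> / \<sigma> l\<bar> powr (1 + \<delta>))"
    using density_floor_pos by (intro mult_left_mono) auto
  also have "\<dots> \<le> \<phi> (\<theta> / \<sigma> l)" by (rule density_ge)
  finally show ?thesis .
qed

definition evidence_floor :: "nat \<Rightarrow> nat \<Rightarrow> real" where
  "evidence_floor n l = density_floor / 2 * exp (- evidence_exponent * real (l + 1)) / sqrt (real n)"

lemma evidence_floor_pos: "2 \<le> n \<Longrightarrow> 0 < evidence_floor n l"
  using density_floor_pos by (simp add: evidence_floor_def)

lemma evidence_ge:
  assumes n_ge_2: "2 \<le> n" and k_less: "k < 2 ^ l"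
  defines "s \<equiv> 1 / sqrt (real n)"
  shows "ennreal (evidence_floor n l * normal_density (\<theta>\<^sub>0 (l, k)) s y)
    \<le> evidence (\<lambda>\<theta>. normal_density \<theta> s) (coord_prior (l, k)) y"
proof -
  let ?q = "density_floor * exp (- evidence_exponent * real (l + 1)) / \<sigma> l"
  have s_range: "0 < s" "s \<le> 1" using n_ge_2 by (simp_all add: s_def)
  have q_le: "?q \<le> \<phi> (\<theta> / \<sigma> l) / \<sigma> l" if "\<bar>\<theta> - \<theta>\<^sub>0 (l, k)\<bar> \<le> \<sigma> l * s" for \<theta>
    using order_trans[OF that, of "\<sigma> l"] s_range \<sigma>_pos[of l] k_less
    by (intro divide_right_mono prior_density_ge) (auto simp: mult_left_le)
  have "ennreal (?q * (\<sigma> l * s) / 2 * normal_density (\<theta>\<^sub>0 (l, k)) s y)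
      \<le> evidence (\<lambda>\<theta>. normal_density \<theta> s) (density lborel (\<lambda>\<theta>. ennreal (\<phi> (\<theta> / \<sigma> l) / \<sigma> l))) y"
    using s_range \<sigma>_pos[of l] \<sigma>_le_1[of l] density_floor_pos
    by (intro evidence_normal_density_ge q_le) (auto simp: mult_le_cancel_right1)
  also have "?q * (\<sigma> l * s) / 2 = evidence_floor n l"
    using \<sigma>_pos[of l] by (simp add: evidence_floor_def s_def)
  finally show ?thesis
    by (simp add: coord_prior_def scaled_def)
qed

lemma inverse_evidence_floor:
  "1 / evidence_floor n l = 2 / density_floor * (exp (evidence_exponent * real (l + 1)) * sqrt (real n))"
  by (simp add: evidence_floor_def exp_minus divide_simps)

lemma inverse_evidence_floor_low_level_le:
  assumes "2 \<le> n" "2 ^ l \<le> resolution \<alpha> n"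
  shows "1 / evidence_floor n l \<le> 2 / density_floor * real n powr (6 * evidence_exponent + 1)"
proof -
  have "exp (evidence_exponent * real (l + 1)) \<le> exp (evidence_exponent * (6 * ln (real n)))"
    using low_level_le[OF \<alpha>_pos assms] evidence_exponent_nonneg by (simp add: mult_left_mono)
  also have "\<dots> = real n powr (6 * evidence_exponent)"
    using assms by (simp add: powr_def mult_ac)
  finally have "exp (evidence_exponent * real (l + 1)) * sqrt (real n)
      \<le> real n powr (6 * evidence_exponent) * real n"
    using assms by (intro mult_mono real_le_lsqrt) (auto simp: power2_eq_square)
  then have "2 / density_floor * (exp (evidence_exponent * real (l + 1)) * sqrt (real n))
      \<le> 2 / density_floor * (real n powr (6 * evidence_exponent) * real n)"
    using density_floor_pos by (intro mult_left_mono) auto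
  then show ?thesis
    using assms by (simp add: inverse_evidence_floor powr_add)
qed

lemma inverse_evidence_floor_high_level_le:
  assumes "2 \<le> n" "\<not> 2 ^ l \<le> resolution \<alpha> n"
  shows "1 / evidence_floor n l \<le> 2 / density_floor * exp ((evidence_exponent + 1 + 2 * \<alpha>) * real (l + 1))"
proof -
  have "2 / density_floor * (exp (evidence_exponent * real (l + 1)) * sqrt (real n))
      \<le> 2 / density_floor * (exp (evidence_exponent * real (l + 1)) * exp ((1 + 2 * \<alpha>) * real (l + 1)))"
    using density_floor_pos high_level_sqrt_le[OF \<alpha>_pos assms] by (intro mult_left_mono) auto
  then show ?thesis
    unfolding inverse_evidence_floor by (simp add: exp_add[symmetric] algebra_simps)
qed

text \<open>With this radius the prior tails beat the loss in the bound above by \<open>exp (- (l + 1))\<close>, which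
  pays for the \<open>2 ^ l\<close> coefficients of the level.\<close>

definition tail_radius :: real where
  "tail_radius = ((evidence_exponent + 2 + 2 * \<alpha>) * 2 / b2) powr (1 / (1 + \<delta>))"

lemma tail_radius_powr: "b2 / 2 * tail_radius powr (1 + \<delta>) = evidence_exponent + 2 + 2 * \<alpha>"
proof -
  have "tail_radius powr (1 + \<delta>) = (evidence_exponent + 2 + 2 * \<alpha>) * 2 / b2"
    unfolding tail_radius_def using evidence_exponent_nonneg \<alpha>_pos consts_pos by (simp add: powr_powr)
  then show ?thesis using consts_pos by simp
qed

definition low_risk_const :: real where
  "low_risk_const = 2 * sqrt 2 * (1 + moment_const) / density_floor"

definition excess_const :: real where
  "excess_const = 4 * sqrt (6 * evidence_exponent + 7) + (low_risk_const + sqrt low_risk_const)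
    + (tail_radius + B) + 2 * exp_moment / density_floor"

lemma low_risk_const_nonneg: "0 \<le> low_risk_const"
  using moment_const_nonneg density_floor_pos by (simp add: low_risk_const_def)

lemma excess_const_ge:
  "4 * sqrt (6 * evidence_exponent + 7) \<le> excess_const"
  "low_risk_const + sqrt low_risk_const \<le> excess_const"
  "tail_radius + B \<le> excess_const"
  "2 * exp_moment / density_floor \<le> excess_const"
proof -
  have "0 \<le> sqrt (6 * evidence_exponent + 7)" "0 \<le> tail_radius" "0 \<le> 2 * exp_moment / density_floor"
    "0 \<le> sqrt low_risk_const"
    using evidence_exponent_nonneg exp_moment_nonneg density_floor_pos low_risk_const_nonneg
    by (simp_all add: tail_radius_def)
  then show "4 * sqrt (6 * evidence_exponent + 7) \<le> excess_const"
    "low_risk_const + sqrt low_risk_const \<le> excess_const"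
    "tail_radius + B \<le> excess_const"
    "2 * exp_moment / density_floor \<le> excess_const"
    using low_risk_const_nonneg B_nonneg by (simp_all add: excess_const_def)
qed

lemma excess_const_pos: "0 < excess_const"
proof -
  have "0 < 4 * sqrt (6 * evidence_exponent + 7)"
    using evidence_exponent_nonneg by simp
  then show ?thesis using excess_const_ge(1) by linarith
qed

end

locale besov_posterior = besov_model +
  fixes n :: nat and K :: "(nat \<times> nat \<Rightarrow> real) \<Rightarrow> (nat \<times> nat \<Rightarrow> real) measure"
  assumes n_ge_2: "2 \<le> n" and is_posterior_K: "is_posterior (wav_prior \<phi> \<sigma>) (obs_law n) K"
begin

abbreviation s :: real where
  "s \<equiv> 1 / sqrt (real n)"

abbreviation p :: "real \<Rightarrow> real \<Rightarrow> real" where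
  "p \<equiv> \<lambda>\<theta>. normal_density \<theta> s"

sublocale gaussian_sequence s wav_index coord_prior
proof (intro gaussian_sequence.intro sequence_model.intro gaussian_sequence_axioms.intro
    sequence_model_axioms.intro)
  show "0 < s" using n_ge_2 by simp
  then show "likelihood p" by (rule likelihood_normal_density)
  show "prob_space (coord_prior i)" "sets (coord_prior i) = sets borel" for i
    by (simp_all add: coord_prior_def prob_space_scaled \<sigma>_pos split: prod.split)
qed

lemma obs_eq_obs_law: "obs = obs_law n"
  unfolding obs_def[abs_def] obs_law_def[abs_def] ..

sublocale sequence_posterior p wav_index coord_prior K
  by unfold_locales
    (use is_posterior_K in \<open>simp_all add: is_posterior_def wav_prior_eq coef_space_def obs_eq_obs_law\<close>)

lemma marginal_absolutely_continuous_obs: "absolutely_continuous marginal (obs \<theta>\<^sub>0)"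
  by (rule marginal_absolutely_continuous[OF _ sum_second_moments_finite]) simp

abbreviation threshold :: "nat \<Rightarrow> real" where
  "threshold l \<equiv> excess_const * level_rate \<alpha> n l"

lemma threshold_nonneg: "0 \<le> threshold l"
  using excess_const_pos level_rate_nonneg[OF \<alpha>_pos n_ge_2] by simp

lemma low_level_tail_le:
  assumes "2 ^ l \<le> resolution \<alpha> n"
  shows "sqrt 2 * exp (- (threshold l / 2)\<^sup>2 / (4 * s\<^sup>2)) \<le> sqrt 2 * real n powr - (6 * evidence_exponent + 7)"
proof -
  define q where "q = 6 * evidence_exponent + 7"
  have q_nonneg: "0 \<le> q" using evidence_exponent_nonneg by (simp add: q_def)
  then have "16 * q = (4 * sqrt q)\<^sup>2" by (simp add: power_mult_distrib)
  also have "\<dots> \<le> excess_const\<^sup>2" using excess_const_ge(1) q_nonneg unfolding q_def by (intro power_mono) auto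
  finally have "q * ln (real n) \<le> excess_const\<^sup>2 / 16 * ln (real n)"
    using ln_ge_half[OF n_ge_2] by (intro mult_right_mono) auto
  also have "\<dots> = (threshold l / 2)\<^sup>2 / (4 * s\<^sup>2)"
    using assms n_ge_2 ln_ge_half[OF n_ge_2] by (simp add: level_rate_def power_mult_distrib power_divide)
  finally show ?thesis
    using n_ge_2 unfolding q_def[symmetric] by (simp add: powr_def)
qed

lemma low_level_tail_evidence_le:
  assumes low: "2 ^ l \<le> resolution \<alpha> n"
  shows "sqrt 2 * exp (- (threshold l / 2)\<^sup>2 / (4 * s\<^sup>2)) * (1 + moment_const) / evidence_floor n l
    \<le> low_risk_const * real n powr - 6"
proof -
  have "sqrt 2 * exp (- (threshold l / 2)\<^sup>2 / (4 * s\<^sup>2)) * (1 / evidence_floor n l)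
      \<le> (sqrt 2 * real n powr - (6 * evidence_exponent + 7))
        * (2 / density_floor * real n powr (6 * evidence_exponent + 1))"
    using evidence_floor_pos[OF n_ge_2, of l]
    by (intro mult_mono low_level_tail_le low inverse_evidence_floor_low_level_le n_ge_2) auto
  also have "\<dots> = 2 * sqrt 2 / density_floor * real n powr - 6"
    by (simp add: powr_add[symmetric])
  finally have "sqrt 2 * exp (- (threshold l / 2)\<^sup>2 / (4 * s\<^sup>2)) * (1 / evidence_floor n l) * (1 + moment_const)
      \<le> 2 * sqrt 2 / density_floor * real n powr - 6 * (1 + moment_const)"
    using moment_const_nonneg by (intro mult_right_mono) auto
  then show ?thesis
    by (simp add: low_risk_const_def mult_ac)
qed

lemma low_level_risk_le:
  assumes k_less: "k < 2 ^ l" and low: "2 ^ l \<le> resolution \<alpha> n"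
  shows "posterior_risk p (coord_prior (l, k)) (\<theta>\<^sub>0 (l, k)) (excess (threshold l) (\<theta>\<^sub>0 (l, k)))
    \<le> ennreal (threshold l / 2 ^ l)"
proof -
  let ?m = moment_const and ?c = "evidence_floor n l" and ?G = low_risk_const
  define T where "T = sqrt 2 * exp (- (threshold l / 2)\<^sup>2 / (4 * s\<^sup>2))"
  have "(\<integral>\<^sup>+\<theta>. ennreal ((\<theta> - \<theta>\<^sub>0 (l, k))\<^sup>2) \<partial>coord_prior (l, k)) \<le> ennreal ?m"
  proof (rule order_trans[OF second_moment_le[OF k_less] ennreal_leI])
    show "?m * (level_scale \<alpha> l)\<^sup>2 \<le> ?m"
      using moment_const_nonneg level_scale_le_1[OF \<alpha>_pos] level_scale_pos[of \<alpha> l]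
      by (intro mult_right_le_one_le) (auto intro: power_le_one less_imp_le)
  qed
  then have "posterior_risk p (coord_prior (l, k)) (\<theta>\<^sub>0 (l, k)) (excess (threshold l) (\<theta>\<^sub>0 (l, k)))
      \<le> ennreal (T * (1 + ?m) / ?c + sqrt (T * ?m / ?c))"
    unfolding T_def
    by (rule coord.posterior_excess_le_tails[OF evidence_floor_pos[OF n_ge_2] evidence_ge[OF n_ge_2 k_less]
          threshold_nonneg moment_const_nonneg])
  also have "T * (1 + ?m) / ?c + sqrt (T * ?m / ?c) \<le> threshold l / 2 ^ l"
  proof -
    have near_le: "T * (1 + ?m) / ?c \<le> ?G * real n powr - 6"
      unfolding T_def by (rule low_level_tail_evidence_le[OF low])
    have "T * ?m / ?c \<le> T * (1 + ?m) / ?c"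
      using evidence_floor_pos[OF n_ge_2, of l] by (intro divide_right_mono mult_left_mono) (auto simp: T_def)
    then have "sqrt (T * ?m / ?c) \<le> sqrt (?G * real n powr - 6)"
      using near_le by (intro real_sqrt_le_mono) simp
    also have "\<dots> = sqrt ?G * real n powr - 3"
      by (simp add: real_sqrt_mult powr_half_sqrt[symmetric] powr_powr)
    finally have far_le: "sqrt (T * ?m / ?c) \<le> sqrt ?G * real n powr - 3" .
    have "?G * real n powr - 6 \<le> ?G * real n powr - 3"
      using low_risk_const_nonneg n_ge_2 by (intro mult_left_mono powr_mono) auto
    with near_le far_le have "T * (1 + ?m) / ?c + sqrt (T * ?m / ?c) \<le> (?G + sqrt ?G) * real n powr - 3"
      by (simp add: distrib_right)
    also have "\<dots> \<le> excess_const * (level_rate \<alpha> n l / 2 ^ l)"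
      using excess_const_ge(2) excess_const_pos low_level_rate_ge[OF \<alpha>_pos n_ge_2 low] by (intro mult_mono) auto
    finally show ?thesis by simp
  qed
  finally show ?thesis by (simp add: ennreal_leI)
qed

lemma high_level_risk_le:
  assumes k_less: "k < 2 ^ l" and high: "\<not> 2 ^ l \<le> resolution \<alpha> n"
  shows "posterior_risk p (coord_prior (l, k)) (\<theta>\<^sub>0 (l, k)) (excess (threshold l) (\<theta>\<^sub>0 (l, k)))
    \<le> ennreal (threshold l / 2 ^ l)"
proof -
  let ?c = "evidence_floor n l" and ?L = "real (l + 1)"
  let ?R = "tail_radius * ?L powr (1 / (1 + \<delta>))"
  have R_nonneg: "0 \<le> ?R" by (simp add: tail_radius_def)
  have tail_exponent: "b2 / 2 * ?R powr (1 + \<delta>) = (evidence_exponent + 2 + 2 * \<alpha>) * ?L"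
    unfolding tail_radius_powr[symmetric] using consts_pos by (simp add: tail_radius_def powr_mult powr_powr)
  have "\<sigma> l * ?R + \<bar>\<theta>\<^sub>0 (l, k)\<bar> \<le> (tail_radius + B) * level_scale \<alpha> l"
    using coeff_le[OF k_less] \<sigma>_mult[of l] by (simp add: mult.left_commute[of "\<sigma> l"] distrib_right)
  also have "\<dots> \<le> threshold l"
    using high excess_const_ge(3) level_scale_pos[of \<alpha> l] by (simp add: level_rate_def)
  finally have prior_excess: "(\<integral>\<^sup>+\<theta>. excess (threshold l) (\<theta>\<^sub>0 (l, k)) \<theta> \<partial>coord_prior (l, k))
      \<le> ennreal (\<sigma> l * exp (- ((evidence_exponent + 2 + 2 * \<alpha>) * ?L)) * exp_moment)"
    using scaled_excess_le[OF \<sigma>_pos R_nonneg] unfolding tail_exponent by (simp add: coord_prior_def)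
  have "posterior_risk p (coord_prior (l, k)) (\<theta>\<^sub>0 (l, k)) (excess (threshold l) (\<theta>\<^sub>0 (l, k)))
      \<le> ennreal (1 / ?c) * (\<integral>\<^sup>+\<theta>. excess (threshold l) (\<theta>\<^sub>0 (l, k)) \<theta> \<partial>coord_prior (l, k))"
    by (rule coord.posterior_risk_le[OF _ evidence_floor_pos[OF n_ge_2] evidence_ge[OF n_ge_2 k_less]]) measurable
  also have "\<dots> \<le> ennreal (1 / ?c) * ennreal (\<sigma> l * exp (- ((evidence_exponent + 2 + 2 * \<alpha>) * ?L)) * exp_moment)"
    using prior_excess by (rule mult_left_mono) simp
  also have "\<dots> = ennreal (1 / ?c * (\<sigma> l * exp (- ((evidence_exponent + 2 + 2 * \<alpha>) * ?L)) * exp_moment))"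
    using evidence_floor_pos[OF n_ge_2, of l] by (simp add: ennreal_mult'[symmetric])
  also have "1 / ?c * (\<sigma> l * exp (- ((evidence_exponent + 2 + 2 * \<alpha>) * ?L)) * exp_moment)
      \<le> 2 / density_floor * exp ((evidence_exponent + 1 + 2 * \<alpha>) * ?L)
        * (level_scale \<alpha> l * exp (- ((evidence_exponent + 2 + 2 * \<alpha>) * ?L)) * exp_moment)"
    using inverse_evidence_floor_high_level_le[OF n_ge_2 high] \<sigma>_le[of l] \<sigma>_pos[of l]
      exp_moment_nonneg density_floor_pos
    by (intro mult_mono) auto
  also have "\<dots> = 2 * exp_moment / density_floor * level_scale \<alpha> l * exp (- ?L)"
    by (simp add: mult_ac exp_add[symmetric]) (simp add: algebra_simps)
  also have "\<dots> \<le> excess_const * level_scale \<alpha> l * (1 / 2 ^ l)"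
  proof (intro mult_mono)
    have "2 ^ l \<le> exp ?L"
      by (rule order_trans[OF two_power_le_exp]) simp
    then have "inverse (exp ?L) \<le> inverse (2 ^ l)"
      by (rule le_imp_inverse_le) simp
    then show "exp (- ?L) \<le> 1 / 2 ^ l"
      by (simp only: exp_minus inverse_eq_divide)
  qed (use excess_const_ge(4) excess_const_pos level_scale_pos[of \<alpha> l] in auto)
  finally show ?thesis
    using high by (simp add: level_rate_def ennreal_leI)
qed

lemma mean_posterior_excess_le:
  assumes "k < 2 ^ l"
  shows "(\<integral>\<^sup>+\<theta>. excess (threshold l) (\<theta>\<^sub>0 (l, k)) (\<theta> (l, k)) \<partial>mean_posterior \<theta>\<^sub>0) \<le> ennreal (threshold l / 2 ^ l)"
proof -
  have "(\<integral>\<^sup>+\<theta>. excess (threshold l) (\<theta>\<^sub>0 (l, k)) (\<theta> (l, k)) \<partial>mean_posterior \<theta>\<^sub>0)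
      = posterior_risk p (coord_prior (l, k)) (\<theta>\<^sub>0 (l, k)) (excess (threshold l) (\<theta>\<^sub>0 (l, k)))"
    using assms by (intro nn_integral_mean_posterior_component marginal_absolutely_continuous_obs)
      (auto simp: wav_index_def)
  also have "\<dots> \<le> ennreal (threshold l / 2 ^ l)"
    using assms low_level_risk_le high_level_risk_le by (cases "2 ^ l \<le> resolution \<alpha> n") auto
  finally show ?thesis .
qed

lemma excess_component_measurable [measurable]:
  "k < 2 ^ l \<Longrightarrow> (\<lambda>\<theta>. excess a b (\<theta> (l, k))) \<in> borel_measurable (PiM wav_index coord_prior)"
  by (intro excess_measurable component_measurable) (simp add: wav_index_def)

lemma mean_posterior_level_le:
  "(\<integral>\<^sup>+\<theta>. ennreal (threshold l) + (\<Sum>k<2 ^ l. excess (threshold l) (\<theta>\<^sub>0 (l, k)) (\<theta> (l, k))) \<partial>mean_posterior \<theta>\<^sub>0)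
    \<le> ennreal (2 * threshold l)"
proof -
  interpret mean_posterior: prob_space "mean_posterior \<theta>\<^sub>0" by (rule prob_space_mean_posterior)
  have measurable: "(\<lambda>\<theta>. excess (threshold l) (\<theta>\<^sub>0 (l, k)) (\<theta> (l, k))) \<in> borel_measurable (mean_posterior \<theta>\<^sub>0)"
    if "k < 2 ^ l" for k
    using that excess_component_measurable by (simp cong: measurable_cong_sets add: sets_mean_posterior)
  have "(\<integral>\<^sup>+\<theta>. ennreal (threshold l) + (\<Sum>k<2 ^ l. excess (threshold l) (\<theta>\<^sub>0 (l, k)) (\<theta> (l, k))) \<partial>mean_posterior \<theta>\<^sub>0)
      = ennreal (threshold l)
        + (\<integral>\<^sup>+\<theta>. (\<Sum>k<2 ^ l. excess (threshold l) (\<theta>\<^sub>0 (l, k)) (\<theta> (l, k))) \<partial>mean_posterior \<theta>\<^sub>0)"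
    using measurable by (subst nn_integral_add) (auto simp: mean_posterior.emeasure_space_1)
  also have "(\<integral>\<^sup>+\<theta>. (\<Sum>k<2 ^ l. excess (threshold l) (\<theta>\<^sub>0 (l, k)) (\<theta> (l, k))) \<partial>mean_posterior \<theta>\<^sub>0)
      = (\<Sum>k<2 ^ l. \<integral>\<^sup>+\<theta>. excess (threshold l) (\<theta>\<^sub>0 (l, k)) (\<theta> (l, k)) \<partial>mean_posterior \<theta>\<^sub>0)"
    using measurable by (intro nn_integral_sum) auto
  also have "ennreal (threshold l) + \<dots> \<le> ennreal (threshold l) + (\<Sum>k<(2::nat) ^ l. ennreal (threshold l / 2 ^ l))"
    using mean_posterior_excess_le by (intro add_left_mono sum_mono) auto
  also have "(\<Sum>k<(2::nat) ^ l. ennreal (threshold l / 2 ^ l)) = ennreal (threshold l)"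
    using threshold_nonneg[of l] by (subst sum_ennreal) auto
  finally show ?thesis
    using threshold_nonneg[of l] by (simp only: ennreal_plus[symmetric] mult_2)
qed

end

lemma (in besov_model) posterior_sup_dist_le:
  assumes n_ge_2: "2 \<le> n" and "is_posterior (wav_prior \<phi> \<sigma>) (obs_law n) K"
    and "wavelet \<psi> \<alpha> C" and square_integrable_f0: "square_integrable_01 f0"
    and \<theta>\<^sub>0_eq: "\<theta>\<^sub>0 = (\<lambda>(l, k). ip01 f0 (\<psi> l k))"
  shows "(\<integral>\<^sup>+x. (\<integral>\<^sup>+\<theta>. sup_dist \<psi> f0 \<theta> \<partial>K x) \<partial>obs_law n \<theta>\<^sub>0)
    \<le> ennreal (2 * C * excess_const * rate_const \<alpha> * (ln (real n) / real n) powr (\<alpha> / (2 * \<alpha> + 1)))"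
proof -
  interpret besov_posterior \<phi> b1 b2 c1 c2 \<delta> \<alpha> B \<theta>\<^sub>0 n K by unfold_locales fact+
  interpret wavelet \<psi> \<alpha> C by fact
  let ?S = "\<lambda>l \<theta>. ennreal (threshold l) + (\<Sum>k<2 ^ l. excess (threshold l) (\<theta>\<^sub>0 (l, k)) (\<theta> (l, k)))"
  have "summable (\<lambda>l. C * B * (2 powr - \<alpha>) ^ l)"
    using two_powr_minus_less_1[OF \<alpha>_pos] by (intro summable_mult summable_geometric) simp
  then have summable: "summable (\<lambda>l. C * 2 powr (real l / 2) * (B * level_scale \<alpha> l))"
    unfolding powr_half_mult_level_scale[symmetric] by (simp add: mult_ac)
  have "sup_dist \<psi> f0 \<theta> \<le> (\<Sum>l. ennreal (C * 2 powr (real l / 2)) * ?S l \<theta>)" for \<theta>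
    using sup_dist_le_excess[OF square_integrable_f0 _ summable threshold_nonneg, of \<theta>] coeff_le
    by (simp add: \<theta>\<^sub>0_eq)
  then have "(\<integral>\<^sup>+x. (\<integral>\<^sup>+\<theta>. sup_dist \<psi> f0 \<theta> \<partial>K x) \<partial>obs_law n \<theta>\<^sub>0)
      \<le> (\<integral>\<^sup>+\<theta>. (\<Sum>l. ennreal (C * 2 powr (real l / 2)) * ?S l \<theta>) \<partial>mean_posterior \<theta>\<^sub>0)"
    by (subst nn_integral_mean_posterior) (auto simp: obs_eq_obs_law intro!: nn_integral_mono)
  also have "\<dots> = (\<Sum>l. ennreal (C * 2 powr (real l / 2)) * (\<integral>\<^sup>+\<theta>. ?S l \<theta> \<partial>mean_posterior \<theta>\<^sub>0))"
    by (simp add: nn_integral_suminf nn_integral_cmult)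
  also have "\<dots> \<le> (\<Sum>l. ennreal (C * 2 powr (real l / 2)) * ennreal (2 * threshold l))"
    by (intro suminf_le mult_left_mono mean_posterior_level_le summableI) auto
  also have "\<dots> = (\<Sum>l. ennreal (2 * C * excess_const) * ennreal (2 powr (real l / 2) * level_rate \<alpha> n l))"
    using C_pos excess_const_pos level_rate_nonneg[OF \<alpha>_pos n_ge_2]
    by (intro suminf_cong) (simp add: ennreal_mult[symmetric] mult_ac)
  also have "\<dots> = ennreal (2 * C * excess_const) * (\<Sum>l. ennreal (2 powr (real l / 2) * level_rate \<alpha> n l))"
    by (rule ennreal_suminf_cmult)
  also have "\<dots> \<le> ennreal (2 * C * excess_const)
      * ennreal (rate_const \<alpha> * (ln (real n) / real n) powr (\<alpha> / (2 * \<alpha> + 1)))"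
    by (intro mult_left_mono suminf_level_rate_le \<alpha>_pos n_ge_2) auto
  also have "\<dots> = ennreal (2 * C * excess_const * rate_const \<alpha> * (ln (real n) / real n) powr (\<alpha> / (2 * \<alpha> + 1)))"
    using C_pos excess_const_pos rate_const_pos[OF \<alpha>_pos] by (simp add: ennreal_mult[symmetric] mult.assoc)
  finally show ?thesis .
qed

theorem theorem1:
  fixes \<alpha> :: real and \<psi> :: "nat \<Rightarrow> nat \<Rightarrow> real \<Rightarrow> real"
    and f0 :: "real \<Rightarrow> real" and \<phi> :: "real \<Rightarrow> real"
    and b1 b2 c1 c2 \<delta> :: real
  assumes \<alpha>_pos: "\<alpha> > 0"
    and wav: "wavelet_basis \<psi> \<alpha>"
    and f0_meas: "f0 \<in> borel_measurable lborel"
    and f0_L2: "set_integrable lborel {0..1} (\<lambda>t. (f0 t)\<^sup>2)"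
    and f0_besov: "\<exists>B. \<forall>l k. k < 2 ^ l \<longrightarrow>
                     2 powr (real l * (1 / 2 + \<alpha>)) * \<bar>ip01 f0 (\<psi> l k)\<bar> \<le> B"
    and \<phi>_cont: "continuous_on UNIV \<phi>"
    and \<phi>_nonneg: "\<And>x. \<phi> x \<ge> 0"
    and \<phi>_int: "(\<integral>\<^sup>+ x. ennreal (\<phi> x) \<partial>lborel) = 1"
    and \<phi>_pos: "\<And>x. \<bar>x\<bar> \<le> 1 \<Longrightarrow> \<phi> x > 0"
    and consts_pos: "b1 > 0" "b2 > 0" "c1 > 0" "c2 > 0" "\<delta> > 0"
    and \<phi>_tails: "\<And>x. \<bar>x\<bar> \<ge> 1 \<Longrightarrow>
        c1 * exp (- b1 * \<bar>x\<bar> powr (1 + \<delta>)) \<le> \<phi> x \<and> \<phi> x \<le> c2 * exp (- b2 * \<bar>x\<bar> powr (1 + \<delta>))"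
  shows "\<exists>M>0. \<forall>n::nat. n \<ge> 2 \<longrightarrow>
     (\<forall>K. is_posterior
            (wav_prior \<phi> (\<lambda>l. 2 powr (- real l * (1 / 2 + \<alpha>)) / real (l + 1) powr (1 / (1 + \<delta>))))
            (obs_law n) K \<longrightarrow>
        (\<integral>\<^sup>+ x. (\<integral>\<^sup>+ \<theta>. sup_dist \<psi> f0 \<theta> \<partial>K x)
            \<partial>obs_law n (\<lambda>(l, k). ip01 f0 (\<psi> l k)))
        \<le> ennreal (M * (ln (real n) / real n) powr (\<alpha> / (2 * \<alpha> + 1))))"
proof -
  obtain B where "\<And>l k. k < 2 ^ l \<Longrightarrow> 2 powr (real l * (1 / 2 + \<alpha>)) * \<bar>ip01 f0 (\<psi> l k)\<bar> \<le> B"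
    using f0_besov by blast
  then have coeff_le: "\<bar>ip01 f0 (\<psi> l k)\<bar> \<le> B * level_scale \<alpha> l" if "k < 2 ^ l" for l k
    using that by (simp add: level_scale_def powr_minus_divide pos_le_divide_eq mult.commute)
  obtain C where "C > 0" "\<And>l t. t \<in> {0..1} \<Longrightarrow> (\<Sum>k<2 ^ l. \<bar>\<psi> l k t\<bar>) \<le> C * 2 powr (real l / 2)"
    using wav unfolding wavelet_basis_def by blast
  with wav interpret wavelet \<psi> \<alpha> C by (intro wavelet.intro)
  interpret besov_model \<phi> b1 b2 c1 c2 \<delta> \<alpha> B "\<lambda>(l, k). ip01 f0 (\<psi> l k)"
    by unfold_locales (fact assms | simp add: coeff_le)+
  have "square_integrable_01 f0"
    using f0_meas f0_L2 by (simp add: square_integrable_01_def)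
  have "(\<integral>\<^sup>+x. (\<integral>\<^sup>+\<theta>. sup_dist \<psi> f0 \<theta> \<partial>K x) \<partial>obs_law n (\<lambda>(l, k). ip01 f0 (\<psi> l k)))
      \<le> ennreal (2 * C * excess_const * rate_const \<alpha> * (ln (real n) / real n) powr (\<alpha> / (2 * \<alpha> + 1)))"
    if "2 \<le> n" "is_posterior (wav_prior \<phi> \<sigma>) (obs_law n) K" for n K
    using that wavelet_axioms \<open>square_integrable_01 f0\<close> by (intro posterior_sup_dist_le refl)
  moreover have "0 < 2 * C * excess_const * rate_const \<alpha>"
    using C_pos excess_const_pos rate_const_pos[OF \<alpha>_pos] by simp
  ultimately show ?thesis
    unfolding \<sigma>_def[abs_def] level_scale_def by blast
qed

end
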